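(* Let $n\ge 3$ and $d\ge 4$. Then there is no $I\in\mathcal{T}^s(n,d)$ with $\mu(I)=2n+3$.
   Context: $k$ is an algebraically closed field of characteristic zero and $R=k[x_0,\dots,x_n]$. Togliatti systems. Let $I\subset R$ be a homogeneous artinian ideal generated by $r$ forms $F_1,\dots,F_r$ of degree $d$, with $r\le\binom{n+d-1}{n-1}$. $I$ is a Togliatti system (of forms of degree $d$) if it satisfies the following (known to be equivalent) conditions: (1) $I$ fails the weak Lefschetz property in degree $d-1$, i.e. for a general linear form $L$ the multiplication map $\times L:(R/I)_{d-1}\to(R/I)_d$ does not have maximal rank (is neither injective nor surjective); (2) $F_1,\dots,F_r$ become $k$-linearly dependent on a general hyperplane of $\mathbb{P}^n$; (3) the variety $X$ associated to $I$ satisfies at least one Laplace equation of order $d-1$, i.e. its $(d-1)$-st osculating space at a general point has dimension less than $\binom{n+d-1}{d-1}-1$. It is monomial if $I$ is generated by monomials. For a monomial $I$, $X$ is the closure of the image of the rational map $\mathbb{P}^n\dashrightarrow\mathbb{P}^{\binom{n+d}{d}-r-1}$ given by all monomials of degree $d$ not in $I$ (here $r$ is the minimal number of generators). A monomial Togliatti system is smooth if $X$ is a smooth variety. It is minimal if, $I$ being generated by monomials $m_1,\dots,m_r$ of degree $d$, no proper subset of $\{m_1,\dots,m_r\}$ generates a monomial Togliatti system. $\mu(I)$ is the minimal number of generators of $I$. $\mathcal{T}^s(n,d)$ is the set of all minimal smooth monomial Togliatti systems $I\subset k[x_0,\dots,x_n]$ of forms of degree $d$. *)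

theory Defs
  imports
    "HOL-Analysis.Analysis"
    "HOL-Computational_Algebra.Polynomial"
    "HOL-Library.Poly_Mapping"
    "HOL-Library.Function_Algebras"
    "HOL-Library.Extended_Nat"
begin

section \<open>Multivariate polynomials\<close>

text \<open>
  A monomial in variables indexed by \<^typ>\<open>'i\<close> is given by its exponent vector, of type
  \<^typ>\<open>'i \<Rightarrow>\<^sub>0 nat\<close>; a polynomial is a finitely supported function from exponent vectors to
  coefficients, multiplied by convolution. The ring \<open>k[x\<^sub>0,\<dots>,x\<^sub>n]\<close> is
  \<open>('v, 'k) mpoly\<close> for a finite index type \<open>'v\<close> with \<open>n + 1\<close> elements.
\<close>

type_synonym 'i exponent = "'i \<Rightarrow>\<^sub>0 nat"
type_synonym ('i, 'k) mpoly = "('i \<Rightarrow>\<^sub>0 nat) \<Rightarrow>\<^sub>0 'k"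

definition exp_degree :: "'i exponent \<Rightarrow> nat" where
  "exp_degree m = (\<Sum>i\<in>Poly_Mapping.keys m. Poly_Mapping.lookup m i)"

definition monom_of :: "'i exponent \<Rightarrow> ('i, 'k::comm_ring_1) mpoly" where
  "monom_of m = Poly_Mapping.single m 1"

definition is_form :: "nat \<Rightarrow> ('i, 'k::comm_ring_1) mpoly \<Rightarrow> bool" where
  "is_form e F \<longleftrightarrow> (\<forall>m\<in>Poly_Mapping.keys F. exp_degree m = e)"

definition poly_vars :: "('i, 'k::comm_ring_1) mpoly \<Rightarrow> 'i set" where
  "poly_vars F = (\<Union>m\<in>Poly_Mapping.keys F. Poly_Mapping.keys m)"

definition eval_monom :: "('i \<Rightarrow> 'k::comm_ring_1) \<Rightarrow> 'i exponent \<Rightarrow> 'k" where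
  "eval_monom a m = (\<Prod>i\<in>Poly_Mapping.keys m. a i ^ Poly_Mapping.lookup m i)"

definition eval_mpoly :: "('i \<Rightarrow> 'k::comm_ring_1) \<Rightarrow> ('i, 'k) mpoly \<Rightarrow> 'k" where
  "eval_mpoly a F = (\<Sum>m\<in>Poly_Mapping.keys F. Poly_Mapping.lookup F m * eval_monom a m)"

definition partial_deriv :: "'i \<Rightarrow> ('i, 'k::comm_ring_1) mpoly \<Rightarrow> ('i, 'k) mpoly" where
  "partial_deriv i F = (\<Sum>m\<in>Poly_Mapping.keys F.
     Poly_Mapping.single (m - Poly_Mapping.single i 1)
       (of_nat (Poly_Mapping.lookup m i) * Poly_Mapping.lookup F m))"

definition linear_form :: "('v::finite \<Rightarrow> 'k::comm_ring_1) \<Rightarrow> ('v, 'k) mpoly" where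
  "linear_form a = (\<Sum>i\<in>UNIV. Poly_Mapping.single (Poly_Mapping.single i 1) (a i))"


section \<open>Ideals\<close>

text \<open>
  Ideals are the submodules of a commutative ring regarded as a module over itself.
\<close>

lemma module_self: "module ((*) :: 'r::comm_ring_1 \<Rightarrow> 'r \<Rightarrow> 'r)"
  by unfold_locales (simp_all add: algebra_simps)

definition is_ideal :: "'r::comm_ring_1 set \<Rightarrow> bool" where
  "is_ideal I \<longleftrightarrow> module.subspace (*) I"

definition ideal_gen :: "'r::comm_ring_1 set \<Rightarrow> 'r set" where
  "ideal_gen S = module.span (*) S"

text \<open>
  Descending chain condition for the ideals of the quotient ring by \<open>I\<close>, which correspond to the
  ideals containing \<open>I\<close>.
\<close>

definition artinian_ideal :: "'r::comm_ring_1 set \<Rightarrow> bool" where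
  "artinian_ideal I \<longleftrightarrow> is_ideal I \<and>
     (\<forall>J :: nat \<Rightarrow> 'r set. (\<forall>i. is_ideal (J i) \<and> I \<subseteq> J i \<and> J (Suc i) \<subseteq> J i)
        \<longrightarrow> (\<exists>N. \<forall>i\<ge>N. J i = J N))"

definition min_num_gens :: "'r::comm_ring_1 set \<Rightarrow> nat" where
  "min_num_gens I = (LEAST r. \<exists>S. finite S \<and> card S = r \<and> ideal_gen S = I)"


section \<open>Zariski topologies\<close>

definition affine_zariski :: "('i::finite \<Rightarrow> 'k::field) topology" where
  "affine_zariski = topology_generated_by {{a. eval_mpoly a F \<noteq> 0} | F. True}"

text \<open>
  Projective space with homogeneous coordinates indexed by the finite set \<open>M\<close>. A point is
  represented by all its (nonzero) coordinate vectors, which are extended by \<open>0\<close> outside of \<open>M\<close>;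
  since the topology is generated by the nonvanishing loci of forms, its open and closed sets are
  stable under nonzero scaling, and they correspond to those of the space of lines.
\<close>

definition coord_space :: "'i set \<Rightarrow> ('i \<Rightarrow> 'k::field) set" where
  "coord_space M = {p. \<forall>i. i \<notin> M \<longrightarrow> p i = 0}"

definition proj_zariski :: "'i set \<Rightarrow> ('i \<Rightarrow> 'k::field) topology" where
  "proj_zariski M = topology_generated_by
     {{p \<in> coord_space M. p \<noteq> 0 \<and> eval_mpoly p F \<noteq> 0} | F. poly_vars F \<subseteq> M \<and> (\<exists>e. is_form e F)}"

definition irreducible_closedin :: "'a topology \<Rightarrow> 'a set \<Rightarrow> bool" where
  "irreducible_closedin T Z \<longleftrightarrow> closedin T Z \<and> Z \<noteq> {} \<and>
     (\<forall>A B. closedin T A \<and> closedin T B \<and> Z = A \<union> B \<longrightarrow> Z = A \<or> Z = B)"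

definition krull_dim :: "'a topology \<Rightarrow> enat" where
  "krull_dim T = Sup {enat l | l. \<exists>Z :: nat \<Rightarrow> 'a set.
     (\<forall>i\<le>l. irreducible_closedin T (Z i)) \<and> (\<forall>i<l. Z i \<subset> Z (Suc i))}"

text \<open>
  The affine cone over the embedded projective tangent space of \<open>X\<close> at the point represented by
  \<open>p\<close>: the common kernel of the differentials at \<open>p\<close> of the forms in the homogeneous ideal of
  \<open>X\<close>. Its dimension as a vector space exceeds that of the tangent space by one.
\<close>

definition affine_tangent_space :: "'i set \<Rightarrow> ('i \<Rightarrow> 'k::field) set \<Rightarrow> ('i \<Rightarrow> 'k) \<Rightarrow> ('i \<Rightarrow> 'k) set" where
  "affine_tangent_space M X p = {v \<in> coord_space M.
     \<forall>F e. poly_vars F \<subseteq> M \<and> is_form e F \<and> (\<forall>q\<in>X. eval_mpoly q F = 0) \<longrightarrow>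
       (\<Sum>i\<in>M. eval_mpoly p (partial_deriv i F) * v i) = 0}"

lemma vector_space_coords: "vector_space (\<lambda>(c::'k::field) (v::'i \<Rightarrow> 'k) i. c * v i)"
  by unfold_locales (simp_all add: fun_eq_iff algebra_simps)

definition smooth_projective :: "'i set \<Rightarrow> ('i \<Rightarrow> 'k::field) set \<Rightarrow> bool" where
  "smooth_projective M X \<longleftrightarrow> (\<forall>p\<in>X.
     enat (vector_space.dim (\<lambda>c v i. c * v i) (affine_tangent_space M X p))
       = krull_dim (subtopology (proj_zariski M) X) + 1)"


section \<open>Togliatti systems\<close>

definition general_linear_form :: "(('v::finite, 'k::field) mpoly \<Rightarrow> bool) \<Rightarrow> bool" where
  "general_linear_form P \<longleftrightarrow>
     (\<exists>U. openin affine_zariski U \<and> U \<noteq> {} \<and> (\<forall>a\<in>U. P (linear_form a)))"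

definition coset_of :: "'r::comm_ring_1 set \<Rightarrow> 'r \<Rightarrow> 'r set" where
  "coset_of I F = {F + h | h. h \<in> I}"

text \<open>The graded piece \<open>(R/I)\<^sub>j\<close>, as a set of cosets, and the map \<open>F + I \<mapsto> L F + I\<close>.\<close>

definition graded_piece :: "('v, 'k::comm_ring_1) mpoly set \<Rightarrow> nat \<Rightarrow> ('v, 'k) mpoly set set" where
  "graded_piece I j = coset_of I ` {F. is_form j F}"

definition mult_map :: "'r::comm_ring_1 set \<Rightarrow> 'r \<Rightarrow> 'r set \<Rightarrow> 'r set" where
  "mult_map I L C = {L * F + h | F h. F \<in> C \<and> h \<in> I}"

definition fails_wlp :: "nat \<Rightarrow> ('v::finite, 'k::field) mpoly set \<Rightarrow> bool" where
  "fails_wlp j I \<longleftrightarrow> general_linear_form (\<lambda>L.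
     \<not> inj_on (mult_map I L) (graded_piece I j) \<and>
     mult_map I L ` graded_piece I j \<noteq> graded_piece I (Suc j))"

text \<open>Here \<open>P\<^sup>n\<close> is the projective space of lines in \<open>k\<^sup>n\<^sup>+\<^sup>1\<close>, so \<open>n = CARD('v) - 1\<close>.\<close>

definition togliatti_system :: "nat \<Rightarrow> ('v::finite, 'k::field) mpoly set \<Rightarrow> bool" where
  "togliatti_system d I \<longleftrightarrow>
     (\<exists>S. finite S \<and> (\<forall>F\<in>S. is_form d F) \<and> I = ideal_gen S \<and>
        card S \<le> (let n = CARD('v) - 1 in (n + d - 1) choose (n - 1))) \<and>
     artinian_ideal I \<and> fails_wlp (d - 1) I"

definition monomial_togliatti :: "nat \<Rightarrow> ('v::finite, 'k::field) mpoly set \<Rightarrow> bool" where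
  "monomial_togliatti d I \<longleftrightarrow> togliatti_system d I \<and> (\<exists>A. I = ideal_gen (monom_of ` A))"

text \<open>
  The exponents of the monomials of degree \<open>d\<close> not in \<open>I\<close>; they index the coordinates of the
  projective space containing the variety associated to \<open>I\<close>.
\<close>

definition complement_exponents :: "nat \<Rightarrow> ('v::finite, 'k::field) mpoly set \<Rightarrow> 'v exponent set" where
  "complement_exponents d I = {m. exp_degree m = d \<and> monom_of m \<notin> I}"

definition monomial_map :: "'v exponent set \<Rightarrow> ('v::finite \<Rightarrow> 'k::field) \<Rightarrow> ('v exponent \<Rightarrow> 'k)" where
  "monomial_map M a = (\<lambda>m. if m \<in> M then eval_monom a m else 0)"

definition togliatti_variety :: "nat \<Rightarrow> ('v::finite, 'k::field) mpoly set \<Rightarrow> ('v exponent \<Rightarrow> 'k) set" where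
  "togliatti_variety d I = (let M = complement_exponents d I in
     proj_zariski M closure_of {monomial_map M a | a. monomial_map M a \<noteq> 0})"

definition smooth_togliatti :: "nat \<Rightarrow> ('v::finite, 'k::field) mpoly set \<Rightarrow> bool" where
  "smooth_togliatti d I \<longleftrightarrow> smooth_projective (complement_exponents d I) (togliatti_variety d I)"

text \<open>
  The set \<open>A\<close> below is determined by \<open>I\<close>: a set of monomials of degree \<open>d\<close> generating \<open>I\<close>
  consists of all the monomials of degree \<open>d\<close> in \<open>I\<close>.
\<close>

definition minimal_togliatti :: "nat \<Rightarrow> ('v::finite, 'k::field) mpoly set \<Rightarrow> bool" where
  "minimal_togliatti d I \<longleftrightarrow>
     (\<exists>A. (\<forall>m\<in>A. exp_degree m = d) \<and> I = ideal_gen (monom_of ` A) \<and>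
        (\<forall>B. B \<subset> A \<longrightarrow> \<not> monomial_togliatti d (ideal_gen (monom_of ` B) :: ('v, 'k) mpoly set)))"

text \<open>The set \<open>\<T>\<^sup>s(n,d)\<close>, with \<open>n + 1 = CARD('v)\<close>.\<close>

definition minimal_smooth_monomial_togliatti :: "nat \<Rightarrow> ('v::finite, 'k::field) mpoly set set" where
  "minimal_smooth_monomial_togliatti d =
     {I. monomial_togliatti d I \<and> smooth_togliatti d I \<and> minimal_togliatti d I}"

end

theory Submission
  imports Defs
begin

text \<open>
  If \<open>I\<close> is generated by a set \<open>A\<close> of monomials of degree \<open>d\<close>, failure of injectivity yields a form
  \<open>F\<close> of degree \<open>d - 1\<close> such that all monomials of \<open>(x\<^sub>0 + \<dots> + x\<^sub>n) F\<close> lie in \<open>A\<close>, and by minimality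
  \<open>A\<close> consists of these monomials and the pure powers. So the set \<open>S\<close> of monomials of the product that are
  not pure powers has \<open>n + 2\<close> elements. If no pure power occurs in the product, then \<open>|S|\<close> is \<open>n + 1\<close>
  (when \<open>F\<close> is a monomial) or at least \<open>2n\<close>.

  Otherwise let \<open>x\<^sub>t\<^sup>d\<close> occur. Eliminating \<open>x\<^sub>t\<close> by \<open>x\<^sub>t = - \<Sum>x\<^sub>i\<close> gives one linear relation between the
  coefficients of the product for every monomial of degree \<open>d\<close> in the other variables, with nonzero
  contribution of \<open>x\<^sub>t\<^sup>d\<close>; hence every face of the simplex of exponents through \<open>x\<^sub>t\<^sup>d\<close> contains several
  elements of \<open>S\<close>. Smoothness enters through tangent spaces: at a vertex of the toric variety, the
  dimension of the tangent space is at least one more than the number of atoms of the semigroup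
  spanned by the exponents at this vertex, whereas at a general point it is the rank of the exponents. So the
  atoms at a vertex are linearly independent, and a two-dimensional face contains at most two of
  them. Near \<open>x\<^sub>t\<^sup>d\<close> this shows that \<open>S\<close> contains no \<open>x\<^sub>t\<^bsup>d-1\<^esup>x\<^sub>j\<close> and no \<open>x\<^sub>t\<^bsup>d-2\<^esup>x\<^sub>j\<^sup>2\<close>, and counting the elements
  of \<open>S\<close> on a three-dimensional face gives more than the five that are available there.
\<close>

section \<open>Exponents\<close>

text \<open>The counts rest on one feature of the elimination: for every exponent vector
  \<open>a\<close> of degree \<open>d\<close> with all entries below \<open>d\<close>, the terms in
  \<open>S\<close> add up to the same nonzero constant \<open>- top_coeff t\<close>. Few products of
  binomial coefficients cannot be constant in \<open>a\<close>. The five comes from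
  \<open>|S| = (2n + 3) - (n + 1) = n + 2\<close>. Once some \<open>x_t^(d-1) x_k\<close> lies
  outside \<open>S\<close>, every variable outside a tetrahedron through \<open>t\<close> and
  \<open>k\<close> forces an element of \<open>S\<close> of its own, which uses up
  \<open>n - 3\<close> of them and reduces all \<open>n\<close> to one tetrahedron. Such a
  \<open>k\<close> exists by minimality: otherwise \<open>x_t^(d-1)\<close> alone would yield a
  smaller system. The pure powers lie in the ideal, so the vertices examined near
  \<open>x_t^d\<close> are the \<open>x_t^(d-1) x_k\<close>. Smoothness enters by comparing a vertex
  with the point all of whose coordinates are 1: both tangent dimensions equal the Krull dimension
  plus one. Limits are replaced by curves \<open>s \<mapsto> (s^(w_i))\<close>, along which a form
  becomes a polynomial in \<open>s\<close>; over an infinite field it can vanish identically only if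
  it is 0.\<close>

abbreviation "lookup \<equiv> Poly_Mapping.lookup"
abbreviation "keys \<equiv> Poly_Mapping.keys"
abbreviation "single \<equiv> Poly_Mapping.single"

text \<open>A finitely supported \<open>c\<close> on exponents is a monomial in the coordinates of
  the projective space and also a formal sum of exponents. This additive extension of
  \<open>g\<close> serves for its degree, its pull-back along the monomial map, its weight on a
  curve and the values of tangent vectors.\<close>

definition weighted_sum :: "('a \<Rightarrow>\<^sub>0 nat) \<Rightarrow> ('a \<Rightarrow> 'b) \<Rightarrow> 'b::comm_semiring_1" where
  "weighted_sum c g = (\<Sum>b\<in>keys c. of_nat (lookup c b) * g b)"

lemma weighted_sum_superset:
  "finite A \<Longrightarrow> keys c \<subseteq> A \<Longrightarrow> weighted_sum c g = (\<Sum>b\<in>A. of_nat (lookup c b) * g b)"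
  unfolding weighted_sum_def by (rule sum.mono_neutral_left) (auto simp: in_keys_iff)

lemma weighted_sum_add: "weighted_sum (c + c') g = weighted_sum c g + weighted_sum c' g"
proof -
  let ?A = "keys c \<union> keys c'"
  have "keys (c + c') \<subseteq> ?A" by (rule Poly_Mapping.keys_add)
  then show ?thesis
    by (simp add: weighted_sum_superset[of ?A] lookup_add distrib_right sum.distrib)
qed

lemma weighted_sum_single [simp]: "weighted_sum (single b n) g = of_nat n * g b"
  by (simp add: weighted_sum_superset[of "{b}"])

lemma exp_degree_weighted_sum: "exp_degree c = weighted_sum c (\<lambda>_. 1)"
  by (simp add: exp_degree_def weighted_sum_def)

lemma exp_degree_add: "exp_degree (c + c') = exp_degree c + exp_degree c'"
  by (simp add: exp_degree_weighted_sum weighted_sum_add)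

lemma exp_degree_single [simp]: "exp_degree (single a n) = n"
  by (simp add: exp_degree_weighted_sum)

lemma exp_degree_zero [simp]: "exp_degree 0 = 0"
  by (simp add: exp_degree_def)

lemma exp_degree_sum: "exp_degree (m :: 'v::finite exponent) = (\<Sum>i\<in>UNIV. lookup m i)"
  unfolding exp_degree_def by (rule sum.mono_neutral_left) (auto simp: in_keys_iff)

section \<open>The product of a form with the sum of the variables\<close>

text \<open>The form is given by its coefficient function \<open>f\<close>. Subtraction of exponents
  truncates at 0, so the sum has to be restricted to the variables dividing
  \<open>s\<close>.\<close>

definition lsum :: "('v::finite exponent \<Rightarrow> 'k::comm_ring_1) \<Rightarrow> 'v exponent \<Rightarrow> 'k" where
  "lsum f s = (\<Sum>i\<in>Poly_Mapping.keys s. f (s - single i 1))"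

lemma lookup_le_exp_degree: "lookup (m :: 'v::finite exponent) i \<le> exp_degree m"
  unfolding exp_degree_sum using member_le_sum[of i UNIV "lookup m"] by auto

lemma diff_single_add: "i \<in> Poly_Mapping.keys (s :: 'v exponent) \<Longrightarrow>
    s - single i 1 + single i 1 = s"
  by (rule poly_mapping_eqI) (auto simp: lookup_add lookup_minus lookup_single when_def in_keys_iff)

lemma exp_degree_diff_single: "i \<in> Poly_Mapping.keys (s :: 'v::finite exponent) \<Longrightarrow>
    exp_degree (s - single i 1) + 1 = exp_degree s"
  by (metis diff_single_add exp_degree_add exp_degree_single)

lemma finite_exp_degree: "finite {m :: 'v::finite exponent. exp_degree m = d}"
proof -
  have "lookup ` {m :: 'v exponent. exp_degree m = d} \<subseteq> (UNIV :: 'v set) \<rightarrow>\<^sub>E {..d}"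
    using lookup_le_exp_degree by auto
  moreover have "finite ((UNIV :: 'v set) \<rightarrow>\<^sub>E {..d})" by (intro finite_PiE) auto
  ultimately have "finite (lookup ` {m :: 'v exponent. exp_degree m = d})"
    by (rule finite_subset)
  then show ?thesis
    by (rule finite_imageD) (simp add: inj_on_def lookup_inject)
qed

lemma lsum_degree:
  assumes "\<And>b. f b \<noteq> 0 \<Longrightarrow> exp_degree b = e" "lsum f (s :: 'v::finite exponent) \<noteq> 0"
  shows "exp_degree s = Suc e"
proof -
  from assms(2) obtain i where "i \<in> keys s" "f (s - single i 1) \<noteq> 0"
    unfolding lsum_def by (meson sum.neutral)
  with assms(1) exp_degree_diff_single[of i s] show ?thesis by auto
qed

text \<open>The sign and the factorials turn the coefficients of the relation obtained from \<open>x\<^sub>t = - \<Sum>x\<^sub>i\<close> into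
  products of binomial coefficients.\<close>

definition root_coeff :: "('v::finite exponent \<Rightarrow> 'k::comm_ring_1) \<Rightarrow> 'v \<Rightarrow> 'v exponent \<Rightarrow> 'k" where
  "root_coeff f t s = (-1) ^ lookup s t * of_nat (\<Prod>i\<in>UNIV. fact (lookup s i)) * lsum f s"

definition box_weight :: "'v::finite \<Rightarrow> ('v \<Rightarrow> nat) \<Rightarrow> 'v exponent \<Rightarrow> nat" where
  "box_weight t a s = (\<Prod>i\<in>-{t}. a i choose lookup s i)"

text \<open>Substituting \<open>x_t = - \<Sum> x_i\<close> kills the product. The coefficient of the
  monomial \<open>a\<close> in the image of a monomial \<open>s\<close> is
  \<open>(-1)^(s_t) s_t! / \<Prod> (a_i - s_i)!\<close>; multiplied by \<open>\<Prod> a_i!\<close>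
  it becomes the weight of \<open>s\<close> in this relation, because
  \<open>a_i! / (a_i - s_i)! = s_i! (a_i choose s_i)\<close>.\<close>

lemma root_identity:
  fixes f :: "'v::finite exponent \<Rightarrow> 'k::field_char_0"
  assumes supp: "\<And>b. f b \<noteq> 0 \<Longrightarrow> exp_degree b + 1 = d" and deg: "(\<Sum>i\<in>-{t}. a i) = d"
  shows "(\<Sum>s | exp_degree s = d. root_coeff f t s * of_nat (box_weight t a s)) = 0"
proof -
  let ?e = "\<lambda>i::'v. single i (1::nat)"
  define ph where "ph b = of_nat (\<Prod>i\<in>UNIV. fact (lookup b i)) * f b" for b
  define D where "D = {s :: 'v exponent. exp_degree s = d}"
  define D' where "D' = {s :: 'v exponent. exp_degree s + 1 = d}"
  have finD: "finite D" unfolding D_def by (rule finite_exp_degree)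
  have finD': "finite D'" unfolding D'_def
    by (rule finite_subset[OF _ finite_exp_degree[of "d-1"]]) auto
  have prodf: "(\<Prod>j\<in>UNIV. fact (lookup (b + ?e i) j) :: nat) = Suc (lookup b i) * (\<Prod>j\<in>UNIV. fact (lookup b j))" for b i
  proof -
    have "(\<Prod>j\<in>UNIV. fact (lookup (b + ?e i) j) :: nat)
       = fact (lookup (b + ?e i) i) * (\<Prod>j\<in>UNIV - {i}. fact (lookup (b + ?e i) j))"
      by (rule prod.remove) auto
    also have "(\<Prod>j\<in>UNIV - {i}. fact (lookup (b + ?e i) j) :: nat) = (\<Prod>j\<in>UNIV - {i}. fact (lookup b j))"
      by (rule prod.cong) (auto simp: lookup_add lookup_single when_def)
    also have "fact (lookup (b + ?e i) i) * (\<Prod>j\<in>UNIV - {i}. fact (lookup b j))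
       = Suc (lookup b i) * (fact (lookup b i) * (\<Prod>j\<in>UNIV - {i}. fact (lookup b j) :: nat))"
      by (simp add: lookup_add algebra_simps)
    also have "fact (lookup b i) * (\<Prod>j\<in>UNIV - {i}. fact (lookup b j) :: nat) = (\<Prod>j\<in>UNIV. fact (lookup b j))"
      by (rule prod.remove[symmetric]) auto
    finally show ?thesis .
  qed
  have expand: "root_coeff f t s * of_nat (box_weight t a s) =
      (\<Sum>i\<in>keys s. (-1) ^ lookup s t * of_nat (lookup s i) * ph (s - ?e i) * of_nat (box_weight t a s))" for s
  proof -
    have *: "of_nat (\<Prod>j\<in>UNIV. fact (lookup s j)) * f (s - ?e i) = of_nat (lookup s i) * ph (s - ?e i)"
      if "i \<in> keys s" for i
    proof -
      have "lookup s i = Suc (lookup (s - ?e i) i)"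
        using that by (simp add: lookup_minus in_keys_iff)
      then show ?thesis
        using prodf[of "s - ?e i" i] unfolding diff_single_add[OF that] ph_def by (simp add: algebra_simps)
    qed
    have "root_coeff f t s * of_nat (box_weight t a s)
      = (\<Sum>i\<in>keys s. (-1) ^ lookup s t * (of_nat (\<Prod>j\<in>UNIV. fact (lookup s j)) * f (s - ?e i)) * of_nat (box_weight t a s))"
      unfolding root_coeff_def lsum_def sum_distrib_left sum_distrib_right by (simp add: mult.assoc)
    also have "\<dots> = (\<Sum>i\<in>keys s. (-1) ^ lookup s t * of_nat (lookup s i) * ph (s - ?e i) * of_nat (box_weight t a s))"
      by (rule sum.cong[OF refl], subst *, assumption, simp only: mult.assoc)
    finally show ?thesis .
  qed
  \<comment> \<open>Every \<open>b\<close> of degree \<open>d - 1\<close> cancels by itself: up to a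
    common factor, the variable \<open>t\<close> contributes \<open>-(b_t + 1)\<close>, every other
    \<open>i\<close> contributes \<open>a_i - b_i\<close>, and these differences add up to
    \<open>b_t + 1\<close>.\<close>
  have inner: "(\<Sum>i\<in>UNIV. (-1) ^ lookup (b + ?e i) t * of_nat (lookup (b + ?e i) i) * of_nat (box_weight t a (b + ?e i)) :: 'k) = 0"
    if b: "b \<in> D'" for b
  proof -
    define w :: 'k where "w = of_nat (box_weight t a b)"
    have t: "(-1) ^ lookup (b + ?e t) t * of_nat (lookup (b + ?e t) t) * of_nat (box_weight t a (b + ?e t))
       = - ((-1) ^ lookup b t * (of_nat (lookup b t) + 1) * w)"
    proof -
      have "box_weight t a (b + ?e t) = box_weight t a b"
        unfolding box_weight_def by (rule prod.cong) (auto simp: lookup_add lookup_single when_def)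
      then show ?thesis by (simp add: lookup_add w_def algebra_simps)
    qed
    have i: "(-1) ^ lookup (b + ?e i) t * of_nat (lookup (b + ?e i) i) * of_nat (box_weight t a (b + ?e i))
       = (-1) ^ lookup b t * (of_nat (a i) - of_nat (lookup b i)) * w" if "i \<noteq> t" for i
    proof -
      define R where "R = (\<Prod>j\<in>-{t}-{i}. a j choose lookup b j)"
      have "box_weight t a (b + ?e i) = (a i choose lookup (b + ?e i) i) * (\<Prod>j\<in>-{t}-{i}. a j choose lookup (b + ?e i) j)"
        unfolding box_weight_def using that by (intro prod.remove) auto
      also have "(\<Prod>j\<in>-{t}-{i}. a j choose lookup (b + ?e i) j) = R"
        unfolding R_def by (rule prod.cong) (auto simp: lookup_add lookup_single when_def)
      finally have 1: "box_weight t a (b + ?e i) = (a i choose Suc (lookup b i)) * R"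
        by (simp add: lookup_add)
      have 2: "box_weight t a b = (a i choose lookup b i) * R"
        unfolding box_weight_def R_def using that by (intro prod.remove) auto
      have 3: "of_nat (Suc (lookup b i)) * of_nat (a i choose Suc (lookup b i))
          = (of_nat (a i) - of_nat (lookup b i)) * (of_nat (a i choose lookup b i) :: 'k)"
      proof (cases "lookup b i \<le> a i")
        case True
        have "Suc (lookup b i) * (a i choose Suc (lookup b i)) = (a i - lookup b i) * (a i choose lookup b i)"
          by (metis binomial_absorb_comp binomial_absorption diff_Suc_1 mult.commute binomial_fact_lemma Suc_times_binomial_add add.commute True le_add_diff_inverse2 Suc_times_binomial_eq times_binomial_minus1_eq)
        then have "of_nat (Suc (lookup b i) * (a i choose Suc (lookup b i))) = (of_nat ((a i - lookup b i) * (a i choose lookup b i)) :: 'k)"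
          by (rule arg_cong)
        then show ?thesis using True by (simp only: of_nat_mult of_nat_diff)
      next
        case False then show ?thesis by (simp add: binomial_eq_0)
      qed
      have "lookup (b + ?e i) t = lookup b t" using that by (simp add: lookup_add lookup_single when_def)
      moreover have "of_nat (lookup (b + ?e i) i) * (of_nat (box_weight t a (b + ?e i)) :: 'k)
          = (of_nat (a i) - of_nat (lookup b i)) * w"
        unfolding 1 w_def 2 using 3 by (simp add: lookup_add mult.assoc[symmetric])
      ultimately show ?thesis by (simp add: mult.assoc)
    qed
    have "(\<Sum>i\<in>UNIV. (-1) ^ lookup (b + ?e i) t * of_nat (lookup (b + ?e i) i) * of_nat (box_weight t a (b + ?e i)) :: 'k)
      = - ((-1) ^ lookup b t * (of_nat (lookup b t) + 1) * w) +
        (\<Sum>i\<in>UNIV-{t}. (-1) ^ lookup (b + ?e i) t * of_nat (lookup (b + ?e i) i) * of_nat (box_weight t a (b + ?e i)))"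
      unfolding t[symmetric] by (rule sum.remove) auto
    also have "(\<Sum>i\<in>UNIV-{t}. (-1) ^ lookup (b + ?e i) t * of_nat (lookup (b + ?e i) i) * of_nat (box_weight t a (b + ?e i)) :: 'k)
       = (\<Sum>i\<in>UNIV-{t}. (-1) ^ lookup b t * (of_nat (a i) - of_nat (lookup b i)) * w)"
      by (rule sum.cong[OF refl], rule i, simp)
    also have "\<dots> = (-1) ^ lookup b t * (of_nat (\<Sum>i\<in>-{t}. a i) - of_nat (\<Sum>i\<in>-{t}. lookup b i)) * w"
      by (simp add: sum_distrib_left[symmetric] sum_distrib_right[symmetric] sum_subtractf Compl_eq_Diff_UNIV)
    also have "(\<Sum>i\<in>-{t}. a i) = d" by (rule deg)
    finally have eq: "(\<Sum>i\<in>UNIV. (-1) ^ lookup (b + ?e i) t * of_nat (lookup (b + ?e i) i) * of_nat (box_weight t a (b + ?e i)) :: 'k)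
      = (-1) ^ lookup b t * w * (of_nat d - of_nat (\<Sum>i\<in>-{t}. lookup b i) - of_nat (lookup b t) - 1)"
      by (simp add: algebra_simps)
    have "exp_degree b = lookup b t + (\<Sum>i\<in>-{t}. lookup b i)"
      unfolding exp_degree_sum Compl_eq_Diff_UNIV by (rule sum.remove) auto
    with b have dd: "d = (\<Sum>i\<in>-{t}. lookup b i) + lookup b t + 1" by (simp add: D'_def)
    have "of_nat d = (of_nat (\<Sum>i\<in>-{t}. lookup b i) + of_nat (lookup b t) + 1 :: 'k)"
      by (subst dd) simp
    then show ?thesis unfolding eq by simp
  qed
  have "(\<Sum>s\<in>D. root_coeff f t s * of_nat (box_weight t a s)) =
     (\<Sum>(s,i)\<in>Sigma D keys. (-1) ^ lookup s t * of_nat (lookup s i) * ph (s - ?e i) * of_nat (box_weight t a s))"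
    unfolding expand by (rule sum.Sigma) (use finD in auto)
  also have "\<dots> = (\<Sum>(b,i)\<in>D' \<times> UNIV. (-1) ^ lookup (b + ?e i) t * of_nat (lookup (b + ?e i) i) * ph b * of_nat (box_weight t a (b + ?e i)))"
  proof (rule sum.reindex_bij_witness[where j = "\<lambda>(s,i). (s - ?e i, i)" and i = "\<lambda>(b,i). (b + ?e i, i)"])
    fix x assume x: "x \<in> Sigma D keys"
    obtain s i where [simp]: "x = (s,i)" by force
    from x have i: "i \<in> keys s" and s: "exp_degree s = d" by (auto simp: D_def)
    note [simp] = diff_single_add[OF i] diff_single_add[OF i, unfolded One_nat_def]
    show "(case case x of (s, i) \<Rightarrow> (s - ?e i, i) of (b, i) \<Rightarrow> (b + ?e i, i)) = x" by simp
    show "(case x of (s, i) \<Rightarrow> (s - ?e i, i)) \<in> D' \<times> UNIV"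
      using exp_degree_diff_single[OF i] s by (simp add: D'_def)
    show "(case case x of (s, i) \<Rightarrow> (s - ?e i, i) of (b,i) \<Rightarrow> (-1) ^ lookup (b + ?e i) t * of_nat (lookup (b + ?e i) i) * ph b * of_nat (box_weight t a (b + ?e i)))
       = (case x of (s,i) \<Rightarrow> (-1) ^ lookup s t * of_nat (lookup s i) * ph (s - ?e i) * of_nat (box_weight t a s))"
      by simp
  next
    fix x assume x: "x \<in> D' \<times> (UNIV :: 'v set)"
    obtain b i where [simp]: "x = (b,i)" by force
    show "(case case x of (b, i) \<Rightarrow> (b + ?e i, i) of (s, i) \<Rightarrow> (s - ?e i, i)) = x" by simp
    show "(case x of (b, i) \<Rightarrow> (b + ?e i, i)) \<in> Sigma D keys"
      using x by (simp add: D_def D'_def exp_degree_add in_keys_iff lookup_add)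
  qed
  also have "\<dots> = (\<Sum>b\<in>D'. \<Sum>i\<in>UNIV. (-1) ^ lookup (b + ?e i) t * of_nat (lookup (b + ?e i) i) * ph b * of_nat (box_weight t a (b + ?e i)))"
    by (rule sum.cartesian_product[symmetric])
  also have "\<dots> = (\<Sum>b\<in>D'. ph b * (\<Sum>i\<in>UNIV. (-1) ^ lookup (b + ?e i) t * of_nat (lookup (b + ?e i) i) * of_nat (box_weight t a (b + ?e i))))"
    unfolding sum_distrib_left by (intro sum.cong) (auto simp: ac_simps)
  also have "\<dots> = 0" by (rule sum.neutral, rule ballI, subst inner, assumption, simp)
  finally show ?thesis by (simp add: D_def)
qed

lemma single_of_keys: "keys c \<subseteq> {m} \<Longrightarrow> c = single m (exp_degree c)"
proof -
  assume k: "keys c \<subseteq> {m}"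
  have "exp_degree c = lookup c m"
    using weighted_sum_superset[of "{m}" c "\<lambda>_. 1 :: nat"] k by (simp add: exp_degree_weighted_sum)
  then show ?thesis using k
    by (intro poly_mapping_eqI) (auto simp: lookup_single when_def in_keys_iff subset_iff)
qed

section \<open>Supports on faces of the simplex\<close>

locale linear_multiple =
  fixes f :: "'v::finite exponent \<Rightarrow> 'k::field_char_0" and d :: nat
  assumes d4: "d \<ge> 4" and f_degree: "\<And>b. f b \<noteq> 0 \<Longrightarrow> exp_degree b + 1 = d"
begin

definition S :: "'v exponent set" where
  "S = {s. lsum f s \<noteq> 0 \<and> (\<forall>i. s \<noteq> single i d)}"

definition T :: "'v set" where "T = {i. lsum f (single i d) \<noteq> 0}"

definition face_count :: "'v set \<Rightarrow> nat" where "face_count Y = card {s\<in>S. keys s = Y}"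

lemma S_degree: "s \<in> S \<Longrightarrow> exp_degree s = d"
  using lsum_degree[of f "d - 1" s] f_degree d4 unfolding S_def by force

lemma finite_S [simp]: "finite S"
  by (rule finite_subset[OF _ finite_exp_degree[of d]]) (use S_degree in auto)

lemma S_keys: "s \<in> S \<Longrightarrow> \<not> keys s \<subseteq> {i}"
  using single_of_keys[of s i] S_degree[of s] unfolding S_def by auto

lemma root_coeff_nonzero: "root_coeff f t s \<noteq> 0 \<longleftrightarrow> lsum f s \<noteq> 0"
  unfolding root_coeff_def by (simp flip: of_nat_prod)

lemma sum_S:
  assumes a: "(\<Sum>i\<in>-{t}. a i) = d"
  shows "(\<Sum>s\<in>S. root_coeff f t s * of_nat (box_weight t a s))
    + (\<Sum>i\<in>T. root_coeff f t (single i d) * of_nat (box_weight t a (single i d))) = 0"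
proof -
  let ?F = "\<lambda>s. root_coeff f t s * of_nat (box_weight t a s)"
  let ?P = "(\<lambda>i. single i d) ` T"
  have inj: "inj_on (\<lambda>i. single i d) T"
    using d4 by (auto simp: inj_on_def poly_mapping_eq_iff lookup_single fun_eq_iff when_def split: if_splits)
  have "0 = (\<Sum>s | exp_degree s = d. ?F s)"
    by (rule root_identity[symmetric]) (use f_degree a in auto)
  also have "\<dots> = (\<Sum>s\<in>S \<union> ?P. ?F s)"
  proof (rule sum.mono_neutral_right[OF finite_exp_degree])
    show "S \<union> ?P \<subseteq> {s. exp_degree s = d}" using S_degree by auto
    show "\<forall>s\<in>{s. exp_degree s = d} - (S \<union> ?P). ?F s = 0"
      using root_coeff_nonzero[of t] unfolding S_def T_def by auto
  qed
  also have "\<dots> = (\<Sum>s\<in>S. ?F s) + (\<Sum>s\<in>?P. ?F s)"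
    by (rule sum.union_disjoint) (use finite_S in \<open>auto simp: S_def\<close>)
  also have "(\<Sum>s\<in>?P. ?F s) = (\<Sum>i\<in>T. ?F (single i d))"
    by (simp add: sum.reindex[OF inj])
  finally show ?thesis by simp
qed

definition top_coeff :: "'v \<Rightarrow> 'k" where "top_coeff t = root_coeff f t (single t d)"

lemma top_coeff_nonzero: "t \<in> T \<Longrightarrow> top_coeff t \<noteq> 0"
  unfolding top_coeff_def root_coeff_nonzero T_def by simp

lemma box_weight_single:
  "box_weight t a (single i d) = (if i = t then 1 else a i choose d)"
proof (cases "i = t")
  case True
  have "box_weight t a (single t d) = (\<Prod>j\<in>-{t}. 1)"
    unfolding box_weight_def by (rule prod.cong) (auto simp: lookup_single when_def)
  with True show ?thesis by simp
next
  case False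
  have "box_weight t a (single i d)
      = (a i choose lookup (single i d) i) * (\<Prod>j\<in>-{t}-{i}. a j choose lookup (single i d) j)"
    unfolding box_weight_def using False by (intro prod.remove) auto
  also have "(\<Prod>j\<in>-{t}-{i}. a j choose lookup (single i d) j) = 1"
    by (rule prod.neutral) (auto simp: lookup_single when_def)
  finally show ?thesis using False by simp
qed

text \<open>If all \<open>a_i < d\<close>, then \<open>a_i choose d = 0\<close>, so
  \<open>x_t^d\<close> is the only pure power left, with weight 1. The right-hand side no longer
  depends on \<open>a\<close>.\<close>

lemma sum_S_mixed:
  assumes a: "(\<Sum>i\<in>-{t}. a i) = d" and less: "\<And>i. i \<noteq> t \<Longrightarrow> a i < d" and t: "t \<in> T"
  shows "(\<Sum>s\<in>S. root_coeff f t s * of_nat (box_weight t a s)) = - top_coeff t"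
proof -
  have "(\<Sum>i\<in>T. root_coeff f t (single i d) * of_nat (box_weight t a (single i d)))
     = (\<Sum>i\<in>T. if i = t then top_coeff t else 0)"
    by (rule sum.cong) (auto simp: box_weight_single top_coeff_def binomial_eq_0 less)
  also have "\<dots> = top_coeff t" using t by simp
  finally show ?thesis using sum_S[OF a] by (simp add: eq_neg_iff_add_eq_0)
qed

definition face :: "'v set \<Rightarrow> 'v exponent set" where "face Y = {s\<in>S. keys s \<subseteq> Y}"

lemma finite_face [simp]: "finite (face Y)" unfolding face_def by simp

text \<open>\<open>0 choose s_i\<close> tests whether \<open>x_i\<close> is absent from
  \<open>s\<close>; an \<open>a\<close> supported on \<open>Y\<close> therefore restricts the
  relation to one face.\<close>

lemma box_weight_face:
  assumes Y: "t \<notin> Y" and a: "\<And>i. i \<notin> Y \<Longrightarrow> i \<noteq> t \<Longrightarrow> a i = 0"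
  shows "box_weight t a s = (if keys s \<subseteq> insert t Y then (\<Prod>i\<in>Y. a i choose lookup s i) else 0)"
proof (cases "keys s \<subseteq> insert t Y")
  case True
  have "(\<Prod>i\<in>Y. a i choose lookup s i) = box_weight t a s"
    unfolding box_weight_def
  proof (rule prod.mono_neutral_left)
    show "\<forall>i\<in>-{t}-Y. (a i choose lookup s i) = 1"
    proof
      fix i assume "i \<in> -{t}-Y"
      then have "a i = 0" "lookup s i = 0" using a True by (auto simp: in_keys_iff subset_iff)
      then show "(a i choose lookup s i) = 1" by simp
    qed
  qed (use Y in auto)
  with True show ?thesis by simp
next
  case False
  then obtain i where "i \<in> keys s" "i \<notin> Y" "i \<noteq> t" by auto
  then have "(a i choose lookup s i) = 0" using a by (simp add: in_keys_iff binomial_eq_0)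
  then have "box_weight t a s = 0" unfolding box_weight_def using \<open>i \<noteq> t\<close>
    by (intro prod_zero) auto
  with False show ?thesis by simp
qed

lemma face_identity:
  assumes Y: "t \<notin> Y" and a: "(\<Sum>i\<in>Y. a i) = d" and less: "\<And>i. i \<in> Y \<Longrightarrow> a i < d" and t: "t \<in> T"
  shows "(\<Sum>s\<in>face (insert t Y). root_coeff f t s * of_nat (\<Prod>i\<in>Y. a i choose lookup s i)) = - top_coeff t"
proof -
  let ?a = "\<lambda>i. if i \<in> Y then a i else 0"
  have "(\<Sum>i\<in>-{t}. ?a i) = (\<Sum>i\<in>Y. a i)"
    by (rule sum.mono_neutral_cong_right) (use Y in auto)
  with a have "(\<Sum>s\<in>S. root_coeff f t s * of_nat (box_weight t ?a s)) = - top_coeff t"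
    by (intro sum_S_mixed t) (use less d4 in auto)
  also have "(\<Sum>s\<in>S. root_coeff f t s * of_nat (box_weight t ?a s))
     = (\<Sum>s\<in>face (insert t Y). root_coeff f t s * of_nat (\<Prod>i\<in>Y. a i choose lookup s i))"
    by (rule sum.mono_neutral_cong_right)
      (use Y in \<open>auto simp: face_def box_weight_face[of t Y] intro!: arg_cong[where f=of_nat] prod.cong\<close>)
  finally show ?thesis .
qed

lemma triangle_identity:
  assumes "distinct [t,j,k]" "\<alpha> + \<beta> = d" "\<alpha> \<ge> 1" "\<beta> \<ge> 1" "t \<in> T"
  shows "(\<Sum>s\<in>face {t,j,k}. root_coeff f t s * of_nat ((\<alpha> choose lookup s j) * (\<beta> choose lookup s k)))
     = - top_coeff t"
  using face_identity[of t "{j,k}" "\<lambda>i. if i = j then \<alpha> else \<beta>"] assms by auto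

text \<open>On an edge the entry of \<open>a\<close> at \<open>j\<close> has to be \<open>d\<close>,
  so \<open>x_j^d\<close> does enter the relation; if \<open>S\<close> misses the edge, it alone can
  compensate \<open>x_t^d\<close>.\<close>

lemma edge_identity:
  assumes "t \<noteq> j" "t \<in> T"
  shows "j \<in> T \<or> face_count {t,j} > 0"
proof (rule ccontr)
  assume c: "\<not> ?thesis"
  let ?a = "\<lambda>i. if i = j then d else 0"
  have z: "box_weight t ?a s = 0" if "s \<in> S" for s
  proof -
    have "keys s \<noteq> {t,j}" using c that finite_S by (auto simp: face_count_def card_gt_0_iff)
    then have "\<not> keys s \<subseteq> insert t {j}" using S_keys[OF that, of t] S_keys[OF that, of j] by auto
    then show ?thesis by (subst box_weight_face[of t "{j}"]) (use assms in auto)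
  qed
  have "(\<Sum>i\<in>T. root_coeff f t (single i d) * of_nat (box_weight t ?a (single i d)))
     = (\<Sum>i\<in>T. if i = t then top_coeff t else 0)"
    using c d4 by (intro sum.cong) (auto simp: box_weight_single top_coeff_def)
  moreover have "(\<Sum>i\<in>-{t}. ?a i) = d" using assms by simp
  ultimately show False using sum_S[of ?a t] assms top_coeff_nonzero by (simp add: z)
qed

end

section \<open>Lower bounds for the number of elements of \<open>S\<close> in a triangle\<close>

context linear_multiple
begin

text \<open>Interpolates between a whole face (\<open>X\<close> empty) and its relative interior
  (\<open>B\<close> empty), so that the cardinality of a face can be split one vertex at a
  time.\<close>

definition between_count :: "'v set \<Rightarrow> 'v set \<Rightarrow> nat" where
  "between_count X B = card {s\<in>S. X \<subseteq> keys s \<and> keys s \<subseteq> X \<union> B}"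

lemma between_count_insert:
  assumes "b \<notin> X" "b \<notin> B"
  shows "between_count X (insert b B) = between_count X B + between_count (insert b X) B"
proof -
  have "{s\<in>S. X \<subseteq> keys s \<and> keys s \<subseteq> X \<union> insert b B} =
     {s\<in>S. X \<subseteq> keys s \<and> keys s \<subseteq> X \<union> B} \<union> {s\<in>S. insert b X \<subseteq> keys s \<and> keys s \<subseteq> insert b X \<union> B}"
    using assms by blast
  moreover have "card \<dots> = between_count X B + between_count (insert b X) B"
    unfolding between_count_def by (rule card_Un_disjoint) (use assms in auto)
  ultimately show ?thesis by (simp add: between_count_def)
qed

lemma between_count_empty: "between_count X {} = face_count X"
  unfolding between_count_def face_count_def by (rule arg_cong[where f=card]) auto

lemma card_face: "card (face B) = between_count {} B"
  unfolding between_count_def face_def by simp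

lemma face_count_singleton: "face_count {x} = 0" "face_count {} = 0"
  using S_keys[of _ x] S_keys[of 0] by (auto simp: face_count_def)

lemma card_face3:
  assumes "distinct [t,j,k]"
  shows "card (face {t,j,k}) = face_count {t,j} + face_count {t,k} + face_count {j,k} + face_count {t,j,k}"
proof -
  have neq: "t \<noteq> j" "t \<noteq> k" "j \<noteq> t" "j \<noteq> k" "k \<noteq> t" "k \<noteq> j" using assms by auto
  show ?thesis
    by (simp add: card_face between_count_insert between_count_empty face_count_singleton neq,
        simp add: insert_commute)
qed

lemma card_face4:
  assumes "distinct [t,j,k,l]"
  shows "card (face {t,j,k,l}) = face_count {t,j} + face_count {t,k} + face_count {t,l}
     + face_count {j,k} + face_count {j,l} + face_count {k,l}
     + face_count {t,j,k} + face_count {t,j,l} + face_count {t,k,l} + face_count {j,k,l} + face_count {t,j,k,l}"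
proof -
  have neq: "t \<noteq> j" "t \<noteq> k" "t \<noteq> l" "j \<noteq> t" "j \<noteq> k" "j \<noteq> l" "k \<noteq> t" "k \<noteq> j" "k \<noteq> l" "l \<noteq> t" "l \<noteq> j" "l \<noteq> k" using assms by auto
  show ?thesis
    by (simp add: card_face between_count_insert between_count_empty face_count_singleton neq,
        simp add: insert_commute)
qed

lemma face_triangle_cases:
  assumes "s \<in> face {t,j,k}"
  shows "keys s = {t,j} \<or> keys s = {t,k} \<or> keys s = {j,k} \<or> keys s = {t,j,k}"
  using assms S_keys[of s t] S_keys[of s j] S_keys[of s k] unfolding face_def by blast

lemma face_triangle_degree:
  assumes "s \<in> face {t,j,k}" "distinct [t,j,k]"
  shows "lookup s t + lookup s j + lookup s k = d"
proof -
  have "exp_degree s = (\<Sum>i\<in>{t,j,k}. lookup s i)" unfolding exp_degree_def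
    by (rule sum.mono_neutral_left) (use assms in \<open>auto simp: face_def in_keys_iff\<close>)
  then show ?thesis using assms S_degree by (simp add: face_def)
qed

lemma face_count_pos: "s \<in> S \<Longrightarrow> face_count (keys s) > 0"
  by (auto simp: face_count_def card_gt_0_iff)

lemma face_count_0: "face_count Y = 0 \<Longrightarrow> s \<in> S \<Longrightarrow> keys s \<noteq> Y"
  using face_count_pos by fastforce

text \<open>A single element with exponents \<open>(p, q)\<close> would make
  \<open>(\<alpha> choose p) * (\<beta> choose q)\<close> constant and nonzero for positive
  \<open>\<alpha> + \<beta> = d\<close>. The values \<open>\<alpha> = 1\<close> and
  \<open>\<beta> = 1\<close> force \<open>p, q <= 1\<close>, and then \<open>\<alpha> = 1\<close>
  and \<open>\<alpha> = 2\<close> give different values; for \<open>(1, 1)\<close> because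
  \<open>d - 1\<close> differs from \<open>2 (d - 2)\<close>.\<close>

lemma triangle_ge_2:
  assumes t: "t \<in> T" and dist: "distinct [t,j,k]"
  shows "card (face {t,j,k}) \<ge> 2"
proof (rule ccontr)
  assume "\<not> ?thesis"
  then have "card (face {t,j,k}) = 0 \<or> card (face {t,j,k}) = 1" by linarith
  then show False
  proof
    assume "card (face {t,j,k}) = 0"
    then have "face {t,j,k} = {}" by simp
    then show False
      using triangle_identity[OF dist _ _ _ t, of 1 "d-1"] d4 top_coeff_nonzero[OF t] by fastforce
  next
    assume "card (face {t,j,k}) = 1"
    then obtain s where s: "face {t,j,k} = {s}" by (auto simp: card_1_singleton_iff)
    define p q where "p = lookup s j" and "q = lookup s k"
    have id: "root_coeff f t s * of_nat ((\<alpha> choose p) * (\<beta> choose q)) = - top_coeff t"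
      if "\<alpha> + \<beta> = d" "\<alpha> \<ge> 1" "\<beta> \<ge> 1" for \<alpha> \<beta>
      using triangle_identity[OF dist that t] unfolding s p_def q_def by simp
    have eq: "(\<alpha> choose p) * (\<beta> choose q) = (\<alpha>' choose p) * (\<beta>' choose q) \<and> (\<alpha> choose p) \<noteq> 0 \<and> (\<beta> choose q) \<noteq> 0"
      if "\<alpha> + \<beta> = d" "\<alpha> \<ge> 1" "\<beta> \<ge> 1" "\<alpha>' + \<beta>' = d" "\<alpha>' \<ge> 1" "\<beta>' \<ge> 1" for \<alpha> \<beta> \<alpha>' \<beta>'
    proof -
      have "root_coeff f t s * of_nat ((\<alpha> choose p) * (\<beta> choose q)) = root_coeff f t s * of_nat ((\<alpha>' choose p) * (\<beta>' choose q))"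
        "root_coeff f t s * of_nat ((\<alpha> choose p) * (\<beta> choose q)) \<noteq> 0"
        using id[OF that(1,2,3)] id[OF that(4,5,6)] top_coeff_nonzero[OF t] by auto
      then show ?thesis
        by (metis mult_cancel_left mult_eq_0_iff of_nat_0 of_nat_eq_iff)
    qed
    have e1: "(1 choose p) * ((d-1) choose q) = (2 choose p) * ((d-2) choose q)" "1 choose p \<noteq> 0"
      using eq[of 1 "d-1" 2 "d-2"] d4 by auto
    have e2: "1 choose q \<noteq> 0" using eq[of "d-1" 1 2 "d-2"] d4 by auto
    have "p \<le> 1" "q \<le> 1" using e1(2) e2 by (auto simp: binomial_eq_0_iff)
    moreover have "p \<noteq> 0 \<or> q \<noteq> 0"
    proof -
      have "j \<in> keys s \<or> k \<in> keys s" using face_triangle_cases[of s t j k] dist s by auto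
      then show ?thesis by (simp add: p_def q_def in_keys_iff)
    qed
    moreover have "p \<in> {0,1} \<Longrightarrow> q \<in> {0,1} \<Longrightarrow> p \<noteq> 0 \<or> q \<noteq> 0 \<Longrightarrow> False"
      using e1(1) d4 by auto
    ultimately show False by force
  qed
qed

lemma F1:
  assumes "t \<in> T" "distinct [t,j,k]"
  shows "face_count {t,j} + face_count {t,k} + face_count {j,k} + face_count {t,j,k} \<ge> 2"
  using triangle_ge_2[OF assms] card_face3[OF assms(2)] by simp

lemma binomial_eq_imp:
  assumes "a choose p = b choose p" "a choose p \<noteq> 0" "p \<ge> 1" shows "a = (b::nat)"
proof (rule ccontr)
  assume "a \<noteq> b"
  have *: "(x choose p) < (y choose p)" if "x < y" "p \<le> x" for x y
  proof -
    have "x choose p < Suc x choose p" using that assms(3) by (cases p) (auto simp: zero_less_binomial_iff)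
    also have "\<dots> \<le> y choose p" using that by (intro binomial_right_mono) auto
    finally show ?thesis .
  qed
  show False using assms *[of a b] *[of b a] \<open>a \<noteq> b\<close>
    by (metis binomial_eq_0_iff linorder_neqE_nat not_le_imp_less order_less_irrefl)
qed

text \<open>Once the binomials kill all elements divisible by both \<open>x_j\<close> and
  \<open>x_k\<close>, the relation is a function of \<open>\<alpha>\<close> from one edge plus a
  function of \<open>\<beta>\<close> from the other.\<close>

lemma face_identity_no_interior:
  assumes t: "t \<in> T" and dist: "distinct [t,j,k]" and ab: "\<alpha> + \<beta> = d" "\<alpha> \<ge> 1" "\<beta> \<ge> 1"
    and int: "\<And>s. s \<in> S \<Longrightarrow> keys s = {t,j,k} \<or> keys s = {j,k} \<Longrightarrow> \<alpha> < lookup s j \<or> \<beta> < lookup s k"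
  shows "(\<Sum>s | s\<in>S \<and> keys s = {t,j}. root_coeff f t s * of_nat (\<alpha> choose lookup s j))
     + (\<Sum>s | s\<in>S \<and> keys s = {t,k}. root_coeff f t s * of_nat (\<beta> choose lookup s k)) = - top_coeff t"
proof -
  let ?g = "\<lambda>s. root_coeff f t s * of_nat ((\<alpha> choose lookup s j) * (\<beta> choose lookup s k))"
  let ?A = "{s. s\<in>S \<and> keys s = {t,j}}" and ?B = "{s. s\<in>S \<and> keys s = {t,k}}"
  have "- top_coeff t = (\<Sum>s\<in>face {t,j,k}. ?g s)"
    using triangle_identity[OF dist ab t] by simp
  also have "\<dots> = (\<Sum>s\<in>?A \<union> ?B. ?g s)"
  proof (rule sum.mono_neutral_right)
    show "?A \<union> ?B \<subseteq> face {t,j,k}" by (auto simp: face_def)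
    show "\<forall>s\<in>face {t,j,k} - (?A \<union> ?B). ?g s = 0"
    proof
      fix s assume s: "s \<in> face {t,j,k} - (?A \<union> ?B)"
      then have "s \<in> S" "keys s = {t,j,k} \<or> keys s = {j,k}"
        using face_triangle_cases[of s t j k] by (auto simp: face_def)
      from int[OF this] show "?g s = 0" by (auto simp: binomial_eq_0)
    qed
  qed simp
  also have "\<dots> = (\<Sum>s\<in>?A. ?g s) + (\<Sum>s\<in>?B. ?g s)"
    by (rule sum.union_disjoint) (use dist in auto)
  also have "(\<Sum>s\<in>?A. ?g s) = (\<Sum>s\<in>?A. root_coeff f t s * of_nat (\<alpha> choose lookup s j))"
  proof (rule sum.cong[OF refl])
    fix s assume "s \<in> ?A" then have "lookup s k = 0" using dist not_in_keys_iff_lookup_eq_zero[of k s] by auto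
    then show "?g s = root_coeff f t s * of_nat (\<alpha> choose lookup s j)" by simp
  qed
  also have "(\<Sum>s\<in>?B. ?g s) = (\<Sum>s\<in>?B. root_coeff f t s * of_nat (\<beta> choose lookup s k))"
  proof (rule sum.cong[OF refl])
    fix s assume "s \<in> ?B" then have "lookup s j = 0" using dist not_in_keys_iff_lookup_eq_zero[of j s] by auto
    then show "?g s = root_coeff f t s * of_nat (\<beta> choose lookup s k)" by simp
  qed
  finally show ?thesis by simp
qed

lemma edge_sum_zero:
  assumes "\<And>s. s \<in> S \<Longrightarrow> keys s = {t,k} \<Longrightarrow> \<beta> < lookup s k"
  shows "(\<Sum>s | s\<in>S \<and> keys s = {t,k}. root_coeff f t s * of_nat (\<beta> choose lookup s k)) = 0"
  by (rule sum.neutral) (use assms in \<open>auto simp: binomial_eq_0\<close>)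

lemma face_count_set:
  "face_count Y = 0 \<Longrightarrow> {s. s \<in> S \<and> keys s = Y} = {}"
  "face_count Y = 1 \<Longrightarrow> \<exists>s. {s. s \<in> S \<and> keys s = Y} = {s}"
  using finite_S by (auto simp: face_count_def card_1_singleton_iff)

text \<open>A single term \<open>r * (\<alpha> choose p)\<close> with \<open>p >= 1\<close> takes
  each nonzero value at most once, as the binomial is strictly increasing in \<open>\<alpha>\<close>
  where it does not vanish.\<close>

lemma edge_two_values:
  assumes t: "t \<in> T" and le: "face_count {t,j} \<le> 1" and ab: "\<alpha> \<noteq> \<alpha>'"
    and "(\<Sum>s | s\<in>S \<and> keys s = {t,j}. root_coeff f t s * of_nat (\<alpha> choose lookup s j)) = - top_coeff t"
    and "(\<Sum>s | s\<in>S \<and> keys s = {t,j}. root_coeff f t s * of_nat (\<alpha>' choose lookup s j)) = - top_coeff t"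
  shows False
proof (cases "face_count {t,j} = 0")
  case True
  then show ?thesis using assms(4) top_coeff_nonzero[OF t] by (simp add: face_count_set)
next
  case False
  with le obtain s where s: "{s. s \<in> S \<and> keys s = {t,j}} = {s}" using face_count_set(2)[of "{t,j}"] by fastforce
  have h: "root_coeff f t s * of_nat (\<alpha> choose lookup s j) = - top_coeff t"
    "root_coeff f t s * of_nat (\<alpha>' choose lookup s j) = - top_coeff t"
    using assms(4,5) unfolding s by simp_all
  then have "\<alpha> choose lookup s j = \<alpha>' choose lookup s j" "\<alpha> choose lookup s j \<noteq> 0"
    using top_coeff_nonzero[OF t]
    by (metis mult_cancel_left mult_eq_0_iff neg_equal_0_iff_equal of_nat_eq_iff,
        metis h(1) mult_eq_0_iff neg_equal_0_iff_equal of_nat_0 top_coeff_nonzero[OF t])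
  moreover have "j \<in> keys s" using s by auto
  ultimately show False using binomial_eq_imp[of \<alpha> "lookup s j" \<alpha>'] ab by (simp add: in_keys_iff)
qed

text \<open>For \<open>\<beta> = 1\<close> and \<open>\<beta> = 2\<close> the edge to
  \<open>k\<close> drops out, as its exponents at \<open>k\<close> exceed 2. Without elements
  divisible by \<open>x_j x_k\<close>, the edge to \<open>j\<close> would have to reproduce the same
  constant at \<open>d - 1\<close> and at \<open>d - 2\<close>.\<close>

lemma F2:
  assumes t: "t \<in> T" and dist: "distinct [t,j,k]" and c: "face_count {t,j} \<le> 1"
    and k: "\<And>s. s \<in> S \<Longrightarrow> keys s = {t,k} \<Longrightarrow> lookup s k > 2"
  shows "face_count {j,k} + face_count {t,j,k} \<ge> 1"
proof (rule ccontr)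
  assume n: "\<not> ?thesis"
  have *: "(\<Sum>s | s\<in>S \<and> keys s = {t,j}. root_coeff f t s * of_nat (\<alpha> choose lookup s j)) = - top_coeff t"
    if "\<alpha> + \<beta> = d" "\<alpha> \<ge> 1" "\<beta> \<ge> 1" "\<beta> \<le> 2" for \<alpha> \<beta>
  proof -
    have "(\<Sum>s | s\<in>S \<and> keys s = {t,k}. root_coeff f t s * of_nat (\<beta> choose lookup s k)) = 0"
      by (rule edge_sum_zero) (use k that in fastforce)
    with face_identity_no_interior[OF t dist that(1,2,3)] show ?thesis
      using n face_count_0 by auto
  qed
  have "d - 1 \<noteq> d - 2" using d4 by simp
  then show False by (rule edge_two_values[OF t c _ *[of "d-1" 1] *[of "d-2" 2]]) (use d4 in auto)
qed

text \<open>The element on the edge \<open>jk\<close> survives only in the relation with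
  \<open>\<alpha>\<close> equal to its exponent at \<open>j\<close>. Two of
  \<open>\<alpha> = 1, 2, 3\<close> avoid this value, and the single element on the edge
  \<open>tj\<close> cannot satisfy both; \<open>d >= 4\<close> keeps \<open>d - 3\<close>
  positive.\<close>

lemma F3:
  assumes t: "t \<in> T" and dist: "distinct [t,j,k]" and c: "face_count {t,j} = 1" "face_count {t,k} = 0"
    "face_count {j,k} = 1" "face_count {t,j,k} = 0"
  shows False
proof -
  obtain s where s: "{s. s \<in> S \<and> keys s = {j,k}} = {s}" using face_count_set(2)[OF c(3)] by blast
  then have "s \<in> face {t,j,k}" and sk: "keys s = {j,k}" by (auto simp: face_def)
  then have ds: "lookup s j + lookup s k = d"
    using face_triangle_degree[of s t j k] dist not_in_keys_iff_lookup_eq_zero[of t s] by auto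
  have *: "(\<Sum>s | s\<in>S \<and> keys s = {t,j}. root_coeff f t s * of_nat (\<alpha> choose lookup s j)) = - top_coeff t"
    if "\<alpha> \<noteq> lookup s j" "\<alpha> \<ge> 1" "\<alpha> \<le> 3" for \<alpha>
  proof -
    have "(\<Sum>s | s\<in>S \<and> keys s = {t,k}. root_coeff f t s * of_nat ((d - \<alpha>) choose lookup s k)) = 0"
      by (simp only: face_count_set(1)[OF c(2)] sum.empty)
    moreover have "\<alpha> < lookup s' j \<or> d - \<alpha> < lookup s' k" if "s' \<in> S" "keys s' = {t,j,k} \<or> keys s' = {j,k}" for s'
    proof -
      have "s' = s" using that s face_count_0[OF c(4)] by blast
      then show ?thesis using ds \<open>\<alpha> \<noteq> lookup s j\<close> \<open>\<alpha> \<le> 3\<close> d4 by auto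
    qed
    ultimately show ?thesis
      using face_identity_no_interior[OF t dist, of \<alpha> "d-\<alpha>"] that d4 by simp
  qed
  show False
  proof (cases "lookup s j = 1")
    case True then show False using edge_two_values[OF t _ _ *[of 2] *[of 3]] c by simp
  next
    case F: False
    show False
    proof (cases "lookup s j = 2")
      case True then show False using edge_two_values[OF t _ _ *[of 1] *[of 3]] c by simp
    next
      case False then show False using edge_two_values[OF t _ _ *[of 1] *[of 2]] c F by simp
    qed
  qed
qed

text \<open>Each of the at most two elements on the opposite edge survives for one
  \<open>\<alpha>\<close> only, so one of the relations for \<open>\<alpha> = 1, 2, 3\<close> has no
  term left and would read \<open>- top_coeff t = 0\<close>.\<close>

lemma F4:
  assumes t: "t \<in> T" and dist: "distinct [t,j,k]" and c: "face_count {t,j} = 0" "face_count {t,k} = 0"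
    "face_count {t,j,k} = 0" "face_count {j,k} \<le> 2"
  shows False
proof -
  let ?H = "{s. s \<in> S \<and> keys s = {j,k}}"
  have "card ((\<lambda>s. lookup s j) ` ?H) \<le> 2"
    using c(4) card_image_le[of ?H "\<lambda>s. lookup s j"] by (simp add: face_count_def)
  moreover have "finite ((\<lambda>s. lookup s j) ` ?H)" by simp
  ultimately have "\<not> {1,2,3} \<subseteq> (\<lambda>s. lookup s j) ` ?H"
    using card_mono[of "(\<lambda>s. lookup s j) ` ?H" "{1,2,3}"] by auto
  then obtain \<alpha> where \<alpha>: "\<alpha> \<in> {1,2,3}" "\<alpha> \<notin> (\<lambda>s. lookup s j) ` ?H" by blast
  have "\<alpha> < lookup s j \<or> d - \<alpha> < lookup s k" if "s \<in> S" "keys s = {t,j,k} \<or> keys s = {j,k}" for s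
  proof -
    have k: "keys s = {j,k}" using that face_count_0[OF c(3)] by blast
    then have "s \<in> face {t,j,k}" using that by (auto simp: face_def)
    then have "lookup s j + lookup s k = d"
      using face_triangle_degree[of s t j k] dist not_in_keys_iff_lookup_eq_zero[of t s] k by auto
    moreover have "lookup s j \<noteq> \<alpha>" using \<alpha> k that by blast
    ultimately show ?thesis using \<alpha>(1) d4 by auto
  qed
  then have "- top_coeff t = 0"
    using face_identity_no_interior[OF t dist, of \<alpha> "d-\<alpha>"] \<alpha>(1) d4 c(1,2) by (auto simp: face_count_set)
  then show False using top_coeff_nonzero[OF t] by simp
qed

text \<open>The relation with exponent 1 at \<open>k0\<close> and \<open>d - 1\<close> at
  \<open>k\<close> sees no element of the edge \<open>t k0\<close> other than
  \<open>x_t^(d-1) x_k0\<close>.\<close>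

lemma F6:
  assumes t: "t \<in> T" and dist: "distinct [t,k0,k]"
    and k0: "\<And>s. s \<in> S \<Longrightarrow> keys s = {t,k0} \<Longrightarrow> lookup s k0 \<noteq> 1"
  shows "\<exists>s\<in>face {t,k0,k}. k \<in> keys s"
proof (rule ccontr)
  assume n: "\<not> ?thesis"
  have n': "keys s = {t,k0} \<and> lookup s k0 > 1" if s: "s \<in> face {t,k0,k}" for s
  proof -
    have "keys s = {t,k0}" using n s face_triangle_cases[OF s] by auto
    then show ?thesis using k0[of s] s by (auto simp: face_def in_keys_iff simp flip: neq0_conv)
       (metis One_nat_def in_keys_iff insertI1 insert_commute less_one linorder_neqE_nat)
  qed
  have "(\<Sum>s\<in>face {t,k0,k}. root_coeff f t s * of_nat ((1 choose lookup s k0) * ((d-1) choose lookup s k))) = 0"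
    by (rule sum.neutral) (use n' in \<open>auto simp: binomial_eq_0\<close>)
  with triangle_identity[OF dist _ _ _ t, of 1 "d-1"] d4 top_coeff_nonzero[OF t] show False by auto
qed

end

section \<open>Atoms at a vertex\<close>

text \<open>A linear functional with its unique minimum at \<open>m\<close> certifies the vertex. In
  a set of exponents of one degree a constant may be added to the weights, so they can be taken
  natural; they then serve as exponents of a curve tending to \<open>m\<close>.\<close>

definition is_vertex :: "'v::finite exponent set \<Rightarrow> 'v exponent \<Rightarrow> bool" where
  "is_vertex M m \<longleftrightarrow> m \<in> M \<and> (\<exists>w :: 'v \<Rightarrow> nat. \<forall>s\<in>M. s \<noteq> m \<longrightarrow>
     (\<Sum>i\<in>UNIV. w i * lookup m i) < (\<Sum>i\<in>UNIV. w i * lookup s i))"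

text \<open>The exponent \<open>a\<close> is an atom if every representation of \<open>a - m\<close> as a sum of differences \<open>s - m\<close> with
  \<open>s \<in> M\<close> involves \<open>a\<close> itself; \<open>c\<close> records the multiplicities of the \<open>s\<close>, and \<open>m\<close> is added to keep the
  degree.\<close>

definition atom_at :: "'v exponent set \<Rightarrow> 'v exponent \<Rightarrow> 'v exponent \<Rightarrow> bool" where
  "atom_at M m a \<longleftrightarrow> a \<in> M \<and> a \<noteq> m \<and>
     (\<forall>(c :: 'v exponent \<Rightarrow>\<^sub>0 nat) e. keys c \<subseteq> M \<longrightarrow> (\<Sum>s\<in>keys c. lookup c s) = Suc e \<longrightarrow>
        (\<forall>i. (\<Sum>s\<in>keys c. lookup c s * lookup s i) = e * lookup m i + lookup a i) \<longrightarrow> a \<in> keys c)"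

lemma sum_eq_1_int:
  fixes c q :: "'a \<Rightarrow> int"
  assumes "finite C" "\<And>x. x \<in> C \<Longrightarrow> c x \<ge> 1" "\<And>x. x \<in> C \<Longrightarrow> q x \<ge> 0" "(\<Sum>x\<in>C. c x * q x) = 1"
  obtains x0 where "x0 \<in> C" "c x0 = 1" "q x0 = 1" "\<And>x. x \<in> C \<Longrightarrow> x \<noteq> x0 \<Longrightarrow> q x = 0"
proof -
  have nn: "c x * q x \<ge> 0" if "x \<in> C" for x using assms(2,3)[OF that] by simp
  obtain x0 where x0: "x0 \<in> C" "c x0 * q x0 \<noteq> 0" using assms(4) sum.neutral[of C "\<lambda>x. c x * q x"] by fastforce
  have "(\<Sum>x\<in>C. c x * q x) = c x0 * q x0 + (\<Sum>x\<in>C-{x0}. c x * q x)"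
    using assms(1) x0(1) by (rule sum.remove)
  moreover have "(\<Sum>x\<in>C-{x0}. c x * q x) \<ge> 0" by (rule sum_nonneg) (use nn in auto)
  moreover have "c x0 * q x0 \<ge> 1" using nn[OF x0(1)] x0(2) by linarith
  ultimately have *: "c x0 * q x0 = 1" "(\<Sum>x\<in>C-{x0}. c x * q x) = 0" using assms(4) by linarith+
  have "c x0 = 1" "q x0 = 1"
    using *(1) assms(2,3)[OF x0(1)] by (auto simp: zmult_eq_1_iff)
  moreover have "q x = 0" if "x \<in> C" "x \<noteq> x0" for x
  proof -
    have "c x * q x = 0"
      using *(2) assms(1) nn that by (subst (asm) sum_nonneg_eq_0_iff) auto
    then show ?thesis using assms(2)[OF that(1)] by simp
  qed
  ultimately show ?thesis using that x0(1) by blast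
qed

section \<open>Plane coordinates on a triangle and atoms at the vertex
  \<open>x_t^(d-1) x_k\<close>\<close>

context linear_multiple
begin

text \<open>The exponents that remain as coordinates of the variety. All pure powers are removed,
  also those that do not occur in the product, since an artinian monomial ideal contains
  them.\<close>

definition M :: "'v exponent set" where
  "M = {s. exp_degree s = d \<and> s \<notin> S \<and> (\<forall>i. s \<noteq> single i d)}"

text \<open>The monomial \<open>x\<^sub>k\<^sup>p x\<^sub>j\<^sup>q x\<^sub>t\<^bsup>d-p-q\<^esup>\<close>, which has degree \<open>d\<close> only if \<open>p + q \<le> d\<close>.\<close>

definition pt :: "'v \<Rightarrow> 'v \<Rightarrow> 'v \<Rightarrow> nat \<Rightarrow> nat \<Rightarrow> 'v exponent" where
  "pt t k j p q = single k p + single j q + single t (d - p - q)"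

lemma lookup_pt:
  assumes "distinct [t,k,j]"
  shows "lookup (pt t k j p q) k = p" "lookup (pt t k j p q) j = q" "lookup (pt t k j p q) t = d - p - q"
    "i \<notin> {t,k,j} \<Longrightarrow> lookup (pt t k j p q) i = 0"
  using assms by (auto simp: pt_def lookup_add lookup_single when_def)

lemma keys_pt_subset: "keys (pt t k j p q) \<subseteq> {t,k,j}"
  by (auto simp: pt_def in_keys_iff lookup_add lookup_single when_def split: if_splits)

lemma pt_degree: "p + q \<le> d \<Longrightarrow> exp_degree (pt t k j p q) = d"
  by (simp add: pt_def exp_degree_add)

lemma pt_swap: "pt t k j p q = pt t j k q p"
  by (simp add: pt_def ac_simps diff_commute)

lemma pt_edge: "pt t k j p 0 = pt t k l p 0"
  by (simp add: pt_def)

lemma pt_eq_iff: "distinct [t,k,j] \<Longrightarrow> pt t k j p q = pt t k j p' q' \<longleftrightarrow> p = p' \<and> q = q'"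
  using lookup_pt(1,2)[of t k j] by (metis (full_types))

lemma face_pt:
  assumes "distinct [t,k,j]" "exp_degree s = d" "keys s \<subseteq> {t,k,j}"
  shows "s = pt t k j (lookup s k) (lookup s j)" "lookup s k + lookup s j \<le> d"
proof -
  have sum: "lookup s t + lookup s k + lookup s j = d"
  proof -
    have "exp_degree s = (\<Sum>i\<in>{t,k,j}. lookup s i)" unfolding exp_degree_def
      by (rule sum.mono_neutral_left) (use assms in \<open>auto simp: in_keys_iff\<close>)
    then show ?thesis using assms by simp
  qed
  show "s = pt t k j (lookup s k) (lookup s j)"
  proof (rule poly_mapping_eqI)
    fix i
    consider "i = t" | "i = k" | "i = j" | "i \<notin> {t,k,j}" by blast
    then show "lookup s i = lookup (pt t k j (lookup s k) (lookup s j)) i"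
    proof cases
      case 4 then show ?thesis using assms(3) lookup_pt(4)[OF assms(1) 4] by (auto simp: in_keys_iff subset_iff)
    qed (use lookup_pt[OF assms(1)] sum in auto)
  qed
  show "lookup s k + lookup s j \<le> d" using sum by simp
qed

lemma pt_pure:
  assumes "distinct [t,k,j]" "p + q \<le> d" "pt t k j p q = single i d"
  shows "(p,q) \<in> {(0,0),(d,0),(0,d)}"
proof -
  have "lookup (pt t k j p q) i = d" using assms(3) by simp
  then show ?thesis using lookup_pt(1-3)[OF assms(1), of p q] lookup_pt(4)[OF assms(1), of i p q] d4 assms
    by (cases "i \<in> {t,k,j}") auto
qed

lemma pt_M_iff:
  assumes "distinct [t,k,j]" "p + q \<le> d" "(p,q) \<notin> {(0,0),(d,0),(0,d)}"
  shows "pt t k j p q \<in> M \<longleftrightarrow> pt t k j p q \<notin> S"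
  using assms pt_pure[OF assms(1,2)] pt_degree[OF assms(2)] unfolding M_def by auto

lemma pt_0_notin_M: "pt t k j 0 0 \<notin> M" "pt t k j d 0 \<notin> M" "pt t k j 0 d \<notin> M"
  by (auto simp: M_def pt_def)

lemma edge_ge:
  assumes "distinct [t,k,j]" "P \<subseteq> {1..<d}" "\<And>p. p \<in> P \<Longrightarrow> pt t k j p 0 \<in> S"
  shows "face_count {t,k} \<ge> card P"
proof -
  have "inj_on (\<lambda>p. pt t k j p 0) P" using assms(1) by (auto simp: inj_on_def pt_eq_iff)
  then have "card P = card ((\<lambda>p. pt t k j p 0) ` P)" by (simp add: card_image)
  also have "\<dots> \<le> face_count {t,k}" unfolding face_count_def
  proof (rule card_mono)
    show "(\<lambda>p. pt t k j p 0) ` P \<subseteq> {s \<in> S. keys s = {t, k}}"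
    proof clarify
      fix p assume p: "p \<in> P"
      have "keys (pt t k j p 0) = {t,k}"
        using keys_pt_subset[of t k j p 0] lookup_pt(1-3)[OF assms(1), of p 0] assms(1,2) p
        by (auto simp: in_keys_iff)
      then show "pt t k j p 0 \<in> S \<and> keys (pt t k j p 0) = {t,k}" using assms(3)[OF p] by blast
    qed
  qed simp
  finally show ?thesis .
qed

lemma mid_ge:
  assumes dist: "distinct [t,k,j]" and P: "\<And>p q. (p,q) \<in> P \<Longrightarrow> p \<ge> 1 \<and> q \<ge> 1 \<and> pt t k j p q \<in> S"
  shows "face_count {k,j} + face_count {t,k,j} \<ge> card P"
proof -
  let ?g = "\<lambda>(p,q). pt t k j p q"
  have "inj_on ?g P" using dist by (auto simp: inj_on_def pt_eq_iff)
  then have "card P = card (?g ` P)" by (simp add: card_image)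
  also have "\<dots> \<le> card ({s\<in>S. keys s = {k,j}} \<union> {s\<in>S. keys s = {t,k,j}})"
  proof (rule card_mono)
    show "?g ` P \<subseteq> {s\<in>S. keys s = {k,j}} \<union> {s\<in>S. keys s = {t,k,j}}"
    proof
      fix s assume "s \<in> ?g ` P"
      then obtain p q where s: "s = pt t k j p q" "(p,q) \<in> P" by auto
      have "k \<in> keys s" "j \<in> keys s" "keys s \<subseteq> {t,k,j}" "s \<in> S"
        using P[OF s(2)] keys_pt_subset lookup_pt(1-3)[OF dist, of p q] by (auto simp: s(1) in_keys_iff)
      then show "s \<in> {s\<in>S. keys s = {k,j}} \<union> {s\<in>S. keys s = {t,k,j}}" by auto
    qed
  qed simp
  also have "\<dots> \<le> face_count {k,j} + face_count {t,k,j}" unfolding face_count_def by (rule card_Un_le)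
  finally show ?thesis .
qed

text \<open>In the coordinates \<open>(p, q)\<close>, with the origin moved to the vertex
  \<open>(1, 0)\<close>, a representation becomes a weighted set \<open>C\<close> of lattice points
  with prescribed coordinate sums. The condition that \<open>q = 0\<close> implies
  \<open>p >= 1\<close> expresses that \<open>x_t^d\<close> is absent from \<open>M\<close>.\<close>

lemma face_atomI:
  assumes dist: "distinct [t,k,j]" and a: "pt t k j pa qa \<in> M" "(pa,qa) \<noteq> (1,0)"
    and *: "\<And>C c. finite C \<Longrightarrow> (\<And>x. x \<in> C \<Longrightarrow> c x \<ge> (1::int)) \<Longrightarrow>
       (\<And>x. x \<in> C \<Longrightarrow> pt t k j (fst x) (snd x) \<in> M) \<Longrightarrow> (\<And>x. x \<in> C \<Longrightarrow> snd x = 0 \<Longrightarrow> fst x \<ge> 1) \<Longrightarrow>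
       (\<Sum>x\<in>C. c x * (int (fst x) - 1)) = int pa - 1 \<Longrightarrow>
       (\<Sum>x\<in>C. c x * int (snd x)) = int qa \<Longrightarrow> (pa,qa) \<in> C"
  shows "atom_at M (pt t k j 1 0) (pt t k j pa qa)"
  unfolding atom_at_def
proof (intro conjI allI impI)
  show "pt t k j pa qa \<in> M" by fact
  show "pt t k j pa qa \<noteq> pt t k j 1 0" using a(2) dist by (auto simp: pt_eq_iff)
  fix c :: "'v exponent \<Rightarrow>\<^sub>0 nat" and e
  assume cM: "keys c \<subseteq> M" and ce: "(\<Sum>s\<in>keys c. lookup c s) = Suc e"
    and ci: "\<forall>i. (\<Sum>s\<in>keys c. lookup c s * lookup s i) = e * lookup (pt t k j 1 0) i + lookup (pt t k j pa qa) i"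
  define g where "g s = (lookup s k, lookup s j)" for s :: "'v exponent"
  \<comment> \<open>The right-hand side of \<open>ci\<close> vanishes at the variables outside the
    triangle and the left-hand side has no negative terms, so the representation stays in the
    plane.\<close>
  have face: "keys s \<subseteq> {t,k,j}" if s: "s \<in> keys c" for s
  proof
    fix i assume i: "i \<in> keys s"
    show "i \<in> {t,k,j}"
    proof (rule ccontr)
      assume n: "i \<notin> {t,k,j}"
      then have "(\<Sum>s\<in>keys c. lookup c s * lookup s i) = 0"
        using ci lookup_pt(4)[OF dist n] by simp
      then have "lookup c s * lookup s i = 0" using s by simp
      then show False using s i by (simp add: in_keys_iff)
    qed
  qed
  have gpt: "pt t k j (lookup s k) (lookup s j) = s" if s: "s \<in> keys c" for s
    using face_pt(1)[OF dist _ face[OF s]] s cM by (auto simp: M_def)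
  have inj: "inj_on g (keys c)"
  proof (rule inj_onI)
    fix x y assume xy: "x \<in> keys c" "y \<in> keys c" "g x = g y"
    have "x = pt t k j (lookup x k) (lookup x j)" by (rule gpt[OF xy(1), symmetric])
    also have "\<dots> = pt t k j (lookup y k) (lookup y j)" using xy(3) by (simp add: g_def)
    also have "\<dots> = y" by (rule gpt[OF xy(2)])
    finally show "x = y" .
  qed
  define w where "w x = int (lookup c (pt t k j (fst x) (snd x)))" for x
  have wg: "w (g s) = int (lookup c s)" if "s \<in> keys c" for s
    using gpt[OF that] by (simp add: w_def g_def)
  have ce': "(\<Sum>s\<in>keys c. int (lookup c s)) = int e + 1"
    using arg_cong[OF ce, of int] by simp
  have ci': "(\<Sum>s\<in>keys c. int (lookup c s) * int (lookup s i)) = int e * int (lookup (pt t k j 1 0) i) + int (lookup (pt t k j pa qa) i)" for i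
    using arg_cong[OF ci[rule_format, of i], of int] by simp
  have "(pa,qa) \<in> g ` keys c"
  proof (rule *[where c = w])
    show "w x \<ge> 1" if "x \<in> g ` keys c" for x
      using that wg by (auto simp: in_keys_iff)
    show M: "pt t k j (fst x) (snd x) \<in> M" if "x \<in> g ` keys c" for x
      using that gpt cM by (auto simp: g_def)
    show "fst x \<ge> 1" if x: "x \<in> g ` keys c" "snd x = 0" for x
      using M[OF x(1)] x(2) pt_0_notin_M(1) by (cases "fst x") auto
    show "(\<Sum>x\<in>g ` keys c. w x * (int (fst x) - 1)) = int pa - 1"
    proof -
      have "(\<Sum>x\<in>g ` keys c. w x * (int (fst x) - 1)) = (\<Sum>s\<in>keys c. int (lookup c s) * (int (lookup s k) - 1))"
        by (subst sum.reindex[OF inj]) (auto simp: wg[unfolded g_def] g_def intro!: sum.cong)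
      also have "\<dots> = (\<Sum>s\<in>keys c. int (lookup c s) * int (lookup s k)) - (\<Sum>s\<in>keys c. int (lookup c s))"
        by (simp add: algebra_simps sum_subtractf)
      also have "\<dots> = int pa - 1"
        unfolding ci' ce' using lookup_pt[OF dist] by simp
      finally show ?thesis .
    qed
    show "(\<Sum>x\<in>g ` keys c. w x * int (snd x)) = int qa"
    proof -
      have "(\<Sum>x\<in>g ` keys c. w x * int (snd x)) = (\<Sum>s\<in>keys c. int (lookup c s) * int (lookup s j))"
        by (subst sum.reindex[OF inj]) (auto simp: wg[unfolded g_def] g_def intro!: sum.cong)
      also have "\<dots> = int qa"
        unfolding ci' using lookup_pt[OF dist] by simp
      finally show ?thesis .
    qed
  qed simp
  then show "pt t k j pa qa \<in> keys c" using gpt by (auto simp: g_def)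
qed

text \<open>The sum of the \<open>p - 1\<close> is \<open>-1\<close>, so some point has
  \<open>p = 0\<close>; its \<open>q\<close> is at least \<open>b\<close> by minimality, and at most
  \<open>b\<close> because all \<open>q\<close> together sum to \<open>b\<close>.\<close>

lemma atom_axis_j:
  assumes dist: "distinct [t,k,j]" and b: "pt t k j 0 b \<in> M" "\<And>b'. 1 \<le> b' \<Longrightarrow> b' < b \<Longrightarrow> pt t k j 0 b' \<notin> M"
  shows "atom_at M (pt t k j 1 0) (pt t k j 0 b)"
proof (rule face_atomI[OF dist b(1)])
  fix C and c :: "nat \<times> nat \<Rightarrow> int"
  assume C: "finite C" "\<And>x. x \<in> C \<Longrightarrow> c x \<ge> 1" "\<And>x. x \<in> C \<Longrightarrow> pt t k j (fst x) (snd x) \<in> M"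
    "\<And>x. x \<in> C \<Longrightarrow> snd x = 0 \<Longrightarrow> fst x \<ge> 1"
    "(\<Sum>x\<in>C. c x * (int (fst x) - 1)) = int 0 - 1" "(\<Sum>x\<in>C. c x * int (snd x)) = int b"
  have "\<exists>x\<in>C. c x * (int (fst x) - 1) < 0"
    using C(5) sum_nonneg[of C "\<lambda>x. c x * (int (fst x) - 1)"] by force
  then obtain p q where pq: "(p,q) \<in> C" "c (p,q) * (int p - 1) < 0" by auto
  then have p: "p = 0" using C(2)[OF pq(1)] by (simp add: mult_less_0_iff)
  have q1: "q \<ge> 1" using C(4)[OF pq(1)] p by (cases q) auto
  then have "q \<ge> b" using b(2)[of q] C(3)[OF pq(1)] p by force
  moreover have "c (p,q) * int q \<le> int b"
  proof -
    have "c x * int (snd x) \<ge> 0" if "x \<in> C" for x using C(2)[OF that] by simp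
    then have "c (p,q) * int (snd (p,q)) \<le> (\<Sum>x\<in>C. c x * int (snd x))"
      using C(1) pq(1) by (intro member_le_sum) auto
    then show ?thesis using C(6) by simp
  qed
  moreover have "int q \<le> c (p,q) * int q" using C(2)[OF pq(1)] q1 by simp
  ultimately have "q = b" by linarith
  then show "(0,b) \<in> C" using pq p by simp
qed simp

text \<open>The sum of the \<open>q\<close> is 1, so exactly one point lies in the row
  \<open>q = 1\<close>; all others lie on the axis \<open>q = 0\<close> and have
  \<open>p - 1 >= 0\<close>. The point of the row therefore has \<open>p <= p1\<close>, and
  \<open>p >= p1\<close> by minimality.\<close>

lemma atom_row:
  assumes dist: "distinct [t,k,j]" and b: "pt t k j p1 1 \<in> M" "\<And>p. p < p1 \<Longrightarrow> pt t k j p 1 \<notin> M" and p1: "p1 \<ge> 1"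
  shows "atom_at M (pt t k j 1 0) (pt t k j p1 1)"
proof (rule face_atomI[OF dist b(1)])
  fix C and c :: "nat \<times> nat \<Rightarrow> int"
  assume C: "finite C" "\<And>x. x \<in> C \<Longrightarrow> c x \<ge> 1" "\<And>x. x \<in> C \<Longrightarrow> pt t k j (fst x) (snd x) \<in> M"
    "\<And>x. x \<in> C \<Longrightarrow> snd x = 0 \<Longrightarrow> fst x \<ge> 1"
    "(\<Sum>x\<in>C. c x * (int (fst x) - 1)) = int p1 - 1" "(\<Sum>x\<in>C. c x * int (snd x)) = int 1"
  obtain x0 where x0: "x0 \<in> C" "c x0 = 1" "int (snd x0) = 1" "\<And>x. x \<in> C \<Longrightarrow> x \<noteq> x0 \<Longrightarrow> int (snd x) = 0"
    using sum_eq_1_int[of C c "\<lambda>x. int (snd x)"] C(1,2,6) by auto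
  have ge: "fst x0 \<ge> p1" using b(2)[of "fst x0"] C(3)[of x0] x0 by force
  have nn: "c x * (int (fst x) - 1) \<ge> 0" if "x \<in> C" for x
  proof (cases "x = x0")
    case True then show ?thesis using ge p1 x0(2) by simp
  next
    case False
    then have "fst x \<ge> 1" using x0(4)[OF that] C(4)[of x] that by simp
    then show ?thesis using C(2)[OF that] by simp
  qed
  have "c x0 * (int (fst x0) - 1) \<le> int p1 - 1"
    unfolding C(5)[symmetric] using x0(1) nn C(1) by (intro member_le_sum) auto
  then have "fst x0 = p1" using x0(2) ge by simp
  then show "(p1,1) \<in> C" using x0(1,3) by (cases x0) auto
qed simp

text \<open>All points lie on the axis \<open>q = 0\<close>, where the values \<open>p - 1\<close>
  generate a numerical semigroup; \<open>p1 - 1\<close> is its smallest positive element.\<close>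

lemma atom_axis_k:
  assumes dist: "distinct [t,k,j]" and b: "pt t k j p1 0 \<in> M" "\<And>p. p < p1 \<Longrightarrow> 2 \<le> p \<Longrightarrow> pt t k j p 0 \<notin> M" and p1: "p1 \<ge> 2"
  shows "atom_at M (pt t k j 1 0) (pt t k j p1 0)"
proof (rule face_atomI[OF dist b(1)])
  fix C and c :: "nat \<times> nat \<Rightarrow> int"
  assume C: "finite C" "\<And>x. x \<in> C \<Longrightarrow> c x \<ge> 1" "\<And>x. x \<in> C \<Longrightarrow> pt t k j (fst x) (snd x) \<in> M"
    "\<And>x. x \<in> C \<Longrightarrow> snd x = 0 \<Longrightarrow> fst x \<ge> 1"
    "(\<Sum>x\<in>C. c x * (int (fst x) - 1)) = int p1 - 1" "(\<Sum>x\<in>C. c x * int (snd x)) = int 0"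
  have q0: "snd x = 0" if "x \<in> C" for x
  proof -
    have "c x * int (snd x) = 0"
      using C(1,2,6) that by (subst (asm) of_nat_0, subst (asm) sum_nonneg_eq_0_iff) force+
    then show ?thesis using C(2)[OF that] by simp
  qed
  have nn: "c x * (int (fst x) - 1) \<ge> 0" if "x \<in> C" for x
    using q0[OF that] C(4)[of x] that C(2)[OF that] by simp
  have "\<exists>x\<in>C. c x * (int (fst x) - 1) \<noteq> 0"
    using C(5) p1 sum.neutral[of C "\<lambda>x. c x * (int (fst x) - 1)"] by fastforce
  then obtain x where x: "x \<in> C" "c x * (int (fst x) - 1) \<noteq> 0" by blast
  have "fst x \<ge> 1" using q0[OF x(1)] C(4)[of x] x(1) by simp
  then have x2: "fst x \<ge> 2" using x(2) by (cases "fst x = 1") auto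
  have ge: "fst x \<ge> p1" using b(2)[of "fst x"] C(3)[of x] x(1) x2 q0[OF x(1)] by force
  have "c x * (int (fst x) - 1) \<le> int p1 - 1"
    unfolding C(5)[symmetric] using x(1) nn C(1) by (intro member_le_sum) auto
  moreover have "int (fst x) - 1 \<le> c x * (int (fst x) - 1)" using C(2)[OF x(1)] x2 by simp
  ultimately have "fst x = p1" using ge by simp
  then show "(p1,0) \<in> C" using x(1) q0[OF x(1)] by (cases x) auto
qed (use p1 in auto)

text \<open>If only the vertex is left on the axis \<open>q = 0\<close>, the axis adds nothing, and
  a point of the row \<open>q = 1\<close> can be represented by itself only.\<close>

lemma atom_row_any:
  assumes dist: "distinct [t,k,j]" and b: "pt t k j p1 1 \<in> M" "\<And>p. 2 \<le> p \<Longrightarrow> pt t k j p 0 \<notin> M"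
  shows "atom_at M (pt t k j 1 0) (pt t k j p1 1)"
proof (rule face_atomI[OF dist b(1)])
  fix C and c :: "nat \<times> nat \<Rightarrow> int"
  assume C: "finite C" "\<And>x. x \<in> C \<Longrightarrow> c x \<ge> 1" "\<And>x. x \<in> C \<Longrightarrow> pt t k j (fst x) (snd x) \<in> M"
    "\<And>x. x \<in> C \<Longrightarrow> snd x = 0 \<Longrightarrow> fst x \<ge> 1"
    "(\<Sum>x\<in>C. c x * (int (fst x) - 1)) = int p1 - 1" "(\<Sum>x\<in>C. c x * int (snd x)) = int 1"
  obtain x0 where x0: "x0 \<in> C" "c x0 = 1" "int (snd x0) = 1" "\<And>x. x \<in> C \<Longrightarrow> x \<noteq> x0 \<Longrightarrow> int (snd x) = 0"
    using sum_eq_1_int[of C c "\<lambda>x. int (snd x)"] C(1,2,6) by auto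
  have rest: "fst x = 1" if "x \<in> C" "x \<noteq> x0" for x
  proof -
    have "snd x = 0" using x0(4)[OF that] by simp
    then show ?thesis using C(3,4)[of x] that b(2)[of "fst x"] by (cases "fst x = 1") auto
  qed
  have "(\<Sum>x\<in>C. c x * (int (fst x) - 1)) = c x0 * (int (fst x0) - 1) + (\<Sum>x\<in>C-{x0}. c x * (int (fst x) - 1))"
    using C(1) x0(1) by (rule sum.remove)
  also have "(\<Sum>x\<in>C-{x0}. c x * (int (fst x) - 1)) = 0" by (rule sum.neutral) (simp add: rest)
  finally have "fst x0 = p1" using C(5) x0(2) by simp
  then show "(p1,1) \<in> C" using x0(1,3) by (cases x0) auto
qed simp

text \<open>Without \<open>(2, 0)\<close> the axis \<open>q = 0\<close> contributes 0 or at least 2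
  to the sum of the \<open>p - 1\<close>, while the one point of the row \<open>q = 1\<close>
  contributes at least \<open>-1\<close>; the total 0 leaves only \<open>(1, 1)\<close>.\<close>

lemma atom_1_1:
  assumes dist: "distinct [t,k,j]" and b: "pt t k j 1 1 \<in> M" "pt t k j 2 0 \<notin> M"
  shows "atom_at M (pt t k j 1 0) (pt t k j 1 1)"
proof (rule face_atomI[OF dist b(1)])
  fix C and c :: "nat \<times> nat \<Rightarrow> int"
  assume C: "finite C" "\<And>x. x \<in> C \<Longrightarrow> c x \<ge> 1" "\<And>x. x \<in> C \<Longrightarrow> pt t k j (fst x) (snd x) \<in> M"
    "\<And>x. x \<in> C \<Longrightarrow> snd x = 0 \<Longrightarrow> fst x \<ge> 1"
    "(\<Sum>x\<in>C. c x * (int (fst x) - 1)) = int 1 - 1" "(\<Sum>x\<in>C. c x * int (snd x)) = int 1"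
  obtain x0 where x0: "x0 \<in> C" "c x0 = 1" "int (snd x0) = 1" "\<And>x. x \<in> C \<Longrightarrow> x \<noteq> x0 \<Longrightarrow> int (snd x) = 0"
    using sum_eq_1_int[of C c "\<lambda>x. int (snd x)"] C(1,2,6) by auto
  have rest: "fst x = 1 \<or> fst x \<ge> 3" if "x \<in> C" "x \<noteq> x0" for x
  proof -
    have "snd x = 0" using x0(4)[OF that] by simp
    then have "fst x \<ge> 1" "fst x \<noteq> 2" using C(3,4)[of x] that b(2) by auto
    then show ?thesis by linarith
  qed
  have sum: "(\<Sum>x\<in>C. c x * (int (fst x) - 1)) = c x0 * (int (fst x0) - 1) + (\<Sum>x\<in>C-{x0}. c x * (int (fst x) - 1))"
    using C(1) x0(1) by (rule sum.remove)
  have nn: "c x * (int (fst x) - 1) = 0 \<or> c x * (int (fst x) - 1) \<ge> 2" if "x \<in> C - {x0}" for x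
  proof -
    have "fst x = 1 \<or> fst x \<ge> 3" using rest that by blast
    then show ?thesis
    proof
      assume "fst x \<ge> 3"
      then have "1 * 2 \<le> c x * (int (fst x) - 1)" using C(2)[of x] that by (intro mult_mono) auto
      then show ?thesis by simp
    qed simp
  qed
  have "fst x0 = 1"
  proof (cases "\<exists>x\<in>C-{x0}. c x * (int (fst x) - 1) \<noteq> 0")
    case True
    then obtain x where x: "x \<in> C-{x0}" "c x * (int (fst x) - 1) \<ge> 2" using nn by blast
    have "c x * (int (fst x) - 1) \<le> (\<Sum>x\<in>C-{x0}. c x * (int (fst x) - 1))"
      using x(1) C(1) nn by (intro member_le_sum) force+
    moreover have "c x0 * (int (fst x0) - 1) = int (fst x0) - 1" by (simp add: x0(2))
    ultimately show ?thesis using sum x(2) C(5) by linarith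
  next
    case False
    then have "(\<Sum>x\<in>C-{x0}. c x * (int (fst x) - 1)) = 0" by (intro sum.neutral) blast
    then show ?thesis using sum C(5) x0(2) by simp
  qed
  then show "(1,1) \<in> C" using x0(1,3) by (cases x0) auto
qed simp

text \<open>The functional \<open>p - 1 + q\<close> is nonnegative on the points of \<open>C\<close>
  and equals 1 at the target, so some point has \<open>p + q = 2\<close>; with \<open>(2, 0)\<close>
  and \<open>(1, 1)\<close> excluded it is \<open>(0, 2)\<close>.\<close>

lemma atom_0_2:
  assumes dist: "distinct [t,k,j]" and b: "pt t k j 0 2 \<in> M" "pt t k j 2 0 \<notin> M" "pt t k j 1 1 \<notin> M"
  shows "atom_at M (pt t k j 1 0) (pt t k j 0 2)"
proof (rule face_atomI[OF dist b(1)])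
  fix C and c :: "nat \<times> nat \<Rightarrow> int"
  assume C: "finite C" "\<And>x. x \<in> C \<Longrightarrow> c x \<ge> 1" "\<And>x. x \<in> C \<Longrightarrow> pt t k j (fst x) (snd x) \<in> M"
    "\<And>x. x \<in> C \<Longrightarrow> snd x = 0 \<Longrightarrow> fst x \<ge> 1"
    "(\<Sum>x\<in>C. c x * (int (fst x) - 1)) = int 0 - 1" "(\<Sum>x\<in>C. c x * int (snd x)) = int 2"
  have "(\<Sum>x\<in>C. c x * (int (fst x) - 1 + int (snd x))) = 1"
    using C(5,6) by (simp add: distrib_left sum.distrib)
  moreover have "int (fst x) - 1 + int (snd x) \<ge> 0" if "x \<in> C" for x
    using C(4)[of x] that by (cases "snd x = 0") auto
  ultimately obtain x0 where x0: "x0 \<in> C" "int (fst x0) - 1 + int (snd x0) = 1"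
    using sum_eq_1_int[of C c "\<lambda>x. int (fst x) - 1 + int (snd x)"] C(1,2) by blast
  then have "fst x0 + snd x0 = 2" by linarith
  then have "(fst x0 = 0 \<and> snd x0 = 2) \<or> (fst x0 = 1 \<and> snd x0 = 1) \<or> (fst x0 = 2 \<and> snd x0 = 0)" by linarith
  then show "(0,2) \<in> C" using C(3)[of x0] x0(1) b by (cases x0) auto
qed simp

lemma vertex_pt:
  assumes dist: "distinct [t,k,j]" and m: "pt t k j 1 0 \<in> M"
  shows "is_vertex M (pt t k j 1 0)"
proof -
  \<comment> \<open>Weight 0 for \<open>t\<close>, 2 for \<open>k\<close> and 3 for all others: the
    vertex has weight 2, and besides it only \<open>x_t^d\<close>, which is absent from
    \<open>M\<close>, weighs at most 2.\<close>
  define w where "w = (\<lambda>i. if i = t then 0 else if i = k then 2 else (3::nat))"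
  have split: "(\<Sum>i\<in>UNIV. h i) = h t + h k + (\<Sum>i\<in>UNIV-{t}-{k}. h i)" for h :: "'v \<Rightarrow> nat"
  proof -
    have "(\<Sum>i\<in>UNIV. h i) = h t + (\<Sum>i\<in>UNIV-{t}. h i)" by (rule sum.remove) auto
    also have "(\<Sum>i\<in>UNIV-{t}. h i) = h k + (\<Sum>i\<in>UNIV-{t}-{k}. h i)" by (rule sum.remove) (use dist in auto)
    finally show ?thesis by simp
  qed
  have W: "(\<Sum>i\<in>UNIV. w i * lookup s i) = 2 * lookup s k + 3 * (\<Sum>i\<in>UNIV-{t}-{k}. lookup s i)" for s
    by (subst split, subst sum_distrib_left) (use dist in \<open>auto simp: w_def intro!: sum.cong\<close>)
  have D: "exp_degree s = lookup s t + lookup s k + (\<Sum>i\<in>UNIV-{t}-{k}. lookup s i)" for s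
    unfolding exp_degree_sum by (rule split)
  have "lookup (pt t k j 1 0) i = 0" if "i \<noteq> t" "i \<noteq> k" for i
    using lookup_pt(2)[OF dist] lookup_pt(4)[OF dist, of i] that by (cases "i = j") auto
  then have mk: "lookup (pt t k j 1 0) k = 1" "(\<Sum>i\<in>UNIV-{t}-{k}. lookup (pt t k j 1 0) i) = 0"
    using lookup_pt(1)[OF dist] by simp_all
  have "(\<Sum>i\<in>UNIV. w i * lookup (pt t k j 1 0) i) < (\<Sum>i\<in>UNIV. w i * lookup s i)" if s: "s \<in> M" "s \<noteq> pt t k j 1 0" for s
  proof (rule ccontr)
    assume "\<not> ?thesis"
    then have le: "2 * lookup s k + 3 * (\<Sum>i\<in>UNIV-{t}-{k}. lookup s i) \<le> 2" unfolding W mk by simp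
    then have z: "(\<Sum>i\<in>UNIV-{t}-{k}. lookup s i) = 0" and k1: "lookup s k \<le> 1" by linarith+
    have "keys s \<subseteq> {t,k}" using z by (auto simp: in_keys_iff)
    then have pt: "s = pt t k j (lookup s k) (lookup s j)" "lookup s j = 0"
      using face_pt(1)[OF dist, of s] s(1) dist by (auto simp: M_def in_keys_iff subset_iff)
    show False
    proof (cases "lookup s k = 0")
      case True
      with pt(2) have "s = pt t k j 0 0" by (subst pt(1)) simp
      then show False using s(1) pt_0_notin_M(1) by simp
    next
      case False then have "lookup s k = 1" using k1 by simp
      with pt(2) have "s = pt t k j 1 0" by (subst pt(1)) simp
      then show False using s(2) by simp
    qed
  qed
  then show ?thesis unfolding is_vertex_def using m by blast
qed

end

section \<open>Smooth supports\<close>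

text \<open>The variables stand for the numbers of elements of \<open>S\<close> in the relative interiors of the faces of a
  tetrahedron with vertices \<open>t, a, b, c\<close>.\<close>

lemma face_count_arith2:
  fixes ta tb tc ab ac bc tab tac tbc abc q :: nat
  assumes "ta + tb + tc + ab + ac + bc + tab + tac + tbc + abc + q \<le> 5"
    and "ta + tb + ab + tab \<ge> 2" "ta + tc + ac + tac \<ge> 2" "tb + tc + bc + tbc \<ge> 2"
    and "ac + tac \<ge> 1" "bc + tbc \<ge> 1" "tc \<le> 1"
    and "\<not> (tc = 1 \<and> ta = 0 \<and> ac = 1 \<and> tac = 0)" "\<not> (tc = 1 \<and> tb = 0 \<and> bc = 1 \<and> tbc = 0)"
    and "\<not> (ta = 0 \<and> tb = 0 \<and> tab = 0 \<and> ab \<le> 2)"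
    and "ab + ac + bc + abc \<ge> 2" "ta = 0" "tb = 0"
  shows False
proof -
  have tc: "tc = 1" using assms(1-7,12,13) by linarith
  have e: "ac + tac = 1" "bc + tbc = 1" "ab + tab = 2" "abc = 0" using assms(1-7,12,13) tc by linarith+
  have "ac = 0" using e(1) assms(8,12) tc by (cases ac) auto
  moreover have "bc = 0" using e(2) assms(9,13) tc by (cases bc) auto
  ultimately have "ab = 2" "tab = 0" using e assms(11) by linarith+
  then show False using assms(10,12,13) by simp
qed

lemma face_count_arith1:
  fixes ta tb tc ab ac bc tab tac tbc abc q :: nat
  assumes "ta + tb + tc + ab + ac + bc + tab + tac + tbc + abc + q \<le> 5"
    and "ab + tab \<ge> 1" "ac + tac \<ge> 1" "bc + tbc \<ge> 1"
    and "\<not> (tb = 1 \<and> ta = 0 \<and> ab = 1 \<and> tab = 0)" "\<not> (tc = 1 \<and> ta = 0 \<and> ac = 1 \<and> tac = 0)"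
    and "ab + ac + bc + abc \<ge> 2" "ta = 0" "tb = 1" "tc = 1"
  shows False
proof -
  have e: "ab + tab = 1" "ac + tac = 1" "bc + tbc = 1" "abc = 0" using assms(1-4,8-10) by linarith+
  have "ab = 0" using e(1) assms(5,8,9) by (cases ab) auto
  moreover have "ac = 0" using e(2) assms(6,8,10) by (cases ac) auto
  ultimately show False using e assms(7) by linarith
qed

text \<open>The hypotheses are the bound five, then \<open>F1\<close>, \<open>F2\<close>,
  \<open>F3\<close> and \<open>F4\<close> for the three triangles at \<open>t\<close>, and last
  \<open>F1\<close> for the opposite triangle, available if an edge at \<open>t\<close> is empty. An
  edge with two or more elements exhausts the bound quickly; the auxiliary lemmas treat two empty
  edges, and one empty edge beside two edges with one element each.\<close>

lemma face_count_arith: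
  fixes ta tb tc ab ac bc tab tac tbc abc q :: nat
  assumes "ta + tb + tc + ab + ac + bc + tab + tac + tbc + abc + q \<le> 5"
    and "ta + tb + ab + tab \<ge> 2" "ta + tc + ac + tac \<ge> 2" "tb + tc + bc + tbc \<ge> 2"
    and "ta \<le> 1 \<Longrightarrow> ab + tab \<ge> 1 \<and> ac + tac \<ge> 1"
    and "tb \<le> 1 \<Longrightarrow> ab + tab \<ge> 1 \<and> bc + tbc \<ge> 1"
    and "tc \<le> 1 \<Longrightarrow> ac + tac \<ge> 1 \<and> bc + tbc \<ge> 1"
    and "\<not> (ta = 1 \<and> tb = 0 \<and> ab = 1 \<and> tab = 0)" "\<not> (tb = 1 \<and> ta = 0 \<and> ab = 1 \<and> tab = 0)"
    and "\<not> (ta = 1 \<and> tc = 0 \<and> ac = 1 \<and> tac = 0)" "\<not> (tc = 1 \<and> ta = 0 \<and> ac = 1 \<and> tac = 0)"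
    and "\<not> (tb = 1 \<and> tc = 0 \<and> bc = 1 \<and> tbc = 0)" "\<not> (tc = 1 \<and> tb = 0 \<and> bc = 1 \<and> tbc = 0)"
    and "\<not> (ta = 0 \<and> tb = 0 \<and> tab = 0 \<and> ab \<le> 2)" "\<not> (ta = 0 \<and> tc = 0 \<and> tac = 0 \<and> ac \<le> 2)"
      "\<not> (tb = 0 \<and> tc = 0 \<and> tbc = 0 \<and> bc \<le> 2)"
    and "ta = 0 \<or> tb = 0 \<or> tc = 0 \<Longrightarrow> ab + ac + bc + abc \<ge> 2"
  shows False
proof -
  consider "ta \<ge> 2" | "tb \<ge> 2" | "tc \<ge> 2" | "ta \<le> 1" "tb \<le> 1" "tc \<le> 1" by linarith
  then show False
  proof cases
    case small: 4
    note F2 = assms(5)[OF small(1)] assms(6)[OF small(2)] assms(7)[OF small(3)]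
    have "ta = 0 \<or> ta = 1" "tb = 0 \<or> tb = 1" "tc = 0 \<or> tc = 1" using small by auto
    then consider "ta = 0" "tb = 0" | "ta = 0" "tc = 0" | "tb = 0" "tc = 0"
      | "ta = 0" "tb = 1" "tc = 1" | "tb = 0" "ta = 1" "tc = 1" | "tc = 0" "ta = 1" "tb = 1"
      | "ta = 1" "tb = 1" "tc = 1" by blast
    then show False
    proof cases
      case 1
      then have z: "ta = 0 \<or> tb = 0 \<or> tc = 0" by blast
      show False
        by (rule face_count_arith2[of ta tb tc ab ac bc tab tac tbc abc q])
          (fact assms(8-16) | (use assms(1-4) F2 assms(17)[OF z] small 1 in linarith))+
    next
      case 2
      then have z: "ta = 0 \<or> tb = 0 \<or> tc = 0" by blast
      show False
        by (rule face_count_arith2[of ta tc tb ac ab bc tac tab tbc abc q])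
          (fact assms(8-16) | (use assms(1-4) F2 assms(17)[OF z] small 2 in linarith))+
    next
      case 3
      then have z: "ta = 0 \<or> tb = 0 \<or> tc = 0" by blast
      show False
        by (rule face_count_arith2[of tb tc ta bc ab ac tbc tab tac abc q])
          (fact assms(8-16) | (use assms(1-4) F2 assms(17)[OF z] small 3 in linarith))+
    next
      case 4
      then have z: "ta = 0 \<or> tb = 0 \<or> tc = 0" by blast
      show False
        by (rule face_count_arith1[of ta tb tc ab ac bc tab tac tbc abc q])
          (fact assms(8-16) | (use assms(1-4) F2 assms(17)[OF z] small 4 in linarith))+
    next
      case 5
      then have z: "ta = 0 \<or> tb = 0 \<or> tc = 0" by blast
      show False
        by (rule face_count_arith1[of tb ta tc ab bc ac tab tbc tac abc q])
          (fact assms(8-16) | (use assms(1-4) F2 assms(17)[OF z] small 5 in linarith))+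
    next
      case 6
      then have z: "ta = 0 \<or> tb = 0 \<or> tc = 0" by blast
      show False
        by (rule face_count_arith1[of tc ta tb ac bc ab tac tbc tab abc q])
          (fact assms(8-16) | (use assms(1-4) F2 assms(17)[OF z] small 6 in linarith))+
    next
      case 7 then show False using assms(1) F2 by linarith
    qed
  next
    case 1
    show False
    proof (cases "tb \<le> 1")
      case tb: True
      show False
      proof (cases "tc \<le> 1")
        case True
        then show False using 1 assms(1-4) assms(6)[OF tb] assms(7)[OF True] by linarith
      qed (use 1 assms(1) assms(6)[OF tb] in linarith)
    next
      case False
      then show False using 1 assms(1,7) by linarith
    qed
  next
    case 2
    show False
    proof (cases "ta \<le> 1")
      case ta: True
      show False
      proof (cases "tc \<le> 1")
        case True
        then show False using 2 assms(1-4) assms(5)[OF ta] assms(7)[OF True] by linarith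
      qed (use 2 assms(1) assms(5)[OF ta] in linarith)
    next
      case False
      then show False using 2 assms(1,7) by linarith
    qed
  next
    case 3
    show False
    proof (cases "ta \<le> 1")
      case ta: True
      show False
      proof (cases "tb \<le> 1")
        case True
        then show False using 3 assms(1-4) assms(5)[OF ta] assms(6)[OF True] by linarith
      qed (use 3 assms(1) assms(5)[OF ta] in linarith)
    next
      case False
      then show False using 3 assms(1,6) by linarith
    qed
  qed
qed

text \<open>\<open>no_three_atoms\<close> is what smoothness gives, \<open>card_S\<close> is
  \<open>2n + 3\<close> minus the \<open>n + 1\<close> pure powers, and
  \<open>not_all_adjacent\<close> is the consequence of minimality that starts the argument at each
  \<open>t\<close>.\<close>

locale smooth_multiple = linear_multiple f d
  for f :: "'v::finite exponent \<Rightarrow> 'k::field_char_0" and d +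
  assumes no_three_atoms: "\<And>m t k j a1 a2 a3. is_vertex M m \<Longrightarrow> keys m \<union> keys a1 \<union> keys a2 \<union> keys a3 \<subseteq> {t,k,j} \<Longrightarrow>
      distinct [a1,a2,a3] \<Longrightarrow> atom_at M m a1 \<Longrightarrow> atom_at M m a2 \<Longrightarrow> atom_at M m a3 \<Longrightarrow> False"
    and card_S: "card S = CARD('v) + 1" and card_vars: "CARD('v) \<ge> 4"
    and not_all_adjacent: "\<And>t. t \<in> T \<Longrightarrow> \<exists>k. k \<noteq> t \<and> single k 1 + single t (d - 1) \<notin> S"
begin

lemma no3_pt:
  assumes dist: "distinct [t,k,j]" and m: "pt t k j 1 0 \<in> M"
    and neq: "distinct [(p1,q1),(p2,q2),(p3,q3)]"
    and a: "atom_at M (pt t k j 1 0) (pt t k j p1 q1)" "atom_at M (pt t k j 1 0) (pt t k j p2 q2)"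
      "atom_at M (pt t k j 1 0) (pt t k j p3 q3)"
  shows False
  by (rule no_three_atoms[OF vertex_pt[OF dist m] _ _ a, of t k j])
    (use neq dist keys_pt_subset in \<open>auto simp: pt_eq_iff\<close>)

lemma adjacent_pt: "pt t k j 1 0 = single k 1 + single t (d - 1)"
  by (simp add: pt_def)

lemma face_reaching:
  assumes t: "t \<in> T" and dist: "distinct [t,k0,k]" and k0: "pt t k0 j0 1 0 \<notin> S"
  shows "\<exists>s\<in>face {t,k0,k}. k \<in> keys s"
proof (rule F6[OF t dist])
  fix s assume s: "s \<in> S" "keys s = {t,k0}"
  have "k \<notin> keys s" using s dist by auto
  then have k: "lookup s k = 0" by (simp add: not_in_keys_iff_lookup_eq_zero)
  have pt: "s = pt t k0 k (lookup s k0) (lookup s k)"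
    using s by (intro face_pt(1)[OF dist S_degree]) auto
  show "lookup s k0 \<noteq> 1"
  proof
    assume "lookup s k0 = 1"
    with pt k have "s = pt t k0 j0 1 0" by (metis pt_edge)
    then show False using k0 s(1) by simp
  qed
qed

text \<open>Every \<open>k\<close> outside \<open>B\<close> has an element of \<open>S\<close> in
  the triangle \<open>t, k0, k\<close> divisible by \<open>x_k\<close>. These \<open>n - 3\<close>
  elements are distinct and lie outside the face \<open>B\<close>, so at most
  \<open>(n + 2) - (n - 3) = 5\<close> remain.\<close>

lemma card_face_le_5:
  assumes t: "t \<in> T" and B: "t \<in> B" "k0 \<in> B" "card B = 4" and k0: "k0 \<noteq> t" "pt t k0 j0 1 0 \<notin> S"
  shows "card (face B) \<le> 5"
proof -
  have "\<exists>s\<in>face {t,k0,k}. k \<in> keys s" if k: "k \<in> -B" for k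
  proof (rule face_reaching[OF t _ k0(2)])
    show "distinct [t,k0,k]" using k B k0(1) by auto
  qed
  then obtain g where g: "\<And>k. k \<in> -B \<Longrightarrow> g k \<in> face {t,k0,k} \<and> k \<in> keys (g k)" by metis
  have "inj_on g (-B)"
  proof (rule inj_onI)
    fix x y assume xy: "x \<in> -B" "y \<in> -B" "g x = g y"
    have "x \<in> keys (g y)" "keys (g y) \<subseteq> {t,k0,y}" using g[OF xy(1)] g[OF xy(2)] xy(3) by (auto simp: face_def)
    then show "x = y" using xy B by auto
  qed
  then have "card (-B) = card (g ` (-B))" by (simp add: card_image)
  moreover have "face B \<inter> g ` (-B) = {}" using g by (fastforce simp: face_def)
  moreover have "face B \<union> g ` (-B) \<subseteq> S" using g by (auto simp: face_def)
  ultimately have "card (face B) + card (-B) \<le> card S"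
    by (metis card_Un_disjoint card_mono finite finite_S finite_face finite_imageI)
  moreover have "card (-B) = CARD('v) - 4" using B(3) by (simp add: Compl_eq_Diff_UNIV card_Diff_subset)
  ultimately show ?thesis using card_S card_vars by linarith
qed

lemma exists_fourth:
  obtains l where "l \<notin> {t,k,j :: 'v}"
proof -
  have "card {t,k,j} \<le> 3" by (simp add: card_insert_if)
  then have "{t,k,j} \<noteq> UNIV" using card_vars by auto
  then show ?thesis using that by blast
qed

lemma budget:
  assumes t: "t \<in> T" and dist: "distinct [t,k,j,l]" and k: "pt t k j' 1 0 \<notin> S"
  shows "face_count {t,k} + face_count {t,j} + face_count {t,l}
     + face_count {k,j} + face_count {k,l} + face_count {j,l}
     + face_count {t,k,j} + face_count {t,k,l} + face_count {t,j,l} + face_count {k,j,l} + face_count {t,k,j,l} \<le> 5"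
proof -
  have "k \<noteq> t" and "card {t,k,j,l} = 4" using dist by auto
  then have "card (face {t,k,j,l}) \<le> 5" using card_face_le_5[OF t _ _ _ _ k, of "{t,k,j,l}"] by blast
  then show ?thesis unfolding card_face4[OF dist] .
qed

lemma budget_tri:
  assumes t: "t \<in> T" and dist: "distinct [t,k,j,l]" and k: "pt t k j' 1 0 \<notin> S"
  shows "face_count {t,k} + face_count {t,j} + (face_count {k,j} + face_count {t,k,j}) + (face_count {k,l} + face_count {t,k,l})
      + (face_count {j,l} + face_count {t,j,l}) + face_count {t,l} \<le> 5"
  using budget[OF assms] by linarith

text \<open>\<open>(\<beta> choose p) * (\<gamma> choose q)\<close> vanishes unless
  \<open>p <= \<beta>\<close> and \<open>q <= \<gamma>\<close>; if all elements have
  \<open>p + q >= \<beta> + \<gamma>\<close>, only \<open>(\<beta>, \<gamma>)\<close> itself is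
  left, with both binomials equal to 1.\<close>

lemma leading_value:
  assumes t: "t \<in> T" and dist: "distinct [t,k,l]" and le: "\<beta> + \<gamma> \<le> d"
    and Z: "\<And>s. s \<in> face {t,k,l} \<Longrightarrow> lookup s k + lookup s l \<ge> \<beta> + \<gamma>"
  shows "(\<Sum>s\<in>face {t,k,l}. root_coeff f t s * of_nat ((\<beta> choose lookup s k) * (\<gamma> choose lookup s l)))
     = (if pt t k l \<beta> \<gamma> \<in> S then root_coeff f t (pt t k l \<beta> \<gamma>) else 0)"
proof -
  have "root_coeff f t s * of_nat ((\<beta> choose lookup s k) * (\<gamma> choose lookup s l))
     = (if s = pt t k l \<beta> \<gamma> then root_coeff f t s else 0)" if s: "s \<in> face {t,k,l}" for s
  proof (cases "s = pt t k l \<beta> \<gamma>")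
    case True
    then show ?thesis using lookup_pt(1,2)[OF dist] by simp
  next
    case False
    have "\<not> (lookup s k = \<beta> \<and> lookup s l = \<gamma>)"
      using face_pt(1)[OF dist, of s] s False S_degree by (auto simp: face_def)
    then have "\<beta> < lookup s k \<or> \<gamma> < lookup s l" using Z[OF s] by linarith
    then show ?thesis using False by (auto simp: binomial_eq_0)
  qed
  then have "(\<Sum>s\<in>face {t,k,l}. root_coeff f t s * of_nat ((\<beta> choose lookup s k) * (\<gamma> choose lookup s l)))
     = (\<Sum>s\<in>face {t,k,l}. if s = pt t k l \<beta> \<gamma> then root_coeff f t s else 0)" by (rule sum.cong[OF refl])
  also have "\<dots> = (if pt t k l \<beta> \<gamma> \<in> face {t,k,l} then root_coeff f t (pt t k l \<beta> \<gamma>) else 0)"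
    by simp
  finally show ?thesis using keys_pt_subset[of t k l \<beta> \<gamma>] by (simp add: face_def)
qed

text \<open>The relations have the form \<open>U \<alpha> + V \<beta> \<gamma> = const\<close> with \<open>\<alpha> + \<beta> + \<gamma> = 4\<close>, so \<open>V\<close> depends on \<open>\<beta> + \<gamma>\<close> only, and
  its lowest nonvanishing degree requires at least three elements of \<open>S\<close>.\<close>

lemma full_edge_contradiction:
  assumes t: "t \<in> T" and dist: "distinct [t,k,j,l]" and k: "pt t k l 1 0 \<notin> S" and d: "d = 4"
    and two: "card (face {t,k,l}) \<le> 2"
    and only: "\<And>s. s \<in> face {t,k,j,l} \<Longrightarrow> j \<in> keys s \<Longrightarrow> keys s = {t,j}"
  shows False
proof -
  have dist': "distinct [t,k,l]" using dist by auto
  define V where "V \<beta> \<gamma> = (\<Sum>s\<in>face {t,k,l}. root_coeff f t s * of_nat ((\<beta> choose lookup s k) * (\<gamma> choose lookup s l)))" for \<beta> \<gamma>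
  define U where "U \<alpha> = (\<Sum>s | s \<in> S \<and> keys s = {t,j}. root_coeff f t s * of_nat (\<alpha> choose lookup s j))" for \<alpha>
  have split: "face {t,k,j,l} = {s. s \<in> S \<and> keys s = {t,j}} \<union> face {t,k,l}"
    using only by (auto simp: face_def)
  have UV: "U \<alpha> + V \<beta> \<gamma> = - top_coeff t" if "\<alpha> + \<beta> + \<gamma> = 4" "\<alpha> < 4" "\<beta> < 4" "\<gamma> < 4" for \<alpha> \<beta> \<gamma>
  proof -
    let ?a = "\<lambda>i. if i = k then \<beta> else if i = j then \<alpha> else \<gamma>"
    have P: "(\<Prod>i\<in>{k,j,l}. ?a i choose lookup s i) = (\<beta> choose lookup s k) * (\<alpha> choose lookup s j) * (\<gamma> choose lookup s l)" for s
    proof -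
      have "k \<noteq> j" "k \<noteq> l" "j \<noteq> l" "j \<noteq> k" "l \<noteq> k" "l \<noteq> j" using dist by auto
      then show ?thesis by (simp add: mult.assoc)
    qed
    have "- top_coeff t = (\<Sum>s\<in>face {t,k,j,l}. root_coeff f t s * of_nat ((\<beta> choose lookup s k) * (\<alpha> choose lookup s j) * (\<gamma> choose lookup s l)))"
      using face_identity[of t "{k,j,l}" ?a] t that dist d unfolding P by auto
    also have "\<dots> = (\<Sum>s | s \<in> S \<and> keys s = {t,j}. root_coeff f t s * of_nat ((\<beta> choose lookup s k) * (\<alpha> choose lookup s j) * (\<gamma> choose lookup s l)))
       + (\<Sum>s\<in>face {t,k,l}. root_coeff f t s * of_nat ((\<beta> choose lookup s k) * (\<alpha> choose lookup s j) * (\<gamma> choose lookup s l)))"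
      unfolding split by (rule sum.union_disjoint) (use dist in \<open>auto simp: face_def\<close>)
    also have "(\<Sum>s | s \<in> S \<and> keys s = {t,j}. root_coeff f t s * of_nat ((\<beta> choose lookup s k) * (\<alpha> choose lookup s j) * (\<gamma> choose lookup s l))) = U \<alpha>"
      unfolding U_def
    proof (rule sum.cong[OF refl])
      fix s assume "s \<in> {s. s \<in> S \<and> keys s = {t,j}}"
      then have "k \<notin> keys s" "l \<notin> keys s" using dist by auto
      then show "root_coeff f t s * of_nat ((\<beta> choose lookup s k) * (\<alpha> choose lookup s j) * (\<gamma> choose lookup s l))
        = root_coeff f t s * of_nat (\<alpha> choose lookup s j)" by (simp add: not_in_keys_iff_lookup_eq_zero)
    qed
    also have "(\<Sum>s\<in>face {t,k,l}. root_coeff f t s * of_nat ((\<beta> choose lookup s k) * (\<alpha> choose lookup s j) * (\<gamma> choose lookup s l))) = V \<beta> \<gamma>"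
      unfolding V_def
    proof (rule sum.cong[OF refl])
      fix s assume "s \<in> face {t,k,l}"
      then have "j \<notin> keys s" using dist by (auto simp: face_def)
      then show "root_coeff f t s * of_nat ((\<beta> choose lookup s k) * (\<alpha> choose lookup s j) * (\<gamma> choose lookup s l))
        = root_coeff f t s * of_nat ((\<beta> choose lookup s k) * (\<gamma> choose lookup s l))" by (simp add: not_in_keys_iff_lookup_eq_zero)
    qed
    finally show ?thesis by simp
  qed
  have U0: "U 0 = 0" unfolding U_def
    by (rule sum.neutral) (auto simp: binomial_eq_0_iff in_keys_iff)
  have lead: "V \<beta> \<gamma> \<noteq> 0 \<longleftrightarrow> pt t k l \<beta> \<gamma> \<in> S"
    if "\<beta> + \<gamma> = \<sigma>" "\<sigma> \<le> 4" "\<And>s. s \<in> face {t,k,l} \<Longrightarrow> lookup s k + lookup s l \<ge> \<sigma>" for \<beta> \<gamma> \<sigma>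
  proof -
    have "\<beta> + \<gamma> \<le> d" using that(1,2) d by simp
    then have "V \<beta> \<gamma> = (if pt t k l \<beta> \<gamma> \<in> S then root_coeff f t (pt t k l \<beta> \<gamma>) else 0)"
      unfolding V_def using that by (intro leading_value[OF t dist']) auto
    moreover have "pt t k l \<beta> \<gamma> \<in> S \<Longrightarrow> root_coeff f t (pt t k l \<beta> \<gamma>) \<noteq> 0"
      unfolding root_coeff_nonzero S_def by simp
    ultimately show ?thesis by simp
  qed
  have three: False if "distinct [(b1,c1),(b2,c2),(b3,c3)]" "pt t k l b1 c1 \<in> S" "pt t k l b2 c2 \<in> S" "pt t k l b3 c3 \<in> S" for b1 c1 b2 c2 b3 c3
  proof -
    have "{pt t k l b1 c1, pt t k l b2 c2, pt t k l b3 c3} \<subseteq> face {t,k,l}"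
      using that keys_pt_subset by (auto simp: face_def)
    then have "card {pt t k l b1 c1, pt t k l b2 c2, pt t k l b3 c3} \<le> 2"
      using two card_mono[OF finite_face] le_trans by blast
    moreover have "card {pt t k l b1 c1, pt t k l b2 c2, pt t k l b3 c3} = 3"
      using that(1) dist' by (auto simp: pt_eq_iff)
    ultimately show False by simp
  qed
  have pts: "s = pt t k l (lookup s k) (lookup s l)" if "s \<in> face {t,k,l}" for s
    using face_pt(1)[OF dist'] that S_degree by (auto simp: face_def)
  have step: "\<forall>s\<in>face {t,k,l}. lookup s k + lookup s l \<ge> Suc \<sigma>"
    if Z: "\<forall>s\<in>face {t,k,l}. lookup s k + lookup s l \<ge> \<sigma>"
      and N: "\<And>\<beta> \<gamma>. \<beta> + \<gamma> = \<sigma> \<Longrightarrow> pt t k l \<beta> \<gamma> \<notin> S" for \<sigma>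
  proof
    fix s assume s: "s \<in> face {t,k,l}"
    have "lookup s k + lookup s l \<noteq> \<sigma>"
      using N[of "lookup s k" "lookup s l"] pts[OF s] s by (auto simp: face_def)
    then show "lookup s k + lookup s l \<ge> Suc \<sigma>" using Z s by force
  qed
  have Veq: "V \<beta> \<gamma> = V \<beta>' \<gamma>'" if "\<beta> + \<gamma> = \<sigma>" "\<beta>' + \<gamma>' = \<sigma>" "1 \<le> \<sigma>" "\<sigma> < 4" for \<beta> \<gamma> \<beta>' \<gamma>' \<sigma>
  proof -
    have "U (4 - \<sigma>) + V \<beta> \<gamma> = - top_coeff t" by (rule UV) (use that in linarith)+
    moreover have "U (4 - \<sigma>) + V \<beta>' \<gamma>' = - top_coeff t" by (rule UV) (use that in linarith)+
    ultimately show ?thesis by (metis add_left_cancel)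
  qed
  have Z1: "\<forall>s\<in>face {t,k,l}. lookup s k + lookup s l \<ge> 1"
  proof
    fix s assume s: "s \<in> face {t,k,l}"
    have "k \<in> keys s \<or> l \<in> keys s" using face_triangle_cases[OF s] by auto
    then show "lookup s k + lookup s l \<ge> 1" by (auto simp: in_keys_iff)
  qed
  \<comment> \<open>Degree 1 has only two points, so \<open>three\<close> does not apply; the
    assumption that \<open>(1, 0)\<close> is not in \<open>S\<close> settles it.\<close>
  have Z2: "\<forall>s\<in>face {t,k,l}. lookup s k + lookup s l \<ge> 2"
  proof -
    have "pt t k l \<beta> \<gamma> \<notin> S" if "\<beta> + \<gamma> = 1" for \<beta> \<gamma>
      using Veq[OF that, of 1 0] lead[OF that] lead[of 1 0 1] Z1 k by auto
    from step[OF Z1 this] show ?thesis by (simp add: numeral_2_eq_2)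
  qed
  have Z3: "\<forall>s\<in>face {t,k,l}. lookup s k + lookup s l \<ge> 3"
  proof -
    have "pt t k l \<beta> \<gamma> \<notin> S" if "\<beta> + \<gamma> = 2" for \<beta> \<gamma>
    proof
      assume "pt t k l \<beta> \<gamma> \<in> S"
      then have "V \<beta> \<gamma> \<noteq> 0" using lead[OF that] Z2 by auto
      then have "pt t k l b c \<in> S" if "b + c = 2" for b c
        using Veq[OF \<open>\<beta> + \<gamma> = 2\<close> that] lead[OF that] Z2 by auto
      then show False using three[of 2 0 1 1 0 2] by auto
    qed
    from step[OF Z2 this] show ?thesis by simp
  qed
  have Z4: "\<forall>s\<in>face {t,k,l}. lookup s k + lookup s l \<ge> 4"
  proof -
    have "pt t k l \<beta> \<gamma> \<notin> S" if "\<beta> + \<gamma> = 3" for \<beta> \<gamma>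
    proof
      assume "pt t k l \<beta> \<gamma> \<in> S"
      then have "V \<beta> \<gamma> \<noteq> 0" using lead[OF that] Z3 by auto
      then have "pt t k l b c \<in> S" if "b + c = 3" for b c
        using Veq[OF \<open>\<beta> + \<gamma> = 3\<close> that] lead[OF that] Z3 by auto
      then show False using three[of 2 1 1 2 0 3] by auto
    qed
    from step[OF Z3 this] show ?thesis by simp
  qed
  \<comment> \<open>In degree 4 the exponent \<open>\<alpha>\<close> is 0 and \<open>U\<close>
    vanishes, so all three points \<open>(1, 3)\<close>, \<open>(2, 2)\<close>,
    \<open>(3, 1)\<close> would lie in \<open>S\<close>.\<close>
  have "pt t k l b c \<in> S" if "b + c = 4" "b < 4" "c < 4" for b c
    using UV[of 0 b c] that U0 lead[OF that(1)] Z4 top_coeff_nonzero[OF t] by auto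
  then show False using three[of 2 2 1 3 3 1] by auto
qed

lemma row_ge:
  assumes dist: "distinct [t,k,j]" and one: "\<And>p p'. p \<in> {1..<d} \<Longrightarrow> p' \<in> {1..<d} \<Longrightarrow> p \<noteq> p' \<Longrightarrow>
      pt t k j p 1 \<in> M \<Longrightarrow> pt t k j p' 1 \<in> M \<Longrightarrow> False"
  shows "face_count {k,j} + face_count {t,k,j} \<ge> d - 2"
proof -
  let ?Q = "{p\<in>{1..<d}. pt t k j p 1 \<in> M}"
  have "card ?Q \<le> 1"
    using one by (auto simp: card_le_Suc0_iff_eq)
  moreover have "card ({1..<d} - ?Q) = (d - 1) - card ?Q" by (subst card_Diff_subset) auto
  ultimately have "card (({1..<d} - ?Q) \<times> {1::nat}) \<ge> d - 2" by (simp add: card_cartesian_product)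
  also have "card (({1..<d} - ?Q) \<times> {1::nat}) \<le> face_count {k,j} + face_count {t,k,j}"
  proof (rule mid_ge[OF dist])
    fix p q assume pq: "(p,q) \<in> ({1..<d} - ?Q) \<times> {1::nat}"
    then show "1 \<le> p \<and> 1 \<le> q \<and> pt t k j p q \<in> S"
      using pt_M_iff[OF dist, of p q] d4 by auto
  qed
  finally show ?thesis .
qed

lemma edge_full_ge:
  assumes dist: "distinct [t,k,j]" and n: "\<And>p. 2 \<le> p \<Longrightarrow> p < d \<Longrightarrow> pt t k j p 0 \<notin> M"
  shows "face_count {t,k} \<ge> d - 2"
proof -
  have "card {2..<d} \<le> face_count {t,k}"
    by (rule edge_ge[OF dist]) (use n pt_M_iff[OF dist, of _ 0] d4 in auto)
  then show ?thesis by simp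
qed

lemma edge_ge_1:
  assumes dist: "distinct [t,k,j]" and n: "1 \<le> p" "p < d" "pt t k j p 0 \<in> S"
  shows "face_count {t,k} \<ge> 1"
  using edge_ge[OF dist, of "{p}"] n by auto

lemma mid_ge_1:
  assumes dist: "distinct [t,k,j]" and n: "1 \<le> p" "1 \<le> q" "pt t k j p q \<in> S"
  shows "face_count {k,j} + face_count {t,k,j} \<ge> 1"
  using mid_ge[OF dist, of "{(p,q)}"] n by auto

lemma least_nat: "(\<exists>n. P (n::nat)) \<Longrightarrow> \<exists>n. P n \<and> (\<forall>m<n. \<not> P m)"
  using exists_least_iff[of P] by blast

text \<open>At the vertex \<open>x_t^(d-1) x_k\<close> the lowest point of the axis
  \<open>p = 0\<close>, the first point of the row \<open>q = 1\<close> and the first point beyond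
  the vertex on the axis \<open>q = 0\<close> would be three atoms; the row starts at
  \<open>p >= 1\<close> because \<open>(0, 1)\<close> is in \<open>S\<close>. Hence one of these
  three is missing, that line is filled by elements of \<open>S\<close>, and the bound five is in
  conflict.\<close>

lemma adjacent_or:
  assumes t: "t \<in> T" and kt: "distinct [t,k,j]" and k: "pt t k j 1 0 \<notin> S"
  shows "pt t j k 1 0 \<notin> S"
proof
  assume jS: "pt t j k 1 0 \<in> S"
  obtain l where l: "l \<notin> {t,k,j}" by (rule exists_fourth)
  have dist: "distinct [t,k,j]" "distinct [t,j,k]" "distinct [t,k,j,l]" "distinct [t,k,l]" "distinct [t,j,l]" "distinct [t,l,k]"
    using kt l by auto
  have kM: "pt t k j 1 0 \<in> M" using pt_M_iff[OF kt, of 1 0] k d4 by auto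
  have j01: "pt t k j 0 1 \<in> S" using jS by (simp add: pt_swap)
  then have j01M: "pt t k j 0 1 \<notin> M" by (auto simp: M_def)
  have E: "face_count {t,j} \<ge> 1" using edge_ge_1[OF dist(2), of 1] jS d4 by simp
  have F: "face_count {t,k} + face_count {t,l} + face_count {k,l} + face_count {t,k,l} \<ge> 2"
    by (rule F1[OF t dist(4)])
  note bud = budget[OF t dist(3) k]
  define PA where "PA \<longleftrightarrow> (\<forall>b. 1 \<le> b \<and> b < d \<longrightarrow> pt t k j 0 b \<notin> M)"
  define PB where "PB \<longleftrightarrow> (\<forall>p. 1 \<le> p \<and> p < d \<longrightarrow> pt t k j p 1 \<notin> M)"
  define PC where "PC \<longleftrightarrow> (\<forall>p. 2 \<le> p \<and> p < d \<longrightarrow> pt t k j p 0 \<notin> M)"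
  consider (a) PA | (b1) PB | (b2) "\<not> PA" PC | (c) "\<not> PA" "\<not> PB" "\<not> PC" by blast
  then show False
  proof cases
    \<comment> \<open>The only tight case: \<open>d - 1\<close> elements on the edge
      \<open>tj\<close> and two more in the triangle \<open>t, k, l\<close> meet the bound exactly
      for \<open>d = 4\<close>, and nothing else may occur.\<close>
    case a
    have "card {1..<d} \<le> face_count {t,j}"
      by (rule edge_ge[OF dist(2)]) (use a[unfolded PA_def] pt_M_iff[OF kt, of 0] d4 pt_swap[of t j k] in auto)
    then have "d - 1 \<le> face_count {t,j}" by simp
    with bud F d4 have 1: "d = 4" "face_count {t,k} + face_count {t,l} + face_count {k,l} + face_count {t,k,l} \<le> 2"
      "face_count {k,j} = 0" "face_count {j,l} = 0" "face_count {t,k,j} = 0" "face_count {t,j,l} = 0" "face_count {k,j,l} = 0" "face_count {t,k,j,l} = 0"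
      by linarith+
    show False
    proof (rule full_edge_contradiction[OF t dist(3) _ 1(1)])
      show "pt t k l 1 0 \<notin> S" using k pt_edge by metis
      show "card (face {t,k,l}) \<le> 2" using 1(2) card_face3[OF dist(4)] by simp
      fix s assume s: "s \<in> face {t,k,j,l}" "j \<in> keys s"
      then have sS: "s \<in> S" "keys s \<subseteq> {t,k,j,l}" by (auto simp: face_def)
      note z = 1(3-8)[THEN face_count_0, OF sS(1)]
      have nj: "keys s \<noteq> {j}" using S_keys[OF sS(1), of j] by auto
      define bt bk bl where "bt = (t \<in> keys s)" and "bk = (k \<in> keys s)" and "bl = (l \<in> keys s)"
      have eq: "keys s = insert j ((if bt then {t} else {}) \<union> (if bk then {k} else {}) \<union> (if bl then {l} else {}))"
        using sS(2) s(2) by (auto simp: bt_def bk_def bl_def)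
      show "keys s = {t,j}"
        using z nj unfolding eq by (cases bt; cases bk; cases bl) (simp_all add: insert_commute)
    qed
  next
    case b1
    have "card ({1..<d} \<times> {1::nat}) \<le> face_count {k,j} + face_count {t,k,j}"
      by (rule mid_ge[OF kt]) (use b1[unfolded PB_def] pt_M_iff[OF kt, of _ 1] d4 in auto)
    then have "d - 1 \<le> face_count {k,j} + face_count {t,k,j}" by (simp add: card_cartesian_product)
    then show False using bud F E d4 by linarith
  next
    \<comment> \<open>All points of the row \<open>q = 1\<close> left in \<open>M\<close> are atoms
      besides \<open>(0, b)\<close>, so at most one of those with \<open>p >= 1\<close> remains in
      \<open>M\<close>. The edge \<open>tk\<close> and the row give \<open>2 (d - 2)\<close>
      elements, the edge \<open>tj\<close> and an element divisible by \<open>x_l\<close> one each: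
      at least six.\<close>
    case b2
    have noax: "pt t k j p 0 \<notin> M" if "2 \<le> p" for p
    proof (cases "p < d")
      case False
      then have "p = d \<or> d < p" by linarith
      then show ?thesis
      proof
        assume "d < p"
        then have "lookup (pt t k j p 0) k > d" using lookup_pt(1)[OF kt] by simp
        then show ?thesis using lookup_le_exp_degree[of "pt t k j p 0" k] by (auto simp: M_def)
      qed (use pt_0_notin_M in auto)
    qed (use b2(2)[unfolded PC_def] that in auto)
    have e: "face_count {t,k} \<ge> d - 2" by (rule edge_full_ge[OF kt]) (use noax in auto)
    obtain b where b: "1 \<le> b" "pt t k j 0 b \<in> M" "\<And>b'. b' < b \<Longrightarrow> \<not> (1 \<le> b' \<and> pt t k j 0 b' \<in> M)"
      using least_nat[of "\<lambda>b. 1 \<le> b \<and> pt t k j 0 b \<in> M"] b2(1)[unfolded PA_def] by blast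
    have at: "atom_at M (pt t k j 1 0) (pt t k j 0 b)" by (rule atom_axis_j[OF kt b(2)]) (use b(3) in blast)
    have r: "face_count {k,j} + face_count {t,k,j} \<ge> d - 2"
    proof (rule row_ge[OF kt])
      fix p p' assume p: "p \<in> {1..<d}" "p' \<in> {1..<d}" "p \<noteq> p'" "pt t k j p 1 \<in> M" "pt t k j p' 1 \<in> M"
      have "distinct [(0, b), (p, 1), (p', 1)]" using p(1-3) by auto
      from no3_pt[OF kt kM this at] show False using atom_row_any[OF kt p(4) noax] atom_row_any[OF kt p(5) noax] by simp
    qed
    have "\<exists>s\<in>face {t,k,l}. l \<in> keys s" by (rule face_reaching[OF t dist(4) k])
    then obtain s where s: "s \<in> face {t,k,l}" "l \<in> keys s" by blast
    have sS: "face_count (keys s) > 0" using s(1) by (intro face_count_pos) (simp add: face_def)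
    have "keys s = {t,l} \<or> keys s = {k,l} \<or> keys s = {t,k,l}"
      using face_triangle_cases[OF s(1)] s(2) dist(4) by auto
    then have "face_count {t,l} + face_count {k,l} + face_count {t,k,l} \<ge> 1"
      using sS by (elim disjE) simp_all
    then show False using bud e r E d4 by linarith
  next
    case c
    obtain b where b: "1 \<le> b" "pt t k j 0 b \<in> M" "\<And>b'. b' < b \<Longrightarrow> \<not> (1 \<le> b' \<and> pt t k j 0 b' \<in> M)"
      using least_nat[of "\<lambda>b. 1 \<le> b \<and> pt t k j 0 b \<in> M"] c(1)[unfolded PA_def] by blast
    obtain p where p: "pt t k j p 1 \<in> M" "\<And>b'. b' < p \<Longrightarrow> \<not> (pt t k j b' 1 \<in> M)"
      using least_nat[of "\<lambda>b. pt t k j b 1 \<in> M"] c(2)[unfolded PB_def] by blast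
    obtain q where q: "2 \<le> q" "pt t k j q 0 \<in> M" "\<And>b'. b' < q \<Longrightarrow> \<not> (2 \<le> b' \<and> pt t k j b' 0 \<in> M)"
      using least_nat[of "\<lambda>b. 2 \<le> b \<and> pt t k j b 0 \<in> M"] c(3)[unfolded PC_def] by blast
    have p1: "p \<ge> 1" using p(1) j01M by (cases p) auto
    have a1: "atom_at M (pt t k j 1 0) (pt t k j 0 b)" by (rule atom_axis_j[OF kt b(2)]) (use b(3) in blast)
    have a2: "atom_at M (pt t k j 1 0) (pt t k j p 1)" by (rule atom_row[OF kt p(1) p(2) p1])
    have a3: "atom_at M (pt t k j 1 0) (pt t k j q 0)" by (rule atom_axis_k[OF kt q(2) _ q(1)]) (use q(3) in blast)
    have "distinct [(0, b), (p, 1), (q, 0)]" using p1 b(1) q(1) by auto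
    from no3_pt[OF kt kM this a1 a2 a3] show False .
  qed
qed

text \<open>\<open>not_all_adjacent\<close> provides one such variable, and
  \<open>adjacent_or\<close> carries the property over to all others.\<close>

lemma all_adjacent_M:
  assumes t: "t \<in> T" and kt: "distinct [t,k,j]"
  shows "pt t k j 1 0 \<notin> S" "pt t k j 1 0 \<in> M"
proof -
  obtain k0 where k0: "k0 \<noteq> t" "single k0 1 + single t (d - 1) \<notin> S"
    using not_all_adjacent[OF t] by blast
  show 1: "pt t k j 1 0 \<notin> S"
  proof (cases "k = k0")
    case True then show ?thesis unfolding adjacent_pt using k0(2) by blast
  next
    case False
    then have "distinct [t,k0,k]" using k0(1) kt by auto
    moreover have "pt t k0 k 1 0 \<notin> S" unfolding adjacent_pt by (rule k0(2))
    ultimately have "pt t k k0 1 0 \<notin> S" by (rule adjacent_or[OF t])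
    then show ?thesis unfolding adjacent_pt .
  qed
  then show "pt t k j 1 0 \<in> M" using pt_M_iff[OF kt, of 1 0] d4 by auto
qed

text \<open>\<open>(0, 1)\<close> and the first point \<open>(q, 0)\<close> with
  \<open>q >= 2\<close> are already two atoms at the vertex. With \<open>(2, 0)\<close> missing,
  \<open>(1, 1)\<close> would be a third one, and if that is missing too, \<open>(0, 2)\<close>
  would be.\<close>

lemma square_notin_S_aux:
  assumes t: "t \<in> T" and dist: "distinct [t,k,j]" and S2: "pt t k j 2 0 \<in> S"
    and q: "2 \<le> q" "pt t k j q 0 \<in> M"
  shows "pt t k j 1 1 \<in> S \<and> pt t k j 0 2 \<in> S"
proof -
  have dist': "distinct [t,j,k]" using dist by auto
  have kM: "pt t k j 1 0 \<in> M" by (rule all_adjacent_M[OF t dist])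
  have j1: "pt t k j 0 1 \<in> M" using all_adjacent_M(2)[OF t dist'] by (simp add: pt_swap)
  have n2: "pt t k j 2 0 \<notin> M" using S2 by (simp add: M_def)
  have at: "atom_at M (pt t k j 1 0) (pt t k j 0 1)" by (rule atom_axis_j[OF dist j1]) simp
  obtain q where q: "2 \<le> q" "pt t k j q 0 \<in> M" "\<And>b'. b' < q \<Longrightarrow> \<not> (2 \<le> b' \<and> pt t k j b' 0 \<in> M)"
    using least_nat[of "\<lambda>b. 2 \<le> b \<and> pt t k j b 0 \<in> M"] q by blast
  have aq: "atom_at M (pt t k j 1 0) (pt t k j q 0)" by (rule atom_axis_k[OF dist q(2) _ q(1)]) (use q in blast)
  have 11: "pt t k j 1 1 \<notin> M"
  proof
    assume "pt t k j 1 1 \<in> M"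
    then show False using no3_pt[OF dist kM _ at atom_1_1[OF dist _ n2] aq] by auto
  qed
  have 02: "pt t k j 0 2 \<notin> M"
  proof
    assume "pt t k j 0 2 \<in> M"
    then show False using no3_pt[OF dist kM _ at atom_0_2[OF dist _ n2 11] aq] by auto
  qed
  show ?thesis using 11 02 pt_M_iff[OF dist, of 1 1] pt_M_iff[OF dist, of 0 2] d4 by auto
qed

text \<open>If the edge \<open>tk\<close> keeps a point beyond the vertex, the auxiliary lemma
  spreads the assumption from \<open>k\<close> to \<open>j\<close> and \<open>l\<close>; three edges
  and three triangles, or a filled edge \<open>tj\<close> in place of the last triangle, then yield
  six elements. Otherwise the edge \<open>tk\<close> and the rows towards \<open>j\<close> and
  \<open>l\<close> contain at least \<open>d - 2 >= 2\<close> elements of \<open>S\<close>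
  each.\<close>

lemma square_notin_S:
  assumes t: "t \<in> T" and dist: "distinct [t,k,j]"
  shows "pt t k j 2 0 \<notin> S"
proof
  assume S2: "pt t k j 2 0 \<in> S"
  obtain l where l: "l \<notin> {t,k,j}" by (rule exists_fourth)
  have D: "distinct [t,j,k]" "distinct [t,k,j,l]" "distinct [t,k,l]" "distinct [t,j,l]" "distinct [t,l,j]" "distinct [t,l,k]"
    using dist l by auto
  note bud = budget_tri[OF t D(2) all_adjacent_M(1)[OF t dist]]
  have S2': "pt t k l 2 0 \<in> S" using S2 pt_edge by metis
  show False
  proof (cases "\<exists>q\<ge>2. pt t k j q 0 \<in> M")
    case True
    then obtain q where q: "2 \<le> q" "pt t k j q 0 \<in> M" "pt t k l q 0 \<in> M" using pt_edge by metis
    note kj = square_notin_S_aux[OF t dist S2 q(1,2)]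
    note kl = square_notin_S_aux[OF t D(3) S2' q(1,3)]
    have jS: "pt t j l 2 0 \<in> S" using kj pt_edge[of t j k 2 l] pt_swap[of t j k 2 0] by simp
    have lS: "pt t l k 2 0 \<in> S" using kl pt_swap[of t l k 2 0] by simp
    have c: "face_count {t,k} \<ge> 1" "face_count {t,j} \<ge> 1" "face_count {t,l} \<ge> 1"
      using edge_ge_1[OF dist _ _ S2] edge_ge_1[OF D(4) _ _ jS] edge_ge_1[OF D(6) _ _ lS] d4 by auto
    have m: "face_count {k,j} + face_count {t,k,j} \<ge> 1" "face_count {k,l} + face_count {t,k,l} \<ge> 1"
      using mid_ge_1[OF dist, of 1 1] mid_ge_1[OF D(3), of 1 1] kj kl by auto
    show False
    proof (cases "\<exists>q\<ge>2. pt t j l q 0 \<in> M")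
      case True
      then obtain r where "2 \<le> r" "pt t j l r 0 \<in> M" by blast
      from square_notin_S_aux[OF t D(4) jS this]
      have "face_count {j,l} + face_count {t,j,l} \<ge> 1" using mid_ge_1[OF D(4), of 1 1] by auto
      then show False using bud c m by linarith
    next
      case False
      then have "face_count {t,j} \<ge> d - 2" using edge_full_ge[OF D(4)] by blast
      then show False using bud c m d4 by linarith
    qed
  next
    case False
    then have noax: "pt t k j p 0 \<notin> M" "pt t k l p 0 \<notin> M" if "2 \<le> p" for p using that pt_edge by metis+
    have row: "face_count {k,j} + face_count {t,k,j} \<ge> d - 2" if dist: "distinct [t,k,j]" and noax: "\<And>p. 2 \<le> p \<Longrightarrow> pt t k j p 0 \<notin> M" for j
    proof (rule row_ge[OF dist])
      fix p p' assume p: "p \<in> {1..<d}" "p' \<in> {1..<d}" "p \<noteq> p'" "pt t k j p 1 \<in> M" "pt t k j p' 1 \<in> M"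
      have j1: "pt t k j 0 1 \<in> M" using all_adjacent_M(2)[OF t, of j k] dist by (auto simp: pt_swap)
      have at: "atom_at M (pt t k j 1 0) (pt t k j 0 1)" by (rule atom_axis_j[OF dist j1]) simp
      have "distinct [(0, 1), (p, 1), (p', 1)]" using p(1-3) by auto
      from no3_pt[OF dist all_adjacent_M(2)[OF t dist] this at] show False
        using atom_row_any[OF dist p(4) noax] atom_row_any[OF dist p(5) noax] by simp
    qed
    have "face_count {t,k} \<ge> d - 2" using edge_full_ge[OF dist] noax by blast
    with row[OF dist noax(1)] row[OF D(3) noax(2)] bud d4 show False by linarith
  qed
qed

lemma edge_gt_2:
  assumes t: "t \<in> T" and k: "k \<noteq> t" and s: "s \<in> S" "keys s = {t,k}"
  shows "lookup s k > 2"
proof -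
  obtain j where j: "j \<notin> {t,k,k}" by (rule exists_fourth)
  then have dist: "distinct [t,k,j]" using k by auto
  have "lookup s j = 0" using s j by (auto simp flip: not_in_keys_iff_lookup_eq_zero)
  then have pt: "s = pt t k j (lookup s k) 0" using face_pt(1)[OF dist S_degree[OF s(1)]] s by auto
  have "k \<in> keys s" using s by simp
  then have "lookup s k \<noteq> 0" by (simp add: in_keys_iff)
  moreover have "lookup s k \<noteq> 1" using pt s(1) all_adjacent_M(1)[OF t dist] by metis
  moreover have "lookup s k \<noteq> 2" using pt s(1) square_notin_S[OF t dist] by metis
  ultimately show ?thesis by linarith
qed

lemma T_empty: "T = {}"
proof (rule ccontr)
  assume "T \<noteq> {}"
  then obtain t where t: "t \<in> T" by blast
  obtain a where a: "a \<notin> {t,t,t}" by (rule exists_fourth)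
  obtain b where b: "b \<notin> {t,a,a}" by (rule exists_fourth)
  obtain c where c: "c \<notin> {t,a,b}" by (rule exists_fourth)
  have D: "distinct [t,a,b,c]" "distinct [t,a,b]" "distinct [t,b,a]" "distinct [t,a,c]" "distinct [t,c,a]"
     "distinct [t,b,c]" "distinct [t,c,b]" "distinct [a,b,c]" "distinct [b,a,c]" "distinct [c,a,b]" "t \<noteq> a" "t \<noteq> b" "t \<noteq> c"
    using a b c by auto
  have F2': "face_count {j,k} + face_count {t,j,k} \<ge> 1" if "distinct [t,j,k]" "face_count {t,j} \<le> 1" for j k
    by (rule F2[OF t that]) (use edge_gt_2[OF t, of k] that in auto)
  \<comment> \<open>An empty edge at \<open>t\<close> puts its other end in \<open>T\<close> by
    \<open>edge_identity\<close>, so the triangle opposite \<open>t\<close> is bounded from below as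
    well.\<close>
  have F1': "face_count {a,b} + face_count {a,c} + face_count {b,c} + face_count {a,b,c} \<ge> 2"
    if z: "face_count {t,a} = 0 \<or> face_count {t,b} = 0 \<or> face_count {t,c} = 0"
  proof -
    from z have "a \<in> T \<or> b \<in> T \<or> c \<in> T"
      using edge_identity[OF D(11) t] edge_identity[OF D(12) t] edge_identity[OF D(13) t] by auto
    then show ?thesis
      using F1[OF _ D(8)] F1[OF _ D(9)] F1[OF _ D(10)] by (auto simp: insert_commute)
  qed
  have sym: "face_count {b,a} = face_count {a,b}" "face_count {c,a} = face_count {a,c}" "face_count {c,b} = face_count {b,c}"
    "face_count {t,b,a} = face_count {t,a,b}" "face_count {t,c,a} = face_count {t,a,c}" "face_count {t,c,b} = face_count {t,b,c}"
    by (simp_all add: insert_commute)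
  show False
  proof (rule face_count_arith)
    show "face_count {t,a} + face_count {t,b} + face_count {t,c}
     + face_count {a,b} + face_count {a,c} + face_count {b,c}
     + face_count {t,a,b} + face_count {t,a,c} + face_count {t,b,c} + face_count {a,b,c} + face_count {t,a,b,c} \<le> 5"
      by (rule budget[OF t D(1) all_adjacent_M(1)[OF t D(2)]])
    show "face_count {t,a} + face_count {t,b} + face_count {a,b} + face_count {t,a,b} \<ge> 2"
      "face_count {t,a} + face_count {t,c} + face_count {a,c} + face_count {t,a,c} \<ge> 2"
      "face_count {t,b} + face_count {t,c} + face_count {b,c} + face_count {t,b,c} \<ge> 2"
      using F1[OF t D(2)] F1[OF t D(4)] F1[OF t D(6)] by auto
    show "face_count {a,b} + face_count {t,a,b} \<ge> 1 \<and> face_count {a,c} + face_count {t,a,c} \<ge> 1" if "face_count {t,a} \<le> 1"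
      using F2'[OF D(2) that] F2'[OF D(4) that] by simp
    show "face_count {a,b} + face_count {t,a,b} \<ge> 1 \<and> face_count {b,c} + face_count {t,b,c} \<ge> 1" if "face_count {t,b} \<le> 1"
      using F2'[OF D(3) that] F2'[OF D(6) that] sym by simp
    show "face_count {a,c} + face_count {t,a,c} \<ge> 1 \<and> face_count {b,c} + face_count {t,b,c} \<ge> 1" if "face_count {t,c} \<le> 1"
      using F2'[OF D(5) that] F2'[OF D(7) that] sym by simp
  qed (use F3[OF t D(2)] F3[OF t D(3)] F3[OF t D(4)] F3[OF t D(5)] F3[OF t D(6)] F3[OF t D(7)]
      F4[OF t D(2)] F4[OF t D(4)] F4[OF t D(6)] F1' sym in auto)
qed

end

section \<open>Evaluation along curves\<close>

lemma weighted_sum_swap: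
  "weighted_sum c (\<lambda>b. \<Sum>i\<in>UNIV. w i * g b i) = (\<Sum>i\<in>(UNIV::'v::finite set). w i * (weighted_sum c (\<lambda>b. g b i) :: nat))"
  unfolding weighted_sum_def sum_distrib_left
  by (subst sum.swap) (simp add: ac_simps)

lemma eval_mpoly_superset:
  "finite A \<Longrightarrow> keys F \<subseteq> A \<Longrightarrow> eval_mpoly a F = (\<Sum>m\<in>A. lookup F m * eval_monom a m)"
  unfolding eval_mpoly_def by (rule sum.mono_neutral_left) (auto simp: in_keys_iff)

lemma eval_mpoly_add: "eval_mpoly a (F + G) = eval_mpoly a F + eval_mpoly a G"
proof -
  have "keys (F + G) \<subseteq> keys F \<union> keys G" by (rule Poly_Mapping.keys_add)
  then show ?thesis
    by (simp add: eval_mpoly_superset[of "keys F \<union> keys G"] lookup_add distrib_right sum.distrib)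
qed

lemma eval_mpoly_zero [simp]: "eval_mpoly a 0 = 0"
  by (simp add: eval_mpoly_def)

lemma eval_mpoly_single [simp]: "eval_mpoly a (single m c) = c * eval_monom a m"
  by (simp add: eval_mpoly_superset[of "{m}"])

lemma eval_mpoly_one [simp]: "eval_mpoly a 1 = 1"
  using eval_mpoly_single[of a 0 1] by (simp add: eval_monom_def)

lemma eval_mpoly_sum: "finite A \<Longrightarrow> eval_mpoly a (\<Sum>x\<in>A. G x) = (\<Sum>x\<in>A. eval_mpoly a (G x))"
  by (induction A rule: finite_induct) (simp_all add: eval_mpoly_add)

lemma eval_partial_deriv:
  "eval_mpoly a (partial_deriv i F) =
    (\<Sum>m\<in>keys F. of_nat (lookup m i) * lookup F m * eval_monom a (m - single i 1))"
  unfolding partial_deriv_def by (subst eval_mpoly_sum) simp_all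

lemma eval_monom_one: "(\<And>b. b \<in> keys c \<Longrightarrow> p b = 1) \<Longrightarrow> eval_monom p c = 1"
  unfolding eval_monom_def by (rule prod.neutral) simp

lemma eval_monom_power:
  assumes "\<And>b. b \<in> keys c \<Longrightarrow> p b = s ^ W b"
  shows "eval_monom p c = s ^ weighted_sum c W"
proof -
  have "eval_monom p c = (\<Prod>b\<in>keys c. s ^ (lookup c b * W b))"
    unfolding eval_monom_def by (rule prod.cong) (auto simp: assms power_mult mult.commute)
  also have "\<dots> = s ^ weighted_sum c W" by (simp add: weighted_sum_def power_sum)
  finally show ?thesis .
qed

lemma eval_monom_UNIV: "eval_monom x (b :: 'v::finite exponent) = (\<Prod>i\<in>UNIV. x i ^ lookup b i)"
  unfolding eval_monom_def by (rule prod.mono_neutral_left) (auto simp: in_keys_iff)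

lemma eval_monom_monomial_map:
  fixes x :: "'v::finite \<Rightarrow> 'k::field"
  assumes "keys c \<subseteq> M"
  shows "eval_monom (monomial_map M x) c = (\<Prod>i\<in>UNIV. x i ^ weighted_sum c (\<lambda>b. lookup b i))"
proof -
  have "eval_monom (monomial_map M x) c = (\<Prod>b\<in>keys c. \<Prod>i\<in>UNIV. x i ^ (lookup c b * lookup b i))"
    unfolding eval_monom_def monomial_map_def using assms
    by (intro prod.cong) (auto simp: eval_monom_UNIV[unfolded eval_monom_def] power_mult mult.commute simp flip: prod_power_distrib)
  also have "\<dots> = (\<Prod>i\<in>UNIV. \<Prod>b\<in>keys c. x i ^ (lookup c b * lookup b i))" by (rule prod.swap)
  finally show ?thesis by (simp add: weighted_sum_def power_sum)
qed

lemma eval_monom_indicator: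
  "eval_monom (\<lambda>x. if x = m then 1 else 0 :: 'k::comm_ring_1) c = (if keys c \<subseteq> {m} then 1 else 0)"
proof (cases "keys c \<subseteq> {m}")
  case True
  have "eval_monom (\<lambda>x. if x = m then 1 else 0 :: 'k) c = 1" by (rule eval_monom_one) (use True in auto)
  with True show ?thesis by simp
next
  case False
  then obtain b where "b \<in> keys c" "b \<noteq> m" by blast
  then have "eval_monom (\<lambda>x. if x = m then 1 else 0 :: 'k) c = 0"
    unfolding eval_monom_def by (intro prod_zero) (auto simp: in_keys_iff power_0_left intro!: bexI[of _ b])
  with False show ?thesis by simp
qed

text \<open>An algebraic substitute for a curve tending to \<open>x\<close>: up to finitely many
  parameters it lies in every neighbourhood of \<open>x\<close>, and this passes from the generating
  sets to finite intersections and unions.\<close>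

lemma generated_open_curve:
  assumes "generate_topology_on \<B> U" "x \<in> U"
    and "\<And>B. B \<in> \<B> \<Longrightarrow> x \<in> B \<Longrightarrow> finite {s\<in>D. \<gamma> s \<notin> B}"
  shows "finite {s\<in>D. \<gamma> s \<notin> U}"
  using assms(1,2)
proof (induction U rule: generate_topology_on.induct)
  case (Int a b)
  then have "finite ({s\<in>D. \<gamma> s \<notin> a} \<union> {s\<in>D. \<gamma> s \<notin> b})" by auto
  then show ?case by (rule rev_finite_subset) auto
next
  case (UN K)
  then obtain k where "k \<in> K" "x \<in> k" by blast
  with UN have "finite {s\<in>D. \<gamma> s \<notin> k}" by blast
  then show ?case by (rule rev_finite_subset) (use \<open>k \<in> K\<close> in auto)
qed (use assms(3) in auto)

text \<open>Weights \<open>N^(idx i)\<close> turn the weight difference of two vectors into the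
  value at \<open>N\<close> of a nonzero integer polynomial; \<open>N\<close> only has to avoid
  finitely many roots.\<close>

lemma separating_weights:
  assumes "finite (E :: ('v::finite \<Rightarrow> nat) set)"
  shows "\<exists>w :: 'v \<Rightarrow> nat. inj_on (\<lambda>e. \<Sum>i\<in>UNIV. w i * e i) E"
proof -
  obtain idx :: "'v \<Rightarrow> nat" where idx: "inj idx"
    using finite_imp_inj_to_nat_seg[OF finite[of UNIV]] by blast
  define P where "P e e' = (\<Sum>i\<in>UNIV. monom (int (e i) - int (e' i)) (idx i))" for e e' :: "'v \<Rightarrow> nat"
  have P0: "P e e' \<noteq> 0" if ne: "e \<noteq> e'" for e e'
  proof -
    obtain i where i: "e i \<noteq> e' i" using ne by (auto simp: fun_eq_iff)
    have "coeff (P e e') (idx i) = (\<Sum>j\<in>UNIV. if j = i then int (e j) - int (e' j) else 0)"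
      unfolding P_def coeff_sum by (rule sum.cong) (use idx in \<open>auto simp: inj_def\<close>)
    then have "coeff (P e e') (idx i) \<noteq> 0" using i by simp
    then show ?thesis by auto
  qed
  define Z where "Z = (\<Union>e\<in>E. \<Union>e'\<in>E-{e}. {z. poly (P e e') z = 0})"
  have "finite Z" unfolding Z_def using assms P0 by (intro finite_UN_I) (auto intro: poly_roots_finite)
  then have "finite {n. int n \<in> Z}" using finite_vimageI[of Z int] by (simp add: vimage_def)
  then obtain N where N: "int N \<notin> Z" using ex_new_if_finite[OF infinite_UNIV_nat] by blast
  have "inj_on (\<lambda>e. \<Sum>i\<in>UNIV. N ^ idx i * e i) E"
  proof (rule inj_onI, rule ccontr)
    fix e e' assume e: "e \<in> E" "e' \<in> E" "(\<Sum>i\<in>UNIV. N ^ idx i * e i) = (\<Sum>i\<in>UNIV. N ^ idx i * e' i)" "e \<noteq> e'"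
    have "poly (P e e') (int N) = (\<Sum>i\<in>UNIV. int (N ^ idx i * e i)) - (\<Sum>i\<in>UNIV. int (N ^ idx i * e' i))"
      unfolding P_def by (simp add: poly_sum poly_monom algebra_simps sum_subtractf)
    also have "\<dots> = 0" using e(3) by (simp only: of_nat_sum[symmetric])
    finally show False using N e unfolding Z_def by auto
  qed
  then show ?thesis by (rule exI[of _ "\<lambda>i. N ^ idx i"])
qed

section \<open>The closure of the image of a monomial map: its points, the forms vanishing on it and
  its tangent spaces\<close>

locale monomial_variety =
  fixes M :: "'v::finite exponent set" and X :: "('v exponent \<Rightarrow> 'k::field_char_0) set" and d :: nat
  assumes finite_M: "finite M" and degree_M: "\<And>s. s \<in> M \<Longrightarrow> exp_degree s = d" and d_pos: "d \<ge> 1"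
    and X_def: "X = proj_zariski M closure_of {monomial_map M a | a. monomial_map M a \<noteq> 0}"
begin

lemma monomial_map_coord: "monomial_map M a \<in> coord_space M"
  by (simp add: monomial_map_def coord_space_def)

lemma topspace_proj: "topspace (proj_zariski M :: ('v exponent \<Rightarrow> 'k) topology) = {p \<in> coord_space M. p \<noteq> 0}"
proof -
  have "{p \<in> coord_space M. p \<noteq> 0} \<in> {{p \<in> coord_space M. p \<noteq> 0 \<and> eval_mpoly p F \<noteq> (0::'k)} | F. poly_vars F \<subseteq> M \<and> (\<exists>e. is_form e F)}"
    by (rule CollectI, rule exI[of _ 1]) (auto simp: poly_vars_def is_form_def exp_degree_def)
  then show ?thesis unfolding proj_zariski_def topology_generated_by_topspace by blast
qed

lemma image_subset_X: "monomial_map M a \<noteq> 0 \<Longrightarrow> monomial_map M a \<in> X"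
proof -
  assume n: "monomial_map M a \<noteq> 0"
  let ?S = "{monomial_map M a | a. monomial_map M a \<noteq> (0 :: 'v exponent \<Rightarrow> 'k)}"
  have "monomial_map M a \<in> topspace (proj_zariski M) \<inter> ?S"
    unfolding topspace_proj using n monomial_map_coord[of a] by (intro IntI CollectI conjI exI[of _ a]) simp_all
  then show ?thesis unfolding X_def by (rule subsetD[OF closure_of_subset_Int])
qed

lemma vanish_on_X:
  assumes F: "poly_vars F \<subseteq> M" "is_form e F" and v: "\<And>a. eval_mpoly (monomial_map M a) F = 0" and q: "q \<in> X"
  shows "eval_mpoly q F = 0"
proof (rule ccontr)
  assume n: "eval_mpoly q F \<noteq> 0"
  let ?U = "{p \<in> coord_space M. p \<noteq> 0 \<and> eval_mpoly p F \<noteq> 0}"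
  let ?S = "{monomial_map M a | a. monomial_map M a \<noteq> (0 :: 'v exponent \<Rightarrow> 'k)}"
  have op: "openin (proj_zariski M) ?U" unfolding proj_zariski_def
    by (rule topology_generated_by_Basis, rule CollectI, rule exI[of _ F]) (use F in auto)
  have q': "q \<in> topspace (proj_zariski M) \<and> (\<forall>T. q \<in> T \<and> openin (proj_zariski M) T \<longrightarrow> (\<exists>y. y \<in> ?S \<and> y \<in> T))"
    using q unfolding X_def in_closure_of .
  then have "q \<in> ?U" using n topspace_proj by auto
  then obtain y where "y \<in> ?S" "y \<in> ?U"
    using q'[THEN conjunct2, THEN spec, of ?U] op by auto
  then show False using v by auto
qed

definition curve :: "('v \<Rightarrow> nat) \<Rightarrow> 'k \<Rightarrow> 'v exponent \<Rightarrow> 'k" where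
  "curve w s = monomial_map M (\<lambda>i. s ^ w i)"

definition weight :: "('v \<Rightarrow> nat) \<Rightarrow> 'v exponent \<Rightarrow> nat" where
  "weight w b = (\<Sum>i\<in>UNIV. w i * lookup b i)"

lemma curve_eq: "curve w s b = (if b \<in> M then s ^ weight w b else 0)"
  unfolding curve_def monomial_map_def weight_def
  by (simp add: eval_monom_UNIV power_mult[symmetric] power_sum)

text \<open>The restriction of \<open>F\<close> to a curve as an actual polynomial in the parameter,
  so that infinitely many zeros force it to be 0.\<close>

definition curve_poly :: "('v \<Rightarrow> nat) \<Rightarrow> ('v exponent, 'k) mpoly \<Rightarrow> 'k poly" where
  "curve_poly w F = (\<Sum>c\<in>keys F. monom (lookup F c) (weighted_sum c (weight w)))"

lemma poly_vars_keys: "poly_vars F \<subseteq> M \<Longrightarrow> c \<in> keys F \<Longrightarrow> keys c \<subseteq> M"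
  by (auto simp: poly_vars_def)

lemma poly_curve_poly:
  assumes "poly_vars F \<subseteq> M"
  shows "poly (curve_poly w F) s = eval_mpoly (curve w s) F"
  unfolding curve_poly_def eval_mpoly_def poly_sum poly_monom
proof (rule sum.cong[OF refl])
  fix c assume c: "c \<in> keys F"
  have "eval_monom (curve w s) c = s ^ weighted_sum c (weight w)"
    by (rule eval_monom_power) (use poly_vars_keys[OF assms c] in \<open>auto simp: curve_eq\<close>)
  then show "lookup F c * s ^ weighted_sum c (weight w) = lookup F c * eval_monom (curve w s) c" by simp
qed

lemma coeff_curve_poly:
  assumes "\<And>c. c \<in> keys F \<Longrightarrow> weighted_sum c (weight w) = weighted_sum c0 (weight w) \<Longrightarrow> c = c0"
  shows "coeff (curve_poly w F) (weighted_sum c0 (weight w)) = lookup F c0"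
proof -
  have "coeff (curve_poly w F) (weighted_sum c0 (weight w)) = (\<Sum>c\<in>keys F. if c = c0 then lookup F c0 else 0)"
    unfolding curve_poly_def coeff_sum by (rule sum.cong) (use assms in auto)
  then show ?thesis by (simp add: in_keys_iff)
qed

text \<open>Every summand other than \<open>m\<close> is strictly heavier than \<open>m\<close>, so
  the minimal total weight is reached only by copies of \<open>m\<close>.\<close>

lemma weighted_sum_vertex:
  assumes m: "\<And>s. s \<in> M \<Longrightarrow> s \<noteq> m \<Longrightarrow> weight w m < weight w s"
    and c: "keys c \<subseteq> M" "weighted_sum c (weight w) \<le> exp_degree c * weight w m"
  shows "c = single m (exp_degree c)"
proof (rule single_of_keys, rule ccontr)
  assume "\<not> keys c \<subseteq> {m}"
  then obtain b where b: "b \<in> keys c" "b \<noteq> m" by blast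
  have "exp_degree c * weight w m = (\<Sum>x\<in>keys c. lookup c x * weight w m)"
    by (simp add: exp_degree_def sum_distrib_right)
  also have "\<dots> < (\<Sum>x\<in>keys c. lookup c x * weight w x)"
  proof (rule sum_strict_mono_ex1)
    show "\<forall>x\<in>keys c. lookup c x * weight w m \<le> lookup c x * weight w x"
    proof
      fix x assume "x \<in> keys c"
      then have "weight w m \<le> weight w x" using m[of x] c(1) by (cases "x = m") auto
      then show "lookup c x * weight w m \<le> lookup c x * weight w x" by (rule mult_le_mono2)
    qed
    show "\<exists>x\<in>keys c. lookup c x * weight w m < lookup c x * weight w x"
    proof (rule bexI[OF _ b(1)])
      have "weight w m < weight w b" using b c(1) by (intro m) auto
      then show "lookup c b * weight w m < lookup c b * weight w b" using b(1) by (simp add: in_keys_iff)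
    qed
  qed simp
  finally show False using c(2) by (simp add: weighted_sum_def)
qed

text \<open>The curve with the weights \<open>w\<close> tends to the vertex as its parameter goes to
  0. Algebraically: a form not vanishing at the vertex contains a power of the coordinate
  \<open>m\<close>, whose term on the curve cannot cancel because no other monomial of the form has
  the same weight.\<close>

lemma vertex_in_X:
  assumes m: "m \<in> M" "\<And>s. s \<in> M \<Longrightarrow> s \<noteq> m \<Longrightarrow> weight w m < weight w s"
  shows "(\<lambda>x. if x = m then 1 else 0) \<in> X"
proof -
  let ?p = "\<lambda>x. if x = m then 1 else 0 :: 'k"
  have p: "?p \<in> topspace (proj_zariski M)"
    using m(1) unfolding topspace_proj coord_space_def by (auto simp: fun_eq_iff)
  show ?thesis unfolding X_def in_closure_of
  proof (intro conjI p allI impI)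
    fix U assume U: "?p \<in> U \<and> openin (proj_zariski M) U"
    have "generate_topology_on {{p \<in> coord_space M. p \<noteq> 0 \<and> eval_mpoly p F \<noteq> (0::'k)} | F. poly_vars F \<subseteq> M \<and> (\<exists>e. is_form e F)} U"
      using U[THEN conjunct2] unfolding proj_zariski_def openin_topology_generated_by_iff .
    \<comment> \<open>The parameter 0 is left out, since the curve may pass there through the zero
      vector, which is no projective point.\<close>
    then have "finite {s\<in>-{0}. curve w s \<notin> U}"
    proof (rule generated_open_curve[of _ _ ?p])
      show "?p \<in> U" using U by (rule conjunct1)
      fix B assume "B \<in> {{p \<in> coord_space M. p \<noteq> 0 \<and> eval_mpoly p F \<noteq> (0::'k)} | F. poly_vars F \<subseteq> M \<and> (\<exists>e. is_form e F)}" and pB: "?p \<in> B"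
      then obtain F e where F: "poly_vars F \<subseteq> M" "is_form e F" and B: "B = {p \<in> coord_space M. p \<noteq> 0 \<and> eval_mpoly p F \<noteq> 0}" by blast
      let ?c0 = "single m e"
      have "eval_mpoly ?p F = (\<Sum>c\<in>keys F. if c = ?c0 then lookup F ?c0 else 0)"
        unfolding eval_mpoly_def
      proof (rule sum.cong[OF refl])
        fix c assume c: "c \<in> keys F"
        then have "keys c \<subseteq> {m} \<longleftrightarrow> c = ?c0"
          using single_of_keys[of c m] F(2) by (auto simp: is_form_def split: if_splits)
        then show "lookup F c * eval_monom ?p c = (if c = ?c0 then lookup F ?c0 else 0)"
          by (simp add: eval_monom_indicator)
      qed
      then have F0: "lookup F ?c0 \<noteq> 0" using pB B by (auto split: if_splits)
      have "coeff (curve_poly w F) (weighted_sum ?c0 (weight w)) = lookup F ?c0"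
      proof (rule coeff_curve_poly)
        fix c assume c: "c \<in> keys F" "weighted_sum c (weight w) = weighted_sum ?c0 (weight w)"
        have "exp_degree c = e" using c(1) F(2) by (simp add: is_form_def)
        then show "c = ?c0" using weighted_sum_vertex[OF m(2), of c] c poly_vars_keys[OF F(1) c(1)] by simp
      qed
      then have "curve_poly w F \<noteq> 0" using F0 by auto
      then have "finite {s. poly (curve_poly w F) s = 0}" by (rule poly_roots_finite)
      then show "finite {s\<in>-{0}. curve w s \<notin> B}"
      proof (rule rev_finite_subset, intro subsetI CollectI)
        fix s assume s: "s \<in> {s\<in>-{0}. curve w s \<notin> B}"
        have "curve w s m \<noteq> 0" using s m(1) by (simp add: curve_eq)
        then have "curve w s \<noteq> 0" by auto
        moreover have "curve w s \<in> coord_space M" unfolding curve_def by (rule monomial_map_coord)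
        ultimately show "poly (curve_poly w F) s = 0"
          using s unfolding B poly_curve_poly[OF F(1)] by auto
      qed
    qed
    moreover have "infinite (-{0 :: 'k})" by (simp add: infinite_UNIV_char_0 Compl_eq_Diff_UNIV)
    ultimately have "\<not> -{0} \<subseteq> {s\<in>-{0}. curve w s \<notin> U}" using finite_subset by blast
    then obtain s where s: "s \<noteq> 0" "curve w s \<in> U" by blast
    have "curve w s m \<noteq> 0" using s m(1) by (simp add: curve_eq)
    then have "curve w s \<noteq> 0" by auto
    then show "\<exists>y. y \<in> {monomial_map M a | a. monomial_map M a \<noteq> 0} \<and> y \<in> U"
      using s(2) unfolding curve_def by (intro exI conjI CollectI) (rule refl, assumption+)
  qed
qed

lemma ones_in_X: "m \<in> M \<Longrightarrow> (\<lambda>x. if x \<in> M then 1 else 0) \<in> X"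
proof -
  assume m: "m \<in> M"
  have "monomial_map M (\<lambda>_. 1 :: 'k) = (\<lambda>x. if x \<in> M then 1 else 0)"
    by (simp add: monomial_map_def eval_monom_def fun_eq_iff)
  moreover have "(\<lambda>x. if x \<in> M then 1 else 0 :: 'k) \<noteq> 0" using m by (auto simp: fun_eq_iff)
  ultimately show ?thesis using image_subset_X[of "\<lambda>_. 1"] by simp
qed

text \<open>A form vanishing on \<open>X\<close> pulls back to 0, so its coefficients over each
  monomial of the pull-back sum to 0, and a coefficient without partners vanishes. Separating
  weights make this visible on a single curve.\<close>

lemma coefficient_zero:
  assumes F: "poly_vars F \<subseteq> M" "is_form e F" "\<And>q. q \<in> X \<Longrightarrow> eval_mpoly q F = 0" and e: "e \<ge> 1" and m: "m \<in> M"
    and uniq: "\<And>c. c \<in> keys F \<Longrightarrow> (\<And>i. weighted_sum c (\<lambda>b. lookup b i) = (weighted_sum c0 (\<lambda>b. lookup b i) :: nat)) \<Longrightarrow> c = c0"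
  shows "lookup F c0 = 0"
proof -
  let ?x = "\<lambda>c :: 'v exponent \<Rightarrow>\<^sub>0 nat. (\<lambda>i. weighted_sum c (\<lambda>b. lookup b i) :: nat)"
  obtain w :: "'v \<Rightarrow> nat" where w: "inj_on (\<lambda>x. \<Sum>i\<in>UNIV. w i * x i) (?x ` insert c0 (keys F))"
    using separating_weights[of "?x ` insert c0 (keys F)"] by auto
  have W: "weighted_sum c (weight w) = (\<Sum>i\<in>UNIV. w i * ?x c i)" for c
    unfolding weight_def by (rule weighted_sum_swap)
  have "coeff (curve_poly w F) (weighted_sum c0 (weight w)) = lookup F c0"
  proof (rule coeff_curve_poly)
    fix c assume c: "c \<in> keys F" "weighted_sum c (weight w) = weighted_sum c0 (weight w)"
    have "?x c = ?x c0" by (rule inj_onD[OF w]) (use c in \<open>auto simp: W\<close>)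
    then show "c = c0" using uniq[OF c(1)] by (simp add: fun_eq_iff)
  qed
  moreover have "curve_poly w F = 0"
  proof (rule ccontr)
    assume "curve_poly w F \<noteq> 0"
    then have "finite {s. poly (curve_poly w F) s = 0}" by (rule poly_roots_finite)
    moreover have "-{0} \<subseteq> {s. poly (curve_poly w F) s = 0}"
    proof
      fix s :: 'k assume s: "s \<in> -{0}"
      have "curve w s m \<noteq> 0" using s m by (simp add: curve_eq)
      then have "curve w s \<noteq> 0" by auto
      then have "curve w s \<in> X" unfolding curve_def by (rule image_subset_X)
      then show "s \<in> {s. poly (curve_poly w F) s = 0}" using F(3) by (simp add: poly_curve_poly[OF F(1)])
    qed
    ultimately have "finite (-{0 :: 'k})" by (rule rev_finite_subset)
    then show False by (simp add: infinite_UNIV_char_0 Compl_eq_Diff_UNIV)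
  qed
  ultimately show ?thesis by simp
qed

lemma weight_weighted_sum:
  "weighted_sum c (weight w) = (\<Sum>i\<in>UNIV. w i * (weighted_sum c (\<lambda>b. lookup b i) :: nat))"
  unfolding weight_def by (rule weighted_sum_swap)

lemma keys_diff_subset: "keys (c - c') \<subseteq> keys (c :: 'a \<Rightarrow>\<^sub>0 nat)"
  by (auto simp: in_keys_iff lookup_minus)

text \<open>The coordinate monomial \<open>z_a z_m^(e-1)\<close> shares its pull-back with no other:
  by atomicity \<open>a\<close> occurs in every competitor, and the rest sums to
  \<open>(e - 1) m\<close>, which only copies of the vertex achieve.\<close>

lemma atom_unique:
  assumes m: "m \<in> M" "\<And>s. s \<in> M \<Longrightarrow> s \<noteq> m \<Longrightarrow> weight w m < weight w s"
    and a: "a = m \<or> atom_at M m a" and e: "e \<ge> 1"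
    and c: "keys c \<subseteq> M" "exp_degree c = e"
      "\<And>i. weighted_sum c (\<lambda>b. lookup b i) = (weighted_sum (single a 1 + single m (e - 1)) (\<lambda>b. lookup b i) :: nat)"
  shows "c = single a 1 + single m (e - 1)"
proof -
  have vert: "c' = single m (exp_degree c')"
    if "keys c' \<subseteq> M" "\<And>i. weighted_sum c' (\<lambda>b. lookup b i) = exp_degree c' * lookup m i" for c'
  proof (rule weighted_sum_vertex[OF m(2) that(1)])
    have "weighted_sum c' (weight w) = (\<Sum>i\<in>UNIV. w i * (exp_degree c' * lookup m i))"
      unfolding weight_weighted_sum that(2) ..
    also have "\<dots> = exp_degree c' * weight w m" by (simp add: weight_def sum_distrib_left ac_simps)
    finally show "weighted_sum c' (weight w) \<le> exp_degree c' * weight w m" by simp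
  qed
  have ci: "weighted_sum c (\<lambda>b. lookup b i) = (e - 1) * lookup m i + lookup a i" for i
    using c(3)[of i] by (simp add: weighted_sum_add)
  show ?thesis
  proof (cases "a = m")
    case True
    have "c = single m e"
      unfolding c(2)[symmetric]
    proof (rule vert[OF c(1)])
      fix i
      have "e * lookup m i = (e - 1) * lookup m i + lookup m i" using e by (cases e) auto
      then show "weighted_sum c (\<lambda>b. lookup b i) = exp_degree c * lookup m i" using ci True c(2) by simp
    qed
    also have "\<dots> = single m (1 + (e - 1))" using e by simp
    finally show ?thesis unfolding True by (simp only: single_add)
  next
    case False
    then have at: "atom_at M m a" using a by simp
    have ac: "a \<in> keys c"
    proof (rule at[unfolded atom_at_def, THEN conjunct2, THEN conjunct2, rule_format, OF c(1)])
      show "(\<Sum>s\<in>keys c. lookup c s) = Suc (e - 1)" using c(2) e by (simp add: exp_degree_def)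
      show "(\<Sum>s\<in>keys c. lookup c s * lookup s i) = (e - 1) * lookup m i + lookup a i" for i
        using ci[of i] by (simp add: weighted_sum_def)
    qed
    define c' where "c' = c - single a 1"
    have cc: "c = c' + single a 1" unfolding c'_def by (rule diff_single_add[OF ac, symmetric])
    have deg: "exp_degree c' = e - 1"
      using c(2) unfolding cc by (simp add: exp_degree_add exp_degree_single)
    have "c' = single m (e - 1)"
      unfolding deg[symmetric]
    proof (rule vert)
      show "keys c' \<subseteq> M" unfolding c'_def by (rule order_trans[OF keys_diff_subset c(1)])
      show "weighted_sum c' (\<lambda>b. lookup b i) = exp_degree c' * lookup m i" for i
        using ci[of i] unfolding deg cc by (simp add: weighted_sum_add)
    qed
    then show ?thesis using cc by (simp only: add.commute)
  qed
qed

text \<open>At the vertex only the monomial \<open>z_a z_m^(e-1)\<close> contributes to the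
  derivative by \<open>z_a\<close>, and by uniqueness of its pull-back no form vanishing on
  \<open>X\<close> contains it.\<close>

lemma unit_in_tangent:
  assumes m: "m \<in> M" "\<And>s. s \<in> M \<Longrightarrow> s \<noteq> m \<Longrightarrow> weight w m < weight w s"
    and a: "a = m \<or> atom_at M m a"
  shows "(\<lambda>x. if x = a then 1 else 0) \<in> affine_tangent_space M X (\<lambda>x. if x = m then 1 else 0)"
  unfolding affine_tangent_space_def
proof (intro CollectI conjI allI impI)
  let ?p = "\<lambda>x. if x = m then 1 else (0::'k)"
  have aM: "a \<in> M" using a m(1) by (auto simp: atom_at_def)
  then show "(\<lambda>x. if x = a then 1 else 0) \<in> coord_space M" by (auto simp: coord_space_def)
  fix F :: "('v exponent, 'k) mpoly" and e
  assume F: "poly_vars F \<subseteq> M \<and> is_form e F \<and> (\<forall>q\<in>X. eval_mpoly q F = 0)"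
  have "(\<Sum>i\<in>M. eval_mpoly ?p (partial_deriv i F) * (if i = a then 1 else 0))
     = (\<Sum>i\<in>M. if i = a then eval_mpoly ?p (partial_deriv i F) else 0)" by (rule sum.cong) auto
  also have "\<dots> = eval_mpoly ?p (partial_deriv a F)"
    using aM finite_M by simp
  also have "\<dots> = 0"
    unfolding eval_partial_deriv
  proof (rule sum.neutral, rule ballI)
    fix c assume c: "c \<in> keys F"
    have cM: "keys c \<subseteq> M" using F c by (intro poly_vars_keys) auto
    have ce: "exp_degree c = e" using F c by (simp add: is_form_def)
    show "of_nat (lookup c a) * lookup F c * eval_monom ?p (c - single a 1) = 0"
    proof (cases "a \<in> keys c \<and> keys (c - single a 1) \<subseteq> {m}")
      case False
      then show ?thesis by (auto simp: eval_monom_indicator in_keys_iff)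
    next
      case True
      define c0 where "c0 = single a 1 + single m (e - 1)"
      have e1: "exp_degree (c - single a 1) + 1 = e"
        using diff_single_add[of a c] True ce
        by (metis exp_degree_add exp_degree_single)
      have "lookup F c0 = 0"
      proof (rule coefficient_zero)
        show "poly_vars F \<subseteq> M" "is_form e F" "\<And>q. q \<in> X \<Longrightarrow> eval_mpoly q F = 0" using F by auto
        show "e \<ge> 1" using e1 by simp
        show "m \<in> M" by (rule m(1))
        fix c assume c: "c \<in> keys F" "\<And>i. weighted_sum c (\<lambda>b. lookup b i) = (weighted_sum c0 (\<lambda>b. lookup b i) :: nat)"
        show "c = c0" unfolding c0_def
        proof (rule atom_unique[OF m a])
          show "e \<ge> 1" using e1 by simp
          show "keys c \<subseteq> M" using F c(1) by (intro poly_vars_keys) auto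
          show "exp_degree c = e" using F c(1) by (simp add: is_form_def)
        qed (assumption+, rule c(2)[unfolded c0_def])
      qed
      moreover have "c = c0"
      proof -
        have "c - single a 1 = single m (e - 1)"
          using single_of_keys[of "c - single a 1" m] True e1 by (metis add_diff_cancel_right')
        then show ?thesis using diff_single_add[of a c] True by (metis c0_def add.commute)
      qed
      ultimately show ?thesis by simp
    qed
  qed
  finally show "(\<Sum>i\<in>M. eval_mpoly ?p (partial_deriv i F) * (if i = a then 1 else 0)) = 0" .
qed

text \<open>Equal pull-backs put the binomial \<open>z^c - z^c'\<close> in the ideal of
  \<open>X\<close>; its differential at the point with all coordinates 1 is the difference of both
  sides. Tangent vectors there behave like additive functions on exponents.\<close>

lemma tangent_relation:
  assumes v: "v \<in> affine_tangent_space M X (\<lambda>x. if x \<in> M then 1 else 0)"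
    and c: "keys c \<subseteq> M" "keys c' \<subseteq> M" "exp_degree c = exp_degree c'"
      "\<And>i. weighted_sum c (\<lambda>b. lookup b i) = (weighted_sum c' (\<lambda>b. lookup b i) :: nat)"
  shows "weighted_sum c v = weighted_sum c' v"
proof (cases "c = c'")
  case False
  let ?p = "\<lambda>x. if x \<in> M then 1 else (0::'k)"
  define F :: "('v exponent, 'k) mpoly" where "F = single c 1 + single c' (-1)"
  have kF: "keys F = {c, c'}" using False unfolding F_def
    by (auto simp: in_keys_iff lookup_add lookup_single when_def split: if_splits)
  have lF: "lookup F c = 1" "lookup F c' = -1" using False by (auto simp: F_def lookup_add lookup_single when_def)
  have pF: "poly_vars F \<subseteq> M" using c by (auto simp: poly_vars_def kF)
  have fF: "is_form (exp_degree c) F" using c(3) by (auto simp: is_form_def kF)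
  have "eval_mpoly q F = 0" if "q \<in> X" for q
  proof (rule vanish_on_X[OF pF fF _ that])
    show "eval_mpoly (monomial_map M a) F = 0" for a
      unfolding F_def using c by (simp add: eval_mpoly_add eval_monom_monomial_map)
  qed
  then have z: "(\<Sum>i\<in>M. eval_mpoly ?p (partial_deriv i F) * v i) = 0"
    using v pF fF unfolding affine_tangent_space_def by blast
  have "eval_mpoly ?p (partial_deriv i F) = of_nat (lookup c i) - of_nat (lookup c' i)" for i
  proof -
    have "eval_monom ?p (x - single i 1) = 1" if "keys x \<subseteq> M" for x
      by (rule eval_monom_one) (use that keys_diff_subset[of x "single i 1"] in auto)
    then show ?thesis unfolding eval_partial_deriv kF using False c lF by simp
  qed
  then have "(\<Sum>i\<in>M. of_nat (lookup c i) * v i) - (\<Sum>i\<in>M. of_nat (lookup c' i) * v i) = 0"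
    using z by (simp add: left_diff_distrib sum_subtractf)
  then show ?thesis using c finite_M by (simp add: weighted_sum_superset[of M])
qed simp

text \<open>Induction on the weight: if \<open>b\<close> is neither the vertex nor an atom, then
  \<open>b + e m\<close> is a sum of exponents other than \<open>b\<close>, and additivity expresses
  \<open>v b\<close> by the values at \<open>m\<close> and at lighter exponents.\<close>

lemma tangent_determined:
  assumes m: "m \<in> M" "\<And>s. s \<in> M \<Longrightarrow> s \<noteq> m \<Longrightarrow> weight w m < weight w s"
    and v: "v \<in> affine_tangent_space M X (\<lambda>x. if x \<in> M then 1 else 0)"
    and vm: "v m = 0" and va: "\<And>a. atom_at M m a \<Longrightarrow> v a = 0"
  shows "v = 0"
proof -
  have "v b = 0" if "b \<in> M" for b
    using that
  proof (induction "weight w b" arbitrary: b rule: less_induct)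
    case less
    show ?case
    proof (cases "b = m \<or> atom_at M m b")
      case True then show ?thesis using vm va by auto
    next
      case False
      then obtain c e where c: "keys c \<subseteq> M" "(\<Sum>s\<in>keys c. lookup c s) = Suc e"
          "\<And>i. (\<Sum>s\<in>keys c. lookup c s * lookup s i) = e * lookup m i + lookup b i" "b \<notin> keys c"
        using less.prems unfolding atom_at_def by blast
      have deg: "exp_degree c = Suc e" using c(2) by (simp add: exp_degree_def)
      have ci: "weighted_sum c (\<lambda>b. lookup b i) = e * lookup m i + lookup b i" for i
        using c(3) by (simp add: weighted_sum_def)
      have "v s = 0" if s: "s \<in> keys c" for s
      proof (cases "s = m")
        case True then show ?thesis using vm by simp
      next
        case False
        \<comment> \<open>If \<open>s\<close> were not lighter than \<open>b\<close>, the other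
          summands would weigh at most \<open>e\<close> times the minimum and hence all equal
          \<open>m\<close>, which makes \<open>s\<close> equal to \<open>b\<close>.\<close>
        have "weight w s < weight w b"
        proof (rule ccontr)
          assume ge: "\<not> weight w s < weight w b"
          define c' where "c' = c - single s 1"
          have cc: "c = c' + single s 1" unfolding c'_def by (rule diff_single_add[OF s, symmetric])
          have deg': "exp_degree c' = e"
            using deg unfolding cc by (simp add: exp_degree_add exp_degree_single)
          have "weighted_sum c (weight w) = (\<Sum>i\<in>UNIV. w i * (e * lookup m i + lookup b i))"
            unfolding weight_weighted_sum ci ..
          also have "\<dots> = e * weight w m + weight w b"
            by (simp add: weight_def sum_distrib_left distrib_left sum.distrib ac_simps)
          finally have "weighted_sum c' (weight w) + weight w s = e * weight w m + weight w b"
            unfolding cc by (simp add: weighted_sum_add)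
          then have "weighted_sum c' (weight w) \<le> exp_degree c' * weight w m" using ge deg' by simp
          moreover have "keys c' \<subseteq> M" unfolding c'_def by (rule order_trans[OF keys_diff_subset c(1)])
          ultimately have "c' = single m e"
            using weighted_sum_vertex[OF m(2), of c'] deg' by metis
          then have "lookup s i = lookup b i" for i
            using ci[of i] unfolding cc by (simp add: weighted_sum_add)
          then have "s = b" by (rule poly_mapping_eqI)
          then show False using s c(4) by simp
        qed
        then show ?thesis using less.hyps[of s] s c(1) by blast
      qed
      then have "weighted_sum c v = 0" unfolding weighted_sum_def by (intro sum.neutral) simp
      moreover have "weighted_sum c v = weighted_sum (single b 1 + single m e) v"
      proof (rule tangent_relation[OF v c(1)])
        show "keys (single b 1 + single m e) \<subseteq> M"
          using less.prems m(1) Poly_Mapping.keys_add[of "single b 1" "single m e"]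
          by (auto split: if_splits)
        show "exp_degree c = exp_degree (single b 1 + single m e)"
          using deg by (simp add: exp_degree_add exp_degree_single)
        show "weighted_sum c (\<lambda>b. lookup b i) = (weighted_sum (single b 1 + single m e) (\<lambda>b. lookup b i) :: nat)" for i
          using ci[of i] by (simp add: weighted_sum_add)
      qed
      ultimately show ?thesis using vm by (simp add: weighted_sum_add)
    qed
  qed
  moreover have "v b = 0" if "b \<notin> M" for b
    using v that by (simp add: affine_tangent_space_def coord_space_def)
  ultimately show ?thesis by (auto simp: fun_eq_iff)
qed

end

text \<open>The coefficients are the cross product of the two rows, or come from the first two
  columns if their determinant is 0.\<close>

lemma plane_dependence:
  obtains c1 c2 c3 :: int where "c1 \<noteq> 0 \<or> c2 \<noteq> 0 \<or> c3 \<noteq> 0"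
    "c1 * x1 + c2 * x2 + c3 * x3 = 0" "c1 * y1 + c2 * y2 + c3 * y3 = 0"
proof (cases "x1 * y2 - x2 * y1 = 0")
  case False
  show ?thesis
    by (rule that[of "x2 * y3 - x3 * y2" "x3 * y1 - x1 * y3" "x1 * y2 - x2 * y1"])
      (use False in \<open>simp_all add: algebra_simps\<close>)
next
  case True
  consider "x1 \<noteq> 0 \<or> x2 \<noteq> 0" | "y1 \<noteq> 0 \<or> y2 \<noteq> 0" | "x1 = 0" "x2 = 0" "y1 = 0" "y2 = 0" by blast
  then show ?thesis
  proof cases
    case 1 then show ?thesis using True by (intro that[of x2 "-x1" 0]) (auto simp: algebra_simps)
  next
    case 2 then show ?thesis using True by (intro that[of y2 "-y1" 0]) (auto simp: algebra_simps)
  next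
    case 3 then show ?thesis by (intro that[of 1 0 0]) auto
  qed
qed

section \<open>Dimensions of tangent spaces\<close>

definition unit_vec :: "'i \<Rightarrow> 'i \<Rightarrow> 'k::field" where
  "unit_vec a = (\<lambda>x. if x = a then 1 else 0)"

abbreviation fun_scale :: "'k::field \<Rightarrow> ('i \<Rightarrow> 'k) \<Rightarrow> 'i \<Rightarrow> 'k" where
  "fun_scale \<equiv> (\<lambda>c v i. c * v i)"

lemma sum_unit_vec:
  assumes "finite A" shows "(\<Sum>a\<in>A. fun_scale (u a) (unit_vec a)) = (\<lambda>x. if x \<in> A then u x else 0)"
proof
  fix x
  have "(\<Sum>a\<in>A. fun_scale (u a) (unit_vec a)) x = (\<Sum>a\<in>A. u a * unit_vec a x)"
    by (induction A rule: infinite_finite_induct) auto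
  also have "\<dots> = (\<Sum>a\<in>A. if a = x then u x else 0)" by (rule sum.cong) (auto simp: unit_vec_def)
  also have "\<dots> = (if x \<in> A then u x else 0)" using assms by simp
  finally show "(\<Sum>a\<in>A. fun_scale (u a) (unit_vec a)) x = (if x \<in> A then u x else 0)" .
qed

lemma inj_unit_vec: "inj (unit_vec :: 'i \<Rightarrow> 'i \<Rightarrow> 'k::field)"
  by (rule injI) (metis unit_vec_def zero_neq_one)

lemma supported_in_span:
  fixes v :: "'i \<Rightarrow> 'k::field"
  assumes "finite A" "\<And>x. x \<notin> A \<Longrightarrow> v x = 0"
  shows "v \<in> module.span fun_scale (unit_vec ` A)"
proof -
  interpret fs: vector_space "fun_scale :: 'k \<Rightarrow> ('i \<Rightarrow> 'k) \<Rightarrow> 'i \<Rightarrow> 'k" by (rule vector_space_coords)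
  have "v = (\<Sum>a\<in>A. fun_scale (v a) (unit_vec a))"
    using sum_unit_vec[OF assms(1), of v] assms(2) by (simp add: fun_eq_iff)
  also have "\<dots> \<in> fs.span (unit_vec ` A)"
    by (intro fs.span_sum fs.span_scale fs.span_base) auto
  finally show ?thesis .
qed

lemma independent_unit_vec:
  assumes "finite A"
  shows "\<not> module.dependent (fun_scale :: 'k::field \<Rightarrow> ('i \<Rightarrow> 'k) \<Rightarrow> 'i \<Rightarrow> 'k) (unit_vec ` A)"
proof -
  interpret fs: vector_space "fun_scale :: 'k \<Rightarrow> ('i \<Rightarrow> 'k) \<Rightarrow> 'i \<Rightarrow> 'k" by (rule vector_space_coords)
  show ?thesis
  proof
    assume dep: "fs.dependent (unit_vec ` A)"
    have fin: "finite (unit_vec ` A :: ('i \<Rightarrow> 'k) set)" using assms by simp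
    obtain u :: "('i \<Rightarrow> 'k) \<Rightarrow> 'k" where u: "\<exists>v\<in>unit_vec ` A. u v \<noteq> 0" "(\<Sum>v\<in>unit_vec ` A. fun_scale (u v) v) = 0"
      using iffD1[OF fs.dependent_finite[OF fin] dep] by (elim exE conjE)
    obtain a where a: "a \<in> A" "u (unit_vec a) \<noteq> 0" using u(1) by (elim bexE imageE) simp
    have inj: "inj_on (unit_vec :: 'i \<Rightarrow> 'i \<Rightarrow> 'k) A" by (rule inj_on_subset[OF inj_unit_vec subset_UNIV])
    have "(\<Sum>v\<in>unit_vec ` A. fun_scale (u v) v) = (\<Sum>a\<in>A. fun_scale (u (unit_vec a)) (unit_vec a))"
      by (simp only: sum.reindex[OF inj] comp_def)
    then have "(\<lambda>x. if x \<in> A then u (unit_vec x) else 0) = 0"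
      using u(2) sum_unit_vec[OF assms, of "\<lambda>a. u (unit_vec a)"] by (simp only:)
    from fun_cong[OF this, of a] show False using a by simp
  qed
qed

lemma card_le_dim:
  fixes V :: "('i \<Rightarrow> 'k::field) set"
  assumes M: "finite M" "\<And>v x. v \<in> V \<Longrightarrow> x \<notin> M \<Longrightarrow> v x = 0"
    and A: "finite A" "unit_vec ` A \<subseteq> V"
  shows "card A \<le> vector_space.dim fun_scale V"
proof -
  interpret fs: vector_space "fun_scale :: 'k \<Rightarrow> ('i \<Rightarrow> 'k) \<Rightarrow> 'i \<Rightarrow> 'k" by (rule vector_space_coords)
  obtain B where B: "B \<subseteq> V" "fs.independent B" "V \<subseteq> fs.span B" "card B = fs.dim V"
    using fs.basis_exists[of V] by blast
  have "B \<subseteq> fs.span (unit_vec ` M)"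
  proof
    fix v assume "v \<in> B"
    then have "v \<in> V" using B(1) by blast
    then show "v \<in> fs.span (unit_vec ` M)" using M(2) by (intro supported_in_span[OF M(1)]) auto
  qed
  then have "finite B" using fs.independent_span_bound[of "unit_vec ` M" B] M(1) B(2) by simp
  then have "card (unit_vec ` A :: ('i \<Rightarrow> 'k) set) \<le> card B"
    using fs.independent_span_bound[of B "unit_vec ` A"] independent_unit_vec[OF A(1)] A(2) B(3) by blast
  then show ?thesis using B(4) by (simp add: card_image inj_on_subset[OF inj_unit_vec])
qed

text \<open>Restricting functions to \<open>C\<close> is linear and injective on \<open>V\<close>,
  so a basis of \<open>V\<close> maps to independent functions supported on
  \<open>C\<close>.\<close>

lemma dim_le_card:
  fixes V :: "('i \<Rightarrow> 'k::field) set"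
  assumes V: "module.subspace fun_scale V" and C: "finite C"
    and inj: "\<And>v. v \<in> V \<Longrightarrow> (\<And>a. a \<in> C \<Longrightarrow> v a = 0) \<Longrightarrow> v = 0"
  shows "vector_space.dim fun_scale V \<le> card C"
proof -
  interpret fs: vector_space "fun_scale :: 'k \<Rightarrow> ('i \<Rightarrow> 'k) \<Rightarrow> 'i \<Rightarrow> 'k" by (rule vector_space_coords)
  interpret fp: vector_space_pair "fun_scale :: 'k \<Rightarrow> ('i \<Rightarrow> 'k) \<Rightarrow> 'i \<Rightarrow> 'k" "fun_scale :: 'k \<Rightarrow> ('i \<Rightarrow> 'k) \<Rightarrow> 'i \<Rightarrow> 'k" ..
  obtain B where B: "B \<subseteq> V" "fs.independent B" "V \<subseteq> fs.span B" "card B = fs.dim V"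
    using fs.basis_exists[of V] by blast
  define R :: "('i \<Rightarrow> 'k) \<Rightarrow> 'i \<Rightarrow> 'k" where "R v = (\<lambda>x. if x \<in> C then v x else 0)" for v
  have lin: "Vector_Spaces.linear fun_scale fun_scale R"
    by unfold_locales (auto simp: R_def fun_eq_iff)
  have injR: "inj_on R V"
  proof (rule inj_onI)
    fix x y assume xy: "x \<in> V" "y \<in> V" "R x = R y"
    have "x - y = 0"
    proof (rule inj)
      show "x - y \<in> V" using fs.subspace_diff[OF V xy(1,2)] .
      fix a assume "a \<in> C"
      then have "x a = y a" using fun_cong[OF xy(3), of a] by (simp add: R_def)
      then show "(x - y) a = 0" by simp
    qed
    then show "x = y" by simp
  qed
  have "fs.span B \<subseteq> V" by (rule fs.span_minimal[OF B(1) V])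
  then have "fs.independent (R ` B)"
    using fp.linear_independent_injective_image[OF lin B(2)] inj_on_subset[OF injR] by blast
  moreover have "R ` B \<subseteq> fs.span (unit_vec ` C)"
    by (auto simp: R_def intro!: supported_in_span[OF C])
  ultimately have "card (R ` B) \<le> card (unit_vec ` C :: ('i \<Rightarrow> 'k) set)"
    using fs.independent_span_bound[of "unit_vec ` C" "R ` B"] C by simp
  also have "\<dots> \<le> card C" using C by (rule card_image_le)
  also have "card (R ` B) = card B" by (rule card_image) (rule inj_on_subset[OF injR B(1)])
  finally show ?thesis using B(4) by simp
qed

lemma subspace_tangent:
  fixes X :: "('i \<Rightarrow> 'k::field) set"
  shows "module.subspace fun_scale (affine_tangent_space M X p)"
proof -
  interpret fs: vector_space "fun_scale :: 'k \<Rightarrow> ('i \<Rightarrow> 'k) \<Rightarrow> 'i \<Rightarrow> 'k" by (rule vector_space_coords)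
  let ?T = "affine_tangent_space M X p"
  have I: "v \<in> ?T \<longleftrightarrow> (\<forall>i. i \<notin> M \<longrightarrow> v i = 0) \<and> (\<forall>F e. poly_vars F \<subseteq> M \<and> is_form e F \<and> (\<forall>q\<in>X. eval_mpoly q F = 0) \<longrightarrow>
       (\<Sum>i\<in>M. eval_mpoly p (partial_deriv i F) * v i) = 0)" for v
    by (simp add: affine_tangent_space_def coord_space_def)
  have sc: "(\<Sum>i\<in>M. g i * (c * v i)) = c * (\<Sum>i\<in>M. g i * v i)" for g v :: "'i \<Rightarrow> 'k" and c
    unfolding sum_distrib_left by (rule sum.cong) (simp_all add: mult.left_commute)
  have ad: "(\<Sum>i\<in>M. g i * (v i + v' i)) = (\<Sum>i\<in>M. g i * v i) + (\<Sum>i\<in>M. g i * v' i)" for g v v' :: "'i \<Rightarrow> 'k"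
    by (simp add: distrib_left sum.distrib)
  show ?thesis
    by (rule fs.subspaceI) (simp_all add: I sc ad)
qed

section \<open>Comparison of the tangent spaces at a vertex and at the point with all coordinates
  1\<close>

context monomial_variety
begin

text \<open>Two coordinates suffice for the dependence: outside the triangle everything vanishes,
  and the coordinate at \<open>t\<close> follows from the common degree.\<close>

lemma face_relation:
  assumes m: "m \<in> M" "a1 \<in> M" "a2 \<in> M" "a3 \<in> M"
    and keys: "keys m \<union> keys a1 \<union> keys a2 \<union> keys a3 \<subseteq> {t,k,j}"
  obtains c1 c2 c3 :: int where "c1 \<noteq> 0 \<or> c2 \<noteq> 0 \<or> c3 \<noteq> 0"
    "\<And>i. c1 * (int (lookup a1 i) - int (lookup m i)) + c2 * (int (lookup a2 i) - int (lookup m i)) + c3 * (int (lookup a3 i) - int (lookup m i)) = 0"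
proof -
  let ?x = "\<lambda>a i. int (lookup a i) - int (lookup m i)"
  obtain c1 c2 c3 :: int where c: "c1 \<noteq> 0 \<or> c2 \<noteq> 0 \<or> c3 \<noteq> 0"
    "c1 * ?x a1 k + c2 * ?x a2 k + c3 * ?x a3 k = 0" "c1 * ?x a1 j + c2 * ?x a2 j + c3 * ?x a3 j = 0"
    by (rule plane_dependence)
  define z where "z i = c1 * ?x a1 i + c2 * ?x a2 i + c3 * ?x a3 i" for i
  have s: "(\<Sum>i\<in>UNIV. ?x a i) = 0" if "a \<in> M" for a
  proof -
    have "(\<Sum>i\<in>UNIV. int (lookup a i)) = int (exp_degree a)" for a :: "'v exponent" by (simp add: exp_degree_sum)
    then show ?thesis using degree_M[OF that] degree_M[OF m(1)] by (simp add: sum_subtractf)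
  qed
  have zs: "(\<Sum>i\<in>UNIV. z i) = 0"
    unfolding z_def by (simp only: sum.distrib sum_distrib_left[symmetric] s m mult_zero_right add_0)
  have z0: "z i = 0" if nt: "i \<noteq> t" for i
  proof -
    consider "i = k" | "i = j" | "i \<notin> {t,k,j}" using nt by blast
    then show ?thesis
    proof cases
      case 3
      then have "lookup m i = 0" "lookup a1 i = 0" "lookup a2 i = 0" "lookup a3 i = 0"
        using keys by (auto simp: subset_iff in_keys_iff)
      then show ?thesis by (simp add: z_def)
    qed (use c in \<open>simp_all add: z_def\<close>)
  qed
  have "z i = 0" for i
  proof (cases "i = t")
    case True
    have "(\<Sum>i\<in>UNIV. z i) = z t + (\<Sum>i\<in>UNIV-{t}. z i)" by (rule sum.remove) auto
    also have "(\<Sum>i\<in>UNIV-{t}. z i) = 0" by (rule sum.neutral) (simp add: z0)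
    finally show ?thesis using zs True by simp
  qed (use z0 in simp)
  then show ?thesis using that[OF c(1)] by (simp add: z_def)
qed

lemma tangent_face_relation:
  assumes v: "v \<in> affine_tangent_space M X (\<lambda>x. if x \<in> M then 1 else 0)"
    and m: "m \<in> M" "a1 \<in> M" "a2 \<in> M" "a3 \<in> M"
    and c: "\<And>i. c1 * (int (lookup a1 i) - int (lookup m i)) + c2 * (int (lookup a2 i) - int (lookup m i)) + c3 * (int (lookup a3 i) - int (lookup m i)) = 0"
    and vm: "v m = 0"
  shows "of_int c1 * v a1 + of_int c2 * v a2 + of_int c3 * v a3 = 0"
proof -
  define c4 where "c4 = - (c1 + c2 + c3)"
  \<comment> \<open>\<open>P 1\<close> and \<open>P (-1)\<close> collect the positive and the
    negative coefficients of the relation, because \<open>nat\<close> cuts off at 0; the coefficient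
    \<open>c4\<close> of \<open>m\<close> gives both the same degree.\<close>
  define P where "P s = single a1 (nat (s * c1)) + single a2 (nat (s * c2)) + single a3 (nat (s * c3)) + single m (nat (s * c4))" for s
  have W: "weighted_sum (P s) g = of_nat (nat (s * c1)) * g a1 + of_nat (nat (s * c2)) * g a2 + of_nat (nat (s * c3)) * g a3 + of_nat (nat (s * c4)) * g m"
    for s and g :: "'v exponent \<Rightarrow> 'b::comm_semiring_1"
    unfolding P_def by (simp add: weighted_sum_add)
  have N: "int (nat (1 * c)) - int (nat ((-1) * c)) = c" for c by simp
  have N': "of_nat (nat (1 * c)) - of_nat (nat ((-1) * c)) = (of_int c :: 'k)" for c
    using arg_cong[OF N[of c], of "of_int :: int \<Rightarrow> 'k"] by (simp only: of_int_diff of_int_of_nat_eq)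
  have keys: "keys (P s) \<subseteq> M" for s
    using m unfolding P_def by (auto simp: in_keys_iff lookup_add lookup_single when_def split: if_splits)
  have deg: "exp_degree (P 1) = exp_degree (P (-1))"
  proof -
    have "int (exp_degree (P 1)) - int (exp_degree (P (-1))) = c1 + c2 + c3 + c4"
      unfolding exp_degree_weighted_sum W using N[of c1] N[of c2] N[of c3] N[of c4] by simp
    then show ?thesis by (simp add: c4_def)
  qed
  have "weighted_sum (P 1) (\<lambda>b. lookup b i) = (weighted_sum (P (-1)) (\<lambda>b. lookup b i) :: nat)" for i
  proof -
    have "int (weighted_sum (P 1) (\<lambda>b. lookup b i)) - int (weighted_sum (P (-1)) (\<lambda>b. lookup b i))
       = (int (nat (1 * c1)) - int (nat ((-1) * c1))) * int (lookup a1 i) + (int (nat (1 * c2)) - int (nat ((-1) * c2))) * int (lookup a2 i)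
        + (int (nat (1 * c3)) - int (nat ((-1) * c3))) * int (lookup a3 i) + (int (nat (1 * c4)) - int (nat ((-1) * c4))) * int (lookup m i)"
      unfolding W by (simp only: of_nat_add of_nat_mult of_nat_id) (simp only: algebra_simps)
    also have "\<dots> = 0" unfolding N c4_def using c[of i] by (simp add: algebra_simps)
    finally show ?thesis by simp
  qed
  from tangent_relation[OF v keys keys deg this]
  have "weighted_sum (P 1) v - weighted_sum (P (-1)) v = 0" by simp
  moreover have "weighted_sum (P 1) v - weighted_sum (P (-1)) v
     = (of_nat (nat (1 * c1)) - of_nat (nat ((-1) * c1))) * v a1 + (of_nat (nat (1 * c2)) - of_nat (nat ((-1) * c2))) * v a2
        + (of_nat (nat (1 * c3)) - of_nat (nat ((-1) * c3))) * v a3"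
    unfolding W vm by (simp only: algebra_simps mult_zero_right mult_zero_left add_0_right) 
  ultimately show ?thesis unfolding N' by simp
qed

lemma smooth_no_three_atoms:
  assumes smooth: "smooth_projective M X" and m: "is_vertex M m"
    and keys: "keys m \<union> keys a1 \<union> keys a2 \<union> keys a3 \<subseteq> {t,k,j}" and dist: "distinct [a1,a2,a3]"
    and a: "atom_at M m a1" "atom_at M m a2" "atom_at M m a3"
  shows False
proof -
  obtain w where mM: "m \<in> M" and w: "\<And>s. s \<in> M \<Longrightarrow> s \<noteq> m \<Longrightarrow> weight w m < weight w s"
    using m unfolding is_vertex_def weight_def by auto
  define At where "At = {a. atom_at M m a}"
  have AM: "At \<subseteq> M" "m \<notin> At" by (auto simp: At_def atom_at_def)
  then have fin: "finite At" using finite_M finite_subset by blast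
  define Tm where "Tm = affine_tangent_space M X (\<lambda>x. if x = m then 1 else 0)"
  define To where "To = affine_tangent_space M X (\<lambda>x. if x \<in> M then 1 else 0)"
  have "card (insert m At) \<le> vector_space.dim fun_scale Tm"
  proof (rule card_le_dim[OF finite_M])
    show "v x = 0" if "v \<in> Tm" "x \<notin> M" for v x
      using that by (simp add: Tm_def affine_tangent_space_def coord_space_def)
    show "unit_vec ` insert m At \<subseteq> Tm"
      unfolding Tm_def unit_vec_def using unit_in_tangent[OF mM w] by (auto simp: At_def)
  qed (use fin in simp)
  then have lower: "Suc (card At) \<le> vector_space.dim fun_scale Tm" using fin AM by simp
  have aM: "a1 \<in> M" "a2 \<in> M" "a3 \<in> M" using a by (auto simp: atom_at_def)
  obtain c1 c2 c3 :: int where c: "c1 \<noteq> 0 \<or> c2 \<noteq> 0 \<or> c3 \<noteq> 0"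
    "\<And>i. c1 * (int (lookup a1 i) - int (lookup m i)) + c2 * (int (lookup a2 i) - int (lookup m i)) + c3 * (int (lookup a3 i) - int (lookup m i)) = 0"
    using face_relation[OF mM aM keys] by blast
  \<comment> \<open>\<open>b\<close> is an atom with nonzero coefficient in the relation. In
    characteristic 0 this coefficient stays nonzero in the field, so \<open>v b\<close> is
    determined by the other two atoms.\<close>
  obtain b where b: "b \<in> At" "\<And>v. v \<in> To \<Longrightarrow> (\<And>x. x \<in> insert m At - {b} \<Longrightarrow> v x = 0) \<Longrightarrow> v b = 0"
  proof -
    have rel: "of_int c1 * v a1 + of_int c2 * v a2 + of_int c3 * v a3 = 0" if "v \<in> To" "v m = 0" for v
      using tangent_face_relation[OF that(1)[unfolded To_def] mM aM c(2) that(2)] .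
    have A: "a1 \<in> At" "a2 \<in> At" "a3 \<in> At" using a by (auto simp: At_def)
    then have ne: "a1 \<noteq> m" "a2 \<noteq> m" "a3 \<noteq> m" using AM(2) by auto
    from c(1) consider "c1 \<noteq> 0" | "c2 \<noteq> 0" | "c3 \<noteq> 0" by blast
    then show ?thesis
    proof cases
      case 1
      show ?thesis
      proof (rule that[of a1])
        fix v assume v: "v \<in> To" "\<And>x. x \<in> insert m At - {a1} \<Longrightarrow> v x = 0"
        have "v m = 0" "v a2 = 0" "v a3 = 0" using v(2) A ne dist by auto
        then show "v a1 = 0" using rel[OF v(1)] 1 by simp
      qed fact
    next
      case 2
      show ?thesis
      proof (rule that[of a2])
        fix v assume v: "v \<in> To" "\<And>x. x \<in> insert m At - {a2} \<Longrightarrow> v x = 0"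
        have "v m = 0" "v a1 = 0" "v a3 = 0" using v(2) A ne dist by auto
        then show "v a2 = 0" using rel[OF v(1)] 2 by simp
      qed fact
    next
      case 3
      show ?thesis
      proof (rule that[of a3])
        fix v assume v: "v \<in> To" "\<And>x. x \<in> insert m At - {a3} \<Longrightarrow> v x = 0"
        have "v m = 0" "v a1 = 0" "v a2 = 0" using v(2) A ne dist by auto
        then show "v a3 = 0" using rel[OF v(1)] 3 by simp
      qed fact
    qed
  qed
  have "vector_space.dim fun_scale To \<le> card (insert m At - {b})"
  proof (rule dim_le_card)
    show "module.subspace fun_scale To" unfolding To_def by (rule subspace_tangent)
    show "finite (insert m At - {b})" using fin by simp
    fix v assume v: "v \<in> To" "\<And>x. x \<in> insert m At - {b} \<Longrightarrow> v x = 0"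
    have "v b = 0" using b(2)[OF v] .
    then have z: "v x = 0" if "x \<in> insert m At" for x using v(2) that by (cases "x = b") auto
    show "v = 0"
      by (rule tangent_determined[OF mM w v(1)[unfolded To_def]]) (use z in \<open>auto simp: At_def\<close>)
  qed
  also have "\<dots> = card At" using b(1) fin AM(2) by (simp add: card_Diff_singleton)
  finally have upper: "vector_space.dim fun_scale To \<le> card At" .
  have "enat (vector_space.dim fun_scale Tm) = enat (vector_space.dim fun_scale To)"
    using smooth vertex_in_X[OF mM w] ones_in_X[OF mM] unfolding smooth_projective_def Tm_def To_def by simp
  then show False using lower upper by simp
qed

end

section \<open>The number of terms of a product with the sum of the variables\<close>

definition supp :: "('a \<Rightarrow> 'k::zero) \<Rightarrow> 'a set" where "supp h = {s. h s \<noteq> 0}"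

lemma in_supp: "s \<in> supp h \<longleftrightarrow> h s \<noteq> 0" by (simp add: supp_def)

lemma single_Suc_inject: "single i (Suc m) = single j (Suc m) \<Longrightarrow> i = j"
  by (metis lookup_single_eq lookup_single_not_eq nat.distinct(1))

text \<open>Only the variables in \<open>V\<close> are summed while the type of exponents stays the
  same, which permits induction on the number of variables.\<close>

definition lsum_on :: "'v set \<Rightarrow> ('v::finite exponent \<Rightarrow> 'k::comm_ring_1) \<Rightarrow> 'v exponent \<Rightarrow> 'k" where
  "lsum_on V f s = (\<Sum>i\<in>keys s \<inter> V. f (s - single i 1))"

lemma lsum_on_UNIV: "lsum_on UNIV f = lsum f"
  by (simp add: lsum_on_def lsum_def fun_eq_iff)

lemma lsum_on_insert:
  assumes "k \<notin> V"
  shows "lsum_on (insert k V) f s = lsum_on V f s + (if k \<in> keys s then f (s - single k 1) else 0)"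
proof (cases "k \<in> keys s")
  case True
  then have "keys s \<inter> insert k V = insert k (keys s \<inter> V)" by auto
  then show ?thesis using True assms by (simp add: lsum_on_def add.commute)
next
  case False
  then have "keys s \<inter> insert k V = keys s \<inter> V" by auto
  then show ?thesis using False by (simp add: lsum_on_def)
qed

lemma finite_supp_lsum_on:
  assumes "finite (supp f)" shows "finite (supp (lsum_on V f))"
proof (rule finite_subset)
  show "supp (lsum_on V f) \<subseteq> (\<Union>i\<in>UNIV. (\<lambda>b. b + single i 1) ` supp f)"
  proof
    fix s assume "s \<in> supp (lsum_on V f)"
    then have "lsum_on V f s \<noteq> 0" by (simp add: supp_def)
    then obtain i where "i \<in> keys s \<inter> V" "f (s - single i 1) \<noteq> 0"
      unfolding lsum_on_def by (meson sum.neutral)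
    then have "s - single i 1 \<in> supp f" "s = s - single i 1 + single i 1"
      using diff_single_add[of i s] by (auto simp: supp_def)
    then show "s \<in> (\<Union>i\<in>UNIV. (\<lambda>b. b + single i 1) ` supp f)" by blast
  qed
qed (use assms in auto)

definition layer :: "'v \<Rightarrow> nat \<Rightarrow> ('v exponent \<Rightarrow> 'k::zero) \<Rightarrow> 'v exponent \<Rightarrow> 'k" where
  "layer k i f s = (if lookup s k = i then f s else 0)"

lemma lookup_diff_single_other: "j \<noteq> k \<Longrightarrow> lookup (s - single j n) k = lookup s k"
  by (simp add: lookup_minus lookup_single when_def)

lemma lsum_on_layer:
  assumes "k \<notin> V" shows "lsum_on V (layer k i f) s = (if lookup s k = i then lsum_on V f s else 0)"
proof -
  have "layer k i f (s - single j 1) = (if lookup s k = i then f (s - single j 1) else 0)"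
    if "j \<in> V" for j
  proof -
    have "j \<noteq> k" using that assms by blast
    then show ?thesis unfolding layer_def by (subst lookup_diff_single_other) simp_all
  qed
  then show ?thesis unfolding lsum_on_def by (auto intro!: sum.cong sum.neutral)
qed

lemma supp_layer: "supp (layer k i f) = {s\<in>supp f. lookup s k = i}"
  by (auto simp: supp_def layer_def)

text \<open>Sorting the terms by their degree in one variable, the lowest and the highest layer of the product
  are determined by the lowest and the highest layer of the factor.\<close>

locale layered =
  fixes V :: "'v::finite set" and k :: 'v and f :: "'v exponent \<Rightarrow> 'k::field_char_0" and lo hi :: nat
  assumes k: "k \<notin> V" and fin: "finite (supp f)"
    and lo: "\<And>s. s \<in> supp f \<Longrightarrow> lo \<le> lookup s k" "\<exists>s\<in>supp f. lookup s k = lo"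
    and hi: "\<And>s. s \<in> supp f \<Longrightarrow> lookup s k \<le> hi" "\<exists>s\<in>supp f. lookup s k = hi"
begin

definition g where "g = lsum_on (insert k V) f"

definition g_layer where "g_layer i = {s\<in>supp g. lookup s k = i}"

lemma finite_g_layer [simp]: "finite (g_layer i)"
  unfolding g_layer_def g_def using finite_supp_lsum_on[OF fin] by simp

lemma lookup_diff_k: "k \<in> keys s \<Longrightarrow> Suc (lookup (s - single k 1) k) = lookup s k"
  by (simp add: lookup_minus in_keys_iff)

lemma g_low:
  assumes "lookup s k = lo" shows "g s = lsum_on V f s"
proof -
  have "f (s - single k 1) = 0" if "k \<in> keys s"
    using lo(1)[of "s - single k 1"] lookup_diff_k[OF that] assms by (auto simp: supp_def)
  then show ?thesis unfolding g_def lsum_on_insert[OF k] by simp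
qed

lemma g_layer_low: "g_layer lo = supp (lsum_on V (layer k lo f))"
  unfolding g_layer_def supp_def lsum_on_layer[OF k] using g_low by auto

lemma lsum_on_zero:
  assumes "\<And>t. lookup t k = lookup s k \<Longrightarrow> f t = 0" shows "lsum_on V f s = 0"
  unfolding lsum_on_def
proof (rule sum.neutral, rule ballI, rule assms)
  fix i assume "i \<in> keys s \<inter> V"
  then have "i \<noteq> k" using k by blast
  then show "lookup (s - single i 1) k = lookup s k" by (rule lookup_diff_single_other)
qed

lemma g_layer_high: "card (g_layer (Suc hi)) = card (supp (layer k hi f))"
proof -
  have "g_layer (Suc hi) = (\<lambda>s. s + single k 1) ` supp (layer k hi f)"
  proof (intro equalityI subsetI)
    fix s assume s: "s \<in> g_layer (Suc hi)"
    then have sk: "lookup s k = Suc hi" "g s \<noteq> 0" by (auto simp: g_layer_def supp_def)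
    then have ks: "k \<in> keys s" by (simp add: in_keys_iff)
    have "lsum_on V f s = 0" by (rule lsum_on_zero) (use hi(1) sk in \<open>force simp: supp_def\<close>)
    then have "f (s - single k 1) \<noteq> 0" using sk(2) ks unfolding g_def lsum_on_insert[OF k] by simp
    then have "s - single k 1 \<in> supp (layer k hi f)"
      using lookup_diff_k[OF ks] sk(1) by (simp add: supp_layer in_supp)
    then show "s \<in> (\<lambda>s. s + single k 1) ` supp (layer k hi f)"
      using diff_single_add[OF ks] by (metis imageI)
  next
    fix s assume "s \<in> (\<lambda>s. s + single k 1) ` supp (layer k hi f)"
    then obtain b where b: "s = b + single k 1" "f b \<noteq> 0" "lookup b k = hi"
      by (auto simp: supp_layer in_supp)
    have sk: "lookup s k = Suc hi" using b by (simp add: lookup_add)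
    have "lsum_on V f s = 0" by (rule lsum_on_zero) (use hi(1) sk in \<open>force simp: supp_def\<close>)
    moreover have "k \<in> keys s" using sk by (simp add: in_keys_iff)
    ultimately have "g s \<noteq> 0" using b unfolding g_def lsum_on_insert[OF k] by simp
    then show "s \<in> g_layer (Suc hi)" using sk by (simp add: g_layer_def supp_def)
  qed
  then show ?thesis by (simp add: card_image)
qed

lemma g_layer_high_pos: "card (g_layer (Suc hi)) \<ge> 1"
  unfolding g_layer_high using hi(2) fin by (auto simp: supp_layer Suc_le_eq card_gt_0_iff)

lemma card_layers:
  assumes "finite I" shows "(\<Sum>i\<in>I. card (g_layer i)) \<le> card (supp g)"
proof -
  have "(\<Sum>i\<in>I. card (g_layer i)) = card (\<Union>i\<in>I. g_layer i)"
    by (rule card_UN_disjoint[symmetric]) (use assms finite_g_layer in \<open>auto simp: g_layer_def\<close>)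
  also have "\<dots> \<le> card (supp g)"
    by (rule card_mono) (use finite_supp_lsum_on[OF fin] in \<open>auto simp: g_layer_def g_def\<close>)
  finally show ?thesis .
qed

lemma lo_le_hi: "lo \<le> hi" using lo hi by blast

end

lemma layered_exists:
  assumes "k \<notin> V" "finite (supp f)" "supp f \<noteq> {}"
  shows "\<exists>lo hi. layered V k f lo hi"
proof -
  let ?D = "(\<lambda>s. lookup s k) ` supp f"
  have D: "finite ?D" "?D \<noteq> {}" using assms by auto
  have "layered V k f (Min ?D) (Max ?D)"
  proof
    show "\<exists>s\<in>supp f. lookup s k = Min ?D" using Min_in[OF D] by fastforce
    show "\<exists>s\<in>supp f. lookup s k = Max ?D" using Max_in[OF D] by fastforce
  qed (use assms in auto)
  then show ?thesis by blast
qed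

text \<open>Induction on \<open>V\<close>: the lowest layer already has as many terms as there are
  variables besides \<open>k\<close>, and the highest layer adds one.\<close>

lemma card_supp_lsum_on_ge:
  fixes f :: "'v::finite exponent \<Rightarrow> 'k::field_char_0"
  assumes "finite (supp f)" "supp f \<noteq> {}"
  shows "card (supp (lsum_on V f)) \<ge> card V"
  using finite[of V] assms
proof (induction V arbitrary: f rule: finite_induct)
  case (insert k V)
  obtain lo hi where "layered V k f lo hi" using layered_exists[OF insert.hyps(2) insert.prems] by blast
  then interpret layered V k f lo hi .
  have "card V \<le> card (g_layer lo)"
    unfolding g_layer_low by (rule insert.IH) (use fin lo in \<open>auto simp: supp_layer\<close>)
  moreover have "(\<Sum>i\<in>{lo, Suc hi}. card (g_layer i)) \<le> card (supp g)" by (rule card_layers) simp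
  ultimately show ?case using g_layer_high_pos lo_le_hi insert.hyps by (simp add: g_def)
qed simp

text \<open>The coefficient of \<open>s\<close> in the monomial \<open>v\<close> times the
  \<open>m\<close>-th power of the sum of the variables in \<open>V\<close>; being a natural number,
  it is not subject to cancellation.\<close>

fun path_count :: "'v set \<Rightarrow> 'v exponent \<Rightarrow> nat \<Rightarrow> 'v::finite exponent \<Rightarrow> nat" where
  "path_count V v 0 s = (if s = v then 1 else 0)"
| "path_count V v (Suc m) s = (\<Sum>i\<in>keys s \<inter> V. path_count V v m (s - single i 1))"

lemma path_count_step:
  assumes "i \<in> V" "path_count V v m s \<noteq> 0" shows "path_count V v (Suc m) (s + single i 1) \<noteq> 0"
proof -
  have "i \<in> keys (s + single i 1) \<inter> V" using assms(1) by (simp add: in_keys_iff lookup_add)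
  moreover have "s + single i 1 - single i 1 = s" by simp
  ultimately show ?thesis using assms(2) by (auto intro!: bexI[of _ i])
qed

lemma path_count_power:
  assumes "i \<in> V" shows "path_count V v m (v + single i m) \<noteq> 0"
proof (induction m)
  case (Suc m)
  have "v + single i (Suc m) = v + single i m + single i 1"
    by (simp add: add.assoc flip: single_add)
  then show ?case using path_count_step[OF assms Suc] by simp
qed simp

text \<open>The power has exponent \<open>m + 1 >= 2\<close>, so its terms \<open>x_i^(m+1)\<close>
  and \<open>x_a^m x_j\<close>, with \<open>a\<close> fixed and \<open>j\<close> different from
  \<open>a\<close>, are distinct.\<close>

lemma path_count_card:
  assumes "V \<noteq> {}" "m \<ge> 1"
  shows "\<exists>P. finite P \<and> card P \<ge> 2 * card V - 1 \<and> (\<forall>s\<in>P. path_count V v (Suc m) s \<noteq> 0)"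
proof -
  obtain a where a: "a \<in> V" using assms by blast
  let ?p = "\<lambda>i. v + single i (Suc m)" and ?q = "\<lambda>j. v + single a m + single j 1"
  have ip: "inj_on ?p V" by (auto simp: inj_on_def dest: single_Suc_inject)
  have iq: "inj_on ?q (V - {a})" by (auto simp: inj_on_def dest: single_Suc_inject)
  have disj: "?p ` V \<inter> ?q ` (V - {a}) = {}"
  proof -
    have "?p i \<noteq> ?q j" if "j \<noteq> a" for i j
    proof
      assume eq: "?p i = ?q j"
      have "lookup (?p i) a = lookup (?q j) a" "lookup (?p i) j = lookup (?q j) j" using eq by simp_all
      then show False using that assms(2) by (auto simp: lookup_add lookup_single when_def split: if_splits)
    qed
    then show ?thesis by blast
  qed
  have "card (?p ` V \<union> ?q ` (V - {a})) = card (?p ` V) + card (?q ` (V - {a}))"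
    by (rule card_Un_disjoint) (use disj in auto)
  also have "\<dots> = card V + (card V - 1)" using ip iq a by (simp add: card_image)
  finally have "card (?p ` V \<union> ?q ` (V - {a})) \<ge> 2 * card V - 1" by simp
  moreover have "path_count V v (Suc m) s \<noteq> 0" if "s \<in> ?p ` V \<union> ?q ` (V - {a})" for s
    using that path_count_power[of _ V v "Suc m"] path_count_step[OF _ path_count_power[OF a], of _ v m] by blast
  ultimately show ?thesis by (intro exI[of _ "?p ` V \<union> ?q ` (V - {a})"]) auto
qed

context layered
begin

text \<open>Let \<open>L\<close> be the sum over \<open>V\<close>. If the product has no terms in
  the layers above \<open>lo\<close> up to \<open>hi\<close>, the layers of \<open>f\<close> are
  determined downwards from \<open>v\<close>, each being \<open>- L\<close> times the one above it,
  up to powers of \<open>x_k\<close>. The lowest layer of the product is then a nonzero multiple of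
  \<open>v L^(hi - lo + 1)\<close> with a power of \<open>x_k\<close> removed, and
  \<open>hi - lo + 1 >= 2\<close>.\<close>

lemma power_case:
  assumes v: "supp (layer k hi f) = {v}" and lt: "lo < hi"
    and mid: "\<And>s. lo < lookup s k \<Longrightarrow> lookup s k \<le> hi \<Longrightarrow> g s = 0"
  shows "V \<noteq> {} \<Longrightarrow> card (g_layer lo) \<ge> 2 * card V - 1"
proof -
  let ?e = "\<lambda>n. single k (n::nat)"
  have vk: "lookup v k = hi" "f v \<noteq> 0" using v by (auto simp: supp_layer in_supp)
  \<comment> \<open>Adding \<open>m\<close> at \<open>k\<close> lifts \<open>s\<close> to the layer
    of \<open>v\<close>, where all arguments of \<open>path_count\<close> live.\<close>
  have fm: "f s = (-1) ^ m * f v * of_nat (path_count V v m (s + ?e m))"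
    if "m \<le> hi - lo" "lookup s k = hi - m" for m s
    using that
  proof (induction m arbitrary: s)
    case 0
    have "f s = 0" if "s \<noteq> v" using 0 v that by (auto simp: supp_layer in_supp set_eq_iff)
    then show ?case by auto
  next
    case (Suc m)
    let ?s = "s + ?e 1"
    have sk: "lookup ?s k = hi - m" using Suc.prems lt by (simp add: lookup_add)
    have "g ?s = 0" by (rule mid) (use sk Suc.prems lt in auto)
    moreover have "k \<in> keys ?s" by (simp add: in_keys_iff lookup_add)
    moreover have "?s - ?e 1 = s" by simp
    ultimately have "f s = - lsum_on V f ?s"
      unfolding g_def lsum_on_insert[OF k] by (simp add: eq_neg_iff_add_eq_0 add.commute)
    also have "lsum_on V f ?s = (\<Sum>i\<in>keys ?s \<inter> V. (-1) ^ m * f v * of_nat (path_count V v m (s + ?e (Suc m) - single i 1)))"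
      unfolding lsum_on_def
    proof (rule sum.cong[OF refl])
      fix i assume i: "i \<in> keys ?s \<inter> V"
      then have ik: "i \<noteq> k" using k by auto
      have "f (?s - single i 1) = (-1) ^ m * f v * of_nat (path_count V v m (?s - single i 1 + ?e m))"
        by (rule Suc.IH) (use Suc.prems sk ik in \<open>simp_all add: lookup_diff_single_other\<close>)
      also have "?s - single i 1 + ?e m = s + ?e (Suc m) - single i 1"
        using ik by (intro poly_mapping_eqI) (auto simp: lookup_add lookup_minus lookup_single when_def)
      finally show "f (?s - single i 1) = (-1) ^ m * f v * of_nat (path_count V v m (s + ?e (Suc m) - single i 1))" .
    qed
    also have "keys ?s \<inter> V = keys (s + ?e (Suc m)) \<inter> V"
      using k by (auto simp: in_keys_iff lookup_add lookup_single when_def)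
    also have "(\<Sum>i\<in>keys (s + ?e (Suc m)) \<inter> V. (-1) ^ m * f v * of_nat (path_count V v m (s + ?e (Suc m) - single i 1)))
       = (-1) ^ m * f v * of_nat (path_count V v (Suc m) (s + ?e (Suc m)))"
      by (simp add: sum_distrib_left)
    finally show ?case by simp
  qed
  assume V: "V \<noteq> {}"
  define M where "M = hi - lo"
  have M: "M \<ge> 1" "hi = lo + M" using lt by (auto simp: M_def)
  obtain P where P: "finite P" "card P \<ge> 2 * card V - 1" "\<forall>s\<in>P. path_count V v (Suc M) s \<noteq> 0"
    using path_count_card[OF V M(1)] by blast
  have Pk: "lookup s k = hi" if "path_count V v m s \<noteq> 0" for s m
    using that
  proof (induction m arbitrary: s)
    case 0 then show ?case using vk by (simp split: if_splits)
  next
    case (Suc m)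
    then obtain i where "i \<in> keys s \<inter> V" "path_count V v m (s - single i 1) \<noteq> 0" by auto
    then have "lookup (s - single i 1) k = hi" "i \<noteq> k" using Suc.IH k by auto
    then show ?case using lookup_diff_single_other[of i k s 1] by simp
  qed
  have add: "s - ?e M + ?e M = s" if "s \<in> P" for s
    using Pk[of "Suc M" s] P(3) that M by (intro poly_mapping_eqI) (auto simp: lookup_add lookup_minus lookup_single when_def)
  have sub: "(\<lambda>s. s - ?e M) ` P \<subseteq> g_layer lo"
  proof clarify
    fix s assume s: "s \<in> P"
    let ?s = "s - ?e M"
    have sk: "lookup ?s k = lo" using Pk[of "Suc M" s] P(3) s M by (simp add: lookup_minus)
    have "g ?s = lsum_on V f ?s" by (rule g_low[OF sk])
    also have "\<dots> = (\<Sum>i\<in>keys ?s \<inter> V. (-1) ^ M * f v * of_nat (path_count V v M (s - single i 1)))"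
      unfolding lsum_on_def
    proof (rule sum.cong[OF refl])
      fix i assume i: "i \<in> keys ?s \<inter> V"
      then have ik: "i \<noteq> k" using k by auto
      have "f (?s - single i 1) = (-1) ^ M * f v * of_nat (path_count V v M (?s - single i 1 + ?e M))"
        by (rule fm) (use sk ik M in \<open>simp_all add: lookup_diff_single_other\<close>)
      also have "?s - single i 1 + ?e M = ?s + ?e M - single i 1"
        using ik by (intro poly_mapping_eqI) (auto simp: lookup_add lookup_minus lookup_single when_def)
      also have "?s + ?e M = s" by (rule add[OF s])
      finally show "f (?s - single i 1) = (-1) ^ M * f v * of_nat (path_count V v M (s - single i 1))" .
    qed
    also have "keys ?s \<inter> V = keys s \<inter> V"
      using k by (auto simp: in_keys_iff lookup_minus lookup_single when_def)
    also have "(\<Sum>i\<in>keys s \<inter> V. (-1) ^ M * f v * of_nat (path_count V v M (s - single i 1)))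
       = (-1) ^ M * f v * of_nat (path_count V v (Suc M) s)"
      by (simp add: sum_distrib_left)
    finally have "g ?s \<noteq> 0" using vk(2) P(3) s by (simp del: path_count.simps)
    then show "?s \<in> g_layer lo" using sk by (simp add: g_layer_def supp_def)
  qed
  have "inj_on (\<lambda>s. s - ?e M) P" by (rule inj_onI) (metis add)
  then have "card P = card ((\<lambda>s. s - ?e M) ` P)" by (simp add: card_image)
  also have "\<dots> \<le> card (g_layer lo)" by (rule card_mono[OF finite_g_layer sub])
  finally show "card (g_layer lo) \<ge> 2 * card V - 1" using P(2) by simp
qed

text \<open>With \<open>j\<close> the next nonempty layer of \<open>f\<close>, layer
  \<open>j\<close> of the product is \<open>L\<close> times layer \<open>j\<close> of
  \<open>f\<close> plus \<open>x_k\<close> times layer \<open>j - 1\<close>. The latter is empty or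
  the single lowest monomial, so at most one of at least \<open>card V\<close> terms is lost, and in
  that case the highest layer makes up for it.\<close>

lemma low_monomial_case:
  assumes u: "card (supp (layer k lo f)) = 1" and lt: "lo < hi"
  shows "card (supp g) \<ge> 2 * card V"
proof -
  have low: "card (g_layer lo) \<ge> card V"
    unfolding g_layer_low by (rule card_supp_lsum_on_ge) (use fin lo in \<open>auto simp: supp_layer\<close>)
  define j where "j = (LEAST j. lo < j \<and> supp (layer k j f) \<noteq> {})"
  have ex: "lo < hi \<and> supp (layer k hi f) \<noteq> {}" using lt hi(2) by (auto simp: supp_layer)
  have j: "lo < j" "supp (layer k j f) \<noteq> {}" "j \<le> hi"
    using LeastI[of "\<lambda>j. lo < j \<and> supp (layer k j f) \<noteq> {}", OF ex] Least_le[of "\<lambda>j. lo < j \<and> supp (layer k j f) \<noteq> {}", OF ex]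
    unfolding j_def by auto
  have jmin: "supp (layer k i f) = {}" if "lo < i" "i < j" for i
    using not_less_Least[of i "\<lambda>j. lo < j \<and> supp (layer k j f) \<noteq> {}"] that unfolding j_def by blast
  let ?L = "supp (lsum_on V (layer k j f))"
  have L: "card ?L \<ge> card V" "finite ?L"
    using card_supp_lsum_on_ge[OF _ j(2)] finite_supp_lsum_on[of "layer k j f"] fin by (auto simp: supp_layer)
  have Lin: "s \<in> g_layer j" if s: "s \<in> ?L" "k \<in> keys s \<Longrightarrow> f (s - single k 1) = 0" for s
    using s unfolding g_layer_def supp_def g_def lsum_on_insert[OF k] lsum_on_layer[OF k] by (auto split: if_splits)
  show ?thesis
  proof (cases "j = Suc lo")
    case False
    have "?L \<subseteq> g_layer j"
    proof
      fix s assume s: "s \<in> ?L"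
      then have sj: "lookup s k = j" by (auto simp: in_supp lsum_on_layer[OF k] split: if_splits)
      show "s \<in> g_layer j"
      proof (rule Lin[OF s])
        assume "k \<in> keys s"
        then have "lookup (s - single k 1) k = j - 1" using lookup_diff_k sj by fastforce
        then show "f (s - single k 1) = 0"
          using jmin[of "j - 1"] False j(1) in_supp[of "s - single k 1" "layer k (j - 1) f"]
          by (simp add: layer_def)
      qed
    qed
    then have "card (g_layer j) \<ge> card V" using L card_mono[OF finite_g_layer] le_trans by blast
    moreover have "(\<Sum>i\<in>{lo, j}. card (g_layer i)) \<le> card (supp g)" by (rule card_layers) simp
    ultimately show ?thesis using low j(1) by simp
  next
    case True
    obtain u where u: "supp (layer k lo f) = {u}" using u by (auto simp: card_1_singleton_iff)
    have "?L - {u + single k 1} \<subseteq> g_layer j"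
    proof
      fix s assume s: "s \<in> ?L - {u + single k 1}"
      then have sj: "lookup s k = j" by (auto simp: in_supp lsum_on_layer[OF k] split: if_splits)
      show "s \<in> g_layer j"
      proof (rule Lin)
        show "s \<in> ?L" using s by blast
        assume ks: "k \<in> keys s"
        then have l: "lookup (s - single k 1) k = lo" using lookup_diff_k[OF ks] sj True by simp
        have "s - single k 1 \<noteq> u" using s diff_single_add[OF ks] by auto
        then show "f (s - single k 1) = 0" using u l by (auto simp: supp_layer in_supp set_eq_iff)
      qed
    qed
    then have "card (?L - {u + single k 1}) \<le> card (g_layer j)" by (rule card_mono[OF finite_g_layer])
    moreover have "card ?L - 1 \<le> card (?L - {u + single k 1})" by (rule diff_card_le_card_Diff[THEN order_trans[rotated]]) simp_all
    ultimately have "card V - 1 \<le> card (g_layer j)" using L by linarith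
    moreover have "(\<Sum>i\<in>{lo, j, Suc hi}. card (g_layer i)) \<le> card (supp g)" by (rule card_layers) simp
    ultimately show ?thesis using low j g_layer_high_pos by simp
  qed
qed

end

text \<open>Let \<open>V\<close> be the variables besides \<open>k\<close>. A lowest layer that is
  no monomial gives \<open>2 * card V - 2\<close> terms by induction. Two more come from the highest
  layer, or one from there and one from in between, or else \<open>power_case\<close> improves the
  lowest layer by one. If the lowest layer is a monomial and not the only layer,
  \<open>low_monomial_case\<close> applies.\<close>

lemma card_supp_lsum_on_nonmonomial:
  fixes f :: "'v::finite exponent \<Rightarrow> 'k::field_char_0"
  assumes "finite (supp f)" "card (supp f) \<ge> 2" 
  shows "card (supp (lsum_on V f)) + 2 \<ge> 2 * card V"
  using finite[of V] assms
proof (induction V arbitrary: f rule: finite_induct)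
  case (insert k V)
  have "supp f \<noteq> {}" using insert.prems by auto
  then obtain lo hi where "layered V k f lo hi" using layered_exists[OF insert.hyps(2) insert.prems(1)] by blast
  then interpret layered V k f lo hi .
  have "card (supp g) \<ge> 2 * card V"
  proof (cases "lo = hi")
    case True
    have f: "layer k lo f = f"
    proof
      fix s show "layer k lo f s = f s"
        using lo(1)[of s] hi(1)[of s] True by (cases "f s = 0") (auto simp: layer_def in_supp)
    qed
    have "2 * card V \<le> card (g_layer lo) + 2"
      unfolding g_layer_low f by (rule insert.IH[OF insert.prems])
    moreover have "card (g_layer (Suc hi)) \<ge> 2" using g_layer_high f True insert.prems(2) by simp
    moreover have "(\<Sum>i\<in>{lo, Suc hi}. card (g_layer i)) \<le> card (supp g)" by (rule card_layers) simp
    ultimately show ?thesis using True by simp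
  next
    case False
    then have lt: "lo < hi" using lo_le_hi by simp
    have finl: "finite (supp (layer k i f))" for i using fin by (simp add: supp_layer)
    have ne: "card (supp (layer k lo f)) \<noteq> 0" using lo(2) finl by (auto simp: supp_layer)
    show ?thesis
    proof (cases "card (supp (layer k lo f)) = 1")
      case True then show ?thesis by (rule low_monomial_case[OF _ lt])
    next
      case False
      then have "card (supp (layer k lo f)) \<ge> 2" using ne by simp
      then have low: "2 * card V \<le> card (g_layer lo) + 2"
        unfolding g_layer_low by (intro insert.IH finl)
      have two: "(\<Sum>i\<in>{lo, Suc hi}. card (g_layer i)) \<le> card (supp g)" by (rule card_layers) simp
      show ?thesis
      proof (cases "card (g_layer (Suc hi)) \<ge> 2")
        case True then show ?thesis using low two lt by simp
      next
        case False
        then have one: "card (g_layer (Suc hi)) = 1" using g_layer_high_pos by simp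
        show ?thesis
        proof (cases "\<exists>s. lo < lookup s k \<and> lookup s k \<le> hi \<and> g s \<noteq> 0")
          case True
          then obtain s where s: "lo < lookup s k" "lookup s k \<le> hi" "g s \<noteq> 0" by blast
          then have "s \<in> g_layer (lookup s k)" by (simp add: g_layer_def supp_def)
          then have "card (g_layer (lookup s k)) \<ge> 1" by (metis card_0_eq empty_iff finite_g_layer less_one not_le)
          moreover have "(\<Sum>i\<in>{lo, lookup s k, Suc hi}. card (g_layer i)) \<le> card (supp g)" by (rule card_layers) simp
          ultimately show ?thesis using s low one by simp
        next
          case False
          obtain v where "supp (layer k hi f) = {v}" using one unfolding g_layer_high by (auto simp: card_1_singleton_iff)
          from power_case[OF this lt] False have "V \<noteq> {} \<Longrightarrow> card (g_layer lo) \<ge> 2 * card V - 1" by blast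
          then show ?thesis using two one lt by (cases "V = {}") auto
        qed
      qed
    qed
  qed
  then show ?case using insert.hyps by (simp add: g_def)
qed simp

section \<open>Monomial ideals\<close>

lemma poly_mapping_as_sum: "F = (\<Sum>m\<in>keys F. single m (lookup F m))"
proof (rule poly_mapping_eqI)
  fix k
  have "lookup (\<Sum>m\<in>A. single m (lookup F m)) k = (\<Sum>m\<in>A. lookup (single m (lookup F m)) k)" for A
    by (induction A rule: infinite_finite_induct) (auto simp: lookup_add)
  then have "lookup (\<Sum>m\<in>keys F. single m (lookup F m)) k = (\<Sum>m\<in>keys F. if m = k then lookup F k else 0)"
    by (auto simp: lookup_single when_def intro!: sum.cong)
  then show "lookup F k = lookup (\<Sum>m\<in>keys F. single m (lookup F m)) k"
    by (simp add: in_keys_iff)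
qed

lemma lookup_sum_mapping: "lookup (\<Sum>x\<in>A. G x) k = (\<Sum>x\<in>A. lookup (G x) k)"
  by (induction A rule: infinite_finite_induct) (auto simp: lookup_add)

lemma lookup_single_times:
  fixes F :: "('i, 'k::comm_ring_1) mpoly"
  shows "lookup (single b c * F) s = (if \<exists>m. s = b + m then c * lookup F (s - b) else 0)"
proof -
  have "single b c * F = (\<Sum>m\<in>keys F. single (b + m) (c * lookup F m))"
    by (subst (1) poly_mapping_as_sum[of F]) (simp add: sum_distrib_left mult_single)
  then have "lookup (single b c * F) s = (\<Sum>m\<in>keys F. if b + m = s then c * lookup F m else 0)"
    by (simp add: lookup_sum_mapping lookup_single when_def)
  also have "\<dots> = (if \<exists>m. s = b + m then c * lookup F (s - b) else 0)"
  proof (cases "\<exists>m. s = b + m")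
    case True
    then obtain m where m: "s = b + m" by blast
    have "(\<Sum>m\<in>keys F. if b + m = s then c * lookup F m else 0) = (\<Sum>m'\<in>keys F. if m' = m then c * lookup F m else 0)"
      by (rule sum.cong) (auto simp: m)
    then show ?thesis using m by (auto simp: in_keys_iff)
  next
    case False
    then show ?thesis by (auto intro!: sum.neutral)
  qed
  finally show ?thesis .
qed

lemma exponent_ge_single_iff: "(\<exists>b. s = single i (n::nat) + b) \<longleftrightarrow> n \<le> lookup s i"
proof
  assume "n \<le> lookup s i"
  then have "s = single i n + (s - single i n)"
    by (intro poly_mapping_eqI) (auto simp: lookup_add lookup_minus lookup_single when_def)
  then show "\<exists>b. s = single i n + b" by blast
qed (auto simp: lookup_add)

lemma lookup_linear_form_times:
  fixes F :: "('v::finite, 'k::comm_ring_1) mpoly"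
  shows "lookup (linear_form a * F) s = (\<Sum>i\<in>keys s. a i * lookup F (s - single i 1))"
proof -
  have "lookup (linear_form a * F) s = (\<Sum>i\<in>UNIV. lookup (single (single i 1) (a i) * F) s)"
    by (simp add: linear_form_def sum_distrib_right lookup_sum_mapping)
  also have "\<dots> = (\<Sum>i\<in>UNIV. if i \<in> keys s then a i * lookup F (s - single i 1) else 0)"
    unfolding lookup_single_times exponent_ge_single_iff by (intro sum.cong) (auto simp: in_keys_iff)
  also have "\<dots> = (\<Sum>i\<in>keys s. a i * lookup F (s - single i 1))"
    by (simp add: sum.If_cases)
  finally show ?thesis .
qed

text \<open>The ideal generated by the monomials of \<open>A\<close>, described so that membership
  can be tested term by term.\<close>

definition mono_ideal :: "'i exponent set \<Rightarrow> ('i, 'k::comm_ring_1) mpoly set" where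
  "mono_ideal A = {F. \<forall>m\<in>keys F. \<exists>a\<in>A. \<exists>b. m = a + b}"

lemma is_ideal_mono_ideal: "is_ideal (mono_ideal A :: ('i, 'k::comm_ring_1) mpoly set)"
proof -
  interpret rm: module "(*) :: ('i, 'k) mpoly \<Rightarrow> _ \<Rightarrow> _" by (rule module_self)
  show ?thesis unfolding is_ideal_def
  proof (rule rm.subspaceI)
    show "0 \<in> mono_ideal A" by (simp add: mono_ideal_def)
  next
    fix F G :: "('i, 'k) mpoly" assume "F \<in> mono_ideal A" "G \<in> mono_ideal A"
    then show "F + G \<in> mono_ideal A" using Poly_Mapping.keys_add[of F G] by (auto simp: mono_ideal_def)
  next
    fix c F :: "('i, 'k) mpoly" assume F: "F \<in> mono_ideal A"
    show "c * F \<in> mono_ideal A" unfolding mono_ideal_def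
    proof (intro CollectI ballI)
      fix m assume "m \<in> keys (c * F)"
      then obtain x y where xy: "m = x + y" "y \<in> keys F" using keys_mult[of c F] by blast
      then obtain a b where "a \<in> A" "y = a + b" using F by (auto simp: mono_ideal_def)
      then have "m = a + (x + b)" using xy by (simp add: ac_simps)
      then show "\<exists>a\<in>A. \<exists>b. m = a + b" using \<open>a \<in> A\<close> by blast
    qed
  qed
qed

lemma ideal_gen_subset:
  assumes "is_ideal J" "S \<subseteq> J" shows "ideal_gen S \<subseteq> J"
proof -
  interpret rm: module "(*) :: 'a \<Rightarrow> 'a \<Rightarrow> 'a" by (rule module_self)
  show ?thesis using assms unfolding ideal_gen_def is_ideal_def by (intro rm.span_minimal)
qed

lemma ideal_gen_monomials:
  "ideal_gen (monom_of ` A :: ('i, 'k::comm_ring_1) mpoly set) = mono_ideal A"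
proof (rule equalityI)
  have "monom_of a \<in> (mono_ideal A :: ('i, 'k) mpoly set)" if "a \<in> A" for a
    using that unfolding mono_ideal_def monom_of_def by (auto intro!: bexI[of _ a] exI[of _ 0])
  then show "ideal_gen (monom_of ` A :: ('i, 'k) mpoly set) \<subseteq> mono_ideal A"
    by (intro ideal_gen_subset is_ideal_mono_ideal) auto
  interpret rm: module "(*) :: ('i, 'k) mpoly \<Rightarrow> _ \<Rightarrow> _" by (rule module_self)
  show "mono_ideal A \<subseteq> ideal_gen (monom_of ` A :: ('i, 'k) mpoly set)"
  proof
    fix F :: "('i, 'k) mpoly" assume F: "F \<in> mono_ideal A"
    have "single m (lookup F m) \<in> rm.span (monom_of ` A)" if m: "m \<in> keys F" for m
    proof -
      obtain a b where ab: "a \<in> A" "m = a + b" using F m by (auto simp: mono_ideal_def)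
      have "single m (lookup F m) = single b (lookup F m) * monom_of a"
        by (simp add: monom_of_def mult_single ab add.commute)
      then show ?thesis using ab(1) by (simp add: rm.span_scale rm.span_base)
    qed
    then have "(\<Sum>m\<in>keys F. single m (lookup F m)) \<in> rm.span (monom_of ` A)"
      by (intro rm.span_sum)
    then show "F \<in> ideal_gen (monom_of ` A)" unfolding ideal_gen_def by (simp flip: poly_mapping_as_sum)
  qed
qed

lemma exp_degree_0_iff: "exp_degree (b :: 'v::finite exponent) = 0 \<longleftrightarrow> b = 0"
  by (auto simp: exp_degree_sum intro: poly_mapping_eqI)

lemma form_in_mono_ideal:
  fixes F :: "('v::finite, 'k::comm_ring_1) mpoly"
  assumes A: "\<And>m. m \<in> A \<Longrightarrow> exp_degree m = d" and F: "is_form d F"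
  shows "F \<in> mono_ideal A \<longleftrightarrow> keys F \<subseteq> A"
proof
  assume I: "F \<in> mono_ideal A"
  show "keys F \<subseteq> A"
  proof
    fix m assume m: "m \<in> keys F"
    then obtain a b where ab: "a \<in> A" "m = a + b" using I by (auto simp: mono_ideal_def)
    then have "exp_degree b = 0" using F m A[of a] by (auto simp: is_form_def exp_degree_add)
    then show "m \<in> A" using ab by (simp add: exp_degree_0_iff)
  qed
next
  assume "keys F \<subseteq> A"
  then show "F \<in> mono_ideal A"
    unfolding mono_ideal_def by (auto intro!: exI[of _ 0])
qed

lemma monom_of_in_mono_ideal:
  assumes A: "\<And>m. m \<in> A \<Longrightarrow> exp_degree m = d" and m: "exp_degree m = d"
  shows "(monom_of m :: ('v::finite, 'k::comm_ring_1) mpoly) \<in> mono_ideal A \<longleftrightarrow> m \<in> A"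
  using form_in_mono_ideal[of A d "monom_of m :: ('v, 'k) mpoly", OF A] m
  by (simp add: monom_of_def is_form_def)

lemma monom_of_mono_ideal_iff:
  "(monom_of m :: ('i, 'k::comm_ring_1) mpoly) \<in> mono_ideal A \<longleftrightarrow> (\<exists>a\<in>A. \<exists>b. m = a + b)"
  by (simp add: mono_ideal_def monom_of_def)

text \<open>The chain of ideals obtained by adjoining \<open>x_i^N\<close> stabilises, so for some
  \<open>N\<close> an element of \<open>A\<close> divides \<open>x_i^N\<close>, the new generator
  \<open>x_i^(N+1)\<close> being too large. A divisor of \<open>x_i^N\<close> is a power of
  \<open>x_i\<close>.\<close>

lemma artinian_pure_powers:
  fixes A :: "'v::finite exponent set"
  assumes A: "\<And>m. m \<in> A \<Longrightarrow> exp_degree m = d"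
    and art: "artinian_ideal (mono_ideal A :: ('v, 'k::comm_ring_1) mpoly set)"
  shows "single i d \<in> A"
proof -
  define J :: "nat \<Rightarrow> ('v, 'k) mpoly set" where "J N = mono_ideal (insert (single i N) A)" for N
  have "is_ideal (J N) \<and> mono_ideal A \<subseteq> J N \<and> J (Suc N) \<subseteq> J N" for N
  proof (intro conjI)
    show "is_ideal (J N)" unfolding J_def by (rule is_ideal_mono_ideal)
    show "mono_ideal A \<subseteq> J N" unfolding J_def mono_ideal_def by blast
    show "J (Suc N) \<subseteq> J N"
    proof
      fix F assume F: "F \<in> J (Suc N)"
      show "F \<in> J N" unfolding J_def mono_ideal_def
      proof (intro CollectI ballI)
        fix m assume "m \<in> keys F"
        then have "(\<exists>a\<in>A. \<exists>b. m = a + b) \<or> (\<exists>b. m = single i (Suc N) + b)"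
          using F unfolding J_def mono_ideal_def by auto
        then show "\<exists>a\<in>insert (single i N) A. \<exists>b. m = a + b"
        proof
          assume "\<exists>b. m = single i (Suc N) + b"
          then have "N \<le> lookup m i" unfolding exponent_ge_single_iff by simp
          then have "\<exists>b. m = single i N + b" unfolding exponent_ge_single_iff .
          then show ?thesis by simp
        qed simp
      qed
    qed
  qed
  then have "\<forall>n. is_ideal (J n) \<and> mono_ideal A \<subseteq> J n \<and> J (Suc n) \<subseteq> J n" by (rule allI)
  with art[unfolded artinian_ideal_def, THEN conjunct2, THEN spec, of J]
  have "\<exists>N. \<forall>n\<ge>N. J n = J N" by (rule mp)
  then obtain N where N: "\<forall>n\<ge>N. J n = J N" ..
  have "single i N = single i N + 0" by simp
  then have "monom_of (single i N) \<in> J N"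
    unfolding J_def monom_of_mono_ideal_iff by blast
  also have "J N = J (Suc N)" by (rule N[rule_format, OF le_SucI[OF order_refl], symmetric])
  finally have "\<exists>a\<in>insert (single i (Suc N)) A. \<exists>b. single i N = a + b"
    unfolding J_def monom_of_mono_ideal_iff .
  then obtain a b where ab: "a \<in> insert (single i (Suc N)) A" "single i N = a + b" by blast
  have "a \<noteq> single i (Suc N)"
  proof
    assume "a = single i (Suc N)"
    then have "lookup (single i N) i \<ge> Suc N" unfolding ab(2) by (simp add: lookup_add)
    then show False by simp
  qed
  then have "a \<in> A" using ab(1) by simp
  have "keys a \<subseteq> {i}"
  proof
    fix j assume "j \<in> keys a"
    then have "lookup (single i N) j \<noteq> 0" unfolding ab(2) by (simp add: lookup_add in_keys_iff)
    then show "j \<in> {i}" by (simp add: lookup_single when_def split: if_splits)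
  qed
  then have "a = single i (exp_degree a)" by (rule single_of_keys)
  then have "a = single i d" unfolding A[OF \<open>a \<in> A\<close>] .
  then show ?thesis using \<open>a \<in> A\<close> by simp
qed

lemma subspace_dim_eq:
  fixes V W :: "('i \<Rightarrow> 'k::field) set"
  assumes M: "finite M" "\<And>v x. v \<in> V \<Longrightarrow> x \<notin> M \<Longrightarrow> v x = 0"
    and W: "module.subspace fun_scale W" "W \<subseteq> V" and d: "vector_space.dim fun_scale V \<le> vector_space.dim fun_scale W"
  shows "W = V"
proof (rule ccontr)
  assume "W \<noteq> V"
  then obtain x where x: "x \<in> V" "x \<notin> W" using W(2) by blast
  interpret fs: vector_space "fun_scale :: 'k \<Rightarrow> ('i \<Rightarrow> 'k) \<Rightarrow> 'i \<Rightarrow> 'k" by (rule vector_space_coords)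
  obtain B where B: "B \<subseteq> W" "fs.independent B" "W \<subseteq> fs.span B" "card B = fs.dim W"
    using fs.basis_exists[of W] by blast
  obtain B' where B': "B' \<subseteq> V" "fs.independent B'" "V \<subseteq> fs.span B'" "card B' = fs.dim V"
    using fs.basis_exists[of V] by blast
  have VM: "V \<subseteq> fs.span (unit_vec ` M)"
  proof
    fix v assume "v \<in> V"
    then show "v \<in> fs.span (unit_vec ` M)" using M(2) by (intro supported_in_span[OF M(1)]) simp
  qed
  have finB': "finite B'"
    using fs.independent_span_bound[OF finite_imageI[OF M(1)] B'(2) subset_trans[OF B'(1) VM]] by (rule conjunct1)
  have "fs.span B \<subseteq> W" by (rule fs.span_minimal[OF B(1) W(1)])
  then have xs: "x \<notin> fs.span B" using x by blast
  then have ind: "fs.independent (insert x B)" by (rule fs.independent_insertI[OF _ B(2)])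
  have "insert x B \<subseteq> fs.span B'" using B'(3) x(1) B(1) W(2) by auto
  from fs.independent_span_bound[OF finB' ind this]
  have "finite (insert x B) \<and> card (insert x B) \<le> card B'" .
  moreover have "x \<notin> B" using xs fs.span_base by blast
  ultimately show False using B(4) B'(4) d by auto
qed

text \<open>All spaces live on the finite set \<open>M\<close>, so the chain is constant from a
  place where the dimension is minimal.\<close>

lemma descending_chain_supported:
  fixes V :: "nat \<Rightarrow> ('i \<Rightarrow> 'k::field) set"
  assumes M: "finite M" "\<And>n v x. v \<in> V n \<Longrightarrow> x \<notin> M \<Longrightarrow> v x = 0"
    and V: "\<And>n. module.subspace fun_scale (V n)" "\<And>n. V (Suc n) \<subseteq> V n"
  shows "\<exists>N. \<forall>n\<ge>N. V n = V N"
proof -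
  let ?d = "\<lambda>n. vector_space.dim fun_scale (V n)"
  define N where "N = (ARG_MIN ?d n. True)"
  have N: "?d N \<le> ?d n" for n unfolding N_def by (rule arg_min_nat_le) simp
  have "V n = V N" if "n \<ge> N" for n
  proof (rule subspace_dim_eq[OF M(1)])
    show "V n \<subseteq> V N" by (rule lift_Suc_antimono_le[of V, OF V(2) that])
  qed (use M(2) V(1) N in auto)
  then show ?thesis by blast
qed

lemma finite_box: "finite {m :: 'v::finite exponent. \<forall>i. lookup m i < d}"
proof -
  have "lookup ` {m :: 'v exponent. \<forall>i. lookup m i < d} \<subseteq> (UNIV :: 'v set) \<rightarrow>\<^sub>E {..<d}" by auto
  moreover have "finite ((UNIV :: 'v set) \<rightarrow>\<^sub>E {..<d})" by (intro finite_PiE) auto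
  ultimately have "finite (lookup ` {m :: 'v exponent. \<forall>i. lookup m i < d})" by (rule finite_subset)
  then show ?thesis by (rule finite_imageD) (simp add: inj_on_def lookup_inject)
qed

text \<open>Modulo the ideal every polynomial reduces to its part supported in the finite box of
  exponents below \<open>d\<close>, so a chain of ideals above it becomes a chain of subspaces of a
  finite-dimensional space.\<close>

lemma pure_powers_artinian:
  fixes A :: "'v::finite exponent set"
  assumes pure: "\<And>i. single i d \<in> A"
  shows "artinian_ideal (mono_ideal A :: ('v, 'k::field) mpoly set)"
  unfolding artinian_ideal_def
proof (intro conjI allI impI)
  show "is_ideal (mono_ideal A :: ('v, 'k) mpoly set)" by (rule is_ideal_mono_ideal)
  fix J :: "nat \<Rightarrow> ('v, 'k) mpoly set"
  assume J: "\<forall>n. is_ideal (J n) \<and> mono_ideal A \<subseteq> J n \<and> J (Suc n) \<subseteq> J n"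
  interpret rm: module "(*) :: ('v, 'k) mpoly \<Rightarrow> _ \<Rightarrow> _" by (rule module_self)
  interpret fs: vector_space "fun_scale :: 'k \<Rightarrow> ('v exponent \<Rightarrow> 'k) \<Rightarrow> 'v exponent \<Rightarrow> 'k" by (rule vector_space_coords)
  have sub: "rm.subspace (J n)" for n using J by (simp add: is_ideal_def)
  define Box where "Box = {m :: 'v exponent. \<forall>i. lookup m i < d}"
  define V where "V n = lookup ` {F \<in> J n. keys F \<subseteq> Box}" for n
  have "\<exists>N. \<forall>n\<ge>N. V n = V N"
  proof (rule descending_chain_supported)
    show "finite Box" unfolding Box_def by (rule finite_box)
    show "v x = 0" if "v \<in> V n" "x \<notin> Box" for n v x using that by (auto simp: V_def in_keys_iff subset_iff)
    show "V (Suc n) \<subseteq> V n" for n using J unfolding V_def by blast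
    show "fs.subspace (V n)" for n
    proof (rule fs.subspaceI)
      show "0 \<in> V n" unfolding V_def using rm.subspace_0[OF sub, of n] by (auto intro!: image_eqI[of _ _ 0] simp: fun_eq_iff)
    next
      fix x y assume "x \<in> V n" "y \<in> V n"
      then obtain F G where FG: "x = lookup F" "y = lookup G" "F \<in> J n" "G \<in> J n" "keys F \<subseteq> Box" "keys G \<subseteq> Box"
        by (auto simp: V_def)
      have "F + G \<in> J n" using rm.subspace_add[OF sub] FG by blast
      moreover have "keys (F + G) \<subseteq> Box" using Poly_Mapping.keys_add[of F G] FG by blast
      moreover have "x + y = lookup (F + G)" by (simp add: FG fun_eq_iff lookup_add)
      ultimately show "x + y \<in> V n" unfolding V_def by blast
    next
      fix c x assume "x \<in> V n"
      then obtain F where F: "x = lookup F" "F \<in> J n" "keys F \<subseteq> Box" by (auto simp: V_def)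
      let ?G = "single 0 c * F"
      have l: "lookup ?G s = c * lookup F s" for s by (simp add: lookup_single_times)
      have "?G \<in> J n" using rm.subspace_scale[OF sub] F by blast
      moreover have "keys ?G \<subseteq> Box" using F(3) l by (auto simp: in_keys_iff subset_iff)
      moreover have "fun_scale c x = lookup ?G" by (simp add: F l fun_eq_iff)
      ultimately show "fun_scale c x \<in> V n" unfolding V_def by blast
    qed
  qed
  then obtain N where N: "\<And>n. n \<ge> N \<Longrightarrow> V n = V N" by blast
  have "J n = J N" if n: "n \<ge> N" for n
  proof
    show "J n \<subseteq> J N" by (rule lift_Suc_antimono_le[of J, OF _ n]) (use J in blast)
    show "J N \<subseteq> J n"
    proof
      fix F assume F: "F \<in> J N"
      define FU where "FU = (\<Sum>m\<in>keys F \<inter> Box. single m (lookup F m))"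
      define FI where "FI = (\<Sum>m\<in>keys F - Box. single m (lookup F m))"
      have "F = (\<Sum>m\<in>keys F. single m (lookup F m))" by (rule poly_mapping_as_sum)
      also have "\<dots> = FU + FI" unfolding FU_def FI_def
        by (subst sum.Int_Diff[of _ _ Box]) simp_all
      finally have eq: "F = FU + FI" .
      have lk: "lookup (\<Sum>m\<in>X. single m (lookup F m)) s = (if s \<in> X then lookup F s else 0)" if "finite X" for X s
        using that by (simp add: lookup_sum_mapping lookup_single when_def)
      have kU: "keys FU \<subseteq> Box" unfolding FU_def by (auto simp: in_keys_iff lk split: if_splits)
      have "FI \<in> mono_ideal A" unfolding mono_ideal_def
      proof (intro CollectI ballI)
        fix m assume "m \<in> keys FI"
        then have "m \<notin> Box" unfolding FI_def by (auto simp: in_keys_iff lk split: if_splits)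
        then obtain i where "d \<le> lookup m i" by (auto simp: Box_def not_less)
        then obtain b where "m = single i d + b" using exponent_ge_single_iff[of m i d] by blast
        then show "\<exists>a\<in>A. \<exists>b. m = a + b" using pure by blast
      qed
      then have FI: "FI \<in> J m" for m using J by blast
      have "FU = F - FI" using eq by simp
      then have "FU \<in> J N" using rm.subspace_diff[OF sub F FI] by simp
      then have "lookup FU \<in> V N" using kU by (auto simp: V_def)
      then have "lookup FU \<in> V n" using N[OF n] by simp
      then obtain G where "lookup FU = lookup G" "G \<in> J n" by (auto simp: V_def)
      then have "FU \<in> J n" by (simp add: lookup_inject)
      then show "F \<in> J n" unfolding eq by (rule rm.subspace_add[OF sub _ FI])
    qed
  qed
  then show "\<exists>N. \<forall>n\<ge>N. J n = J N" by blast
qed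

text \<open>Consider the components of degree \<open>d\<close>. No element of the ideal has terms of
  smaller degree, so multiplication by \<open>h\<close> acts on these components as the scalar
  \<open>lookup h 0\<close>; hence those of \<open>S\<close> span the unit vectors of
  \<open>A\<close> as a vector space.\<close>

lemma card_le_generators:
  fixes A :: "'v::finite exponent set"
  assumes A: "\<And>m. m \<in> A \<Longrightarrow> exp_degree m = d"
    and S: "finite S" "ideal_gen S = (mono_ideal A :: ('v, 'k::field) mpoly set)"
  shows "card A \<le> card S"
proof -
  interpret rm: module "(*) :: ('v, 'k) mpoly \<Rightarrow> _ \<Rightarrow> _" by (rule module_self)
  interpret fs: vector_space "fun_scale :: 'k \<Rightarrow> ('v exponent \<Rightarrow> 'k) \<Rightarrow> 'v exponent \<Rightarrow> 'k" by (rule vector_space_coords)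
  define part where "part F = (\<lambda>m. if exp_degree m = d then lookup F m else 0)" for F :: "('v, 'k) mpoly"
  have finA: "finite A" by (rule finite_subset[OF _ finite_exp_degree[of d]]) (use A in blast)
  have subI: "rm.subspace (mono_ideal A)" using is_ideal_mono_ideal[of A] unfolding is_ideal_def .
  have sub: "rm.subspace {G \<in> mono_ideal A. part G \<in> fs.span (part ` S)}"
  proof (rule rm.subspaceI)
    show "0 \<in> {G \<in> mono_ideal A. part G \<in> fs.span (part ` S)}"
    proof -
      have "part 0 = 0" by (simp add: part_def fun_eq_iff)
      then show ?thesis using fs.span_zero by (simp add: mono_ideal_def)
    qed
  next
    fix F G assume FG: "F \<in> {G \<in> mono_ideal A. part G \<in> fs.span (part ` S)}" "G \<in> {G \<in> mono_ideal A. part G \<in> fs.span (part ` S)}"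
    have "part (F + G) = part F + part G" by (simp add: part_def fun_eq_iff lookup_add)
    moreover have "F + G \<in> mono_ideal A"
      by (rule rm.subspace_add[OF subI]) (use FG in simp_all)
    ultimately show "F + G \<in> {G \<in> mono_ideal A. part G \<in> fs.span (part ` S)}"
      using FG fs.span_add by simp
  next
    fix h F assume F: "F \<in> {G \<in> mono_ideal A. part G \<in> fs.span (part ` S)}"
    have "part (h * F) = fun_scale (lookup h 0) (part F)"
    proof
      fix m
      show "part (h * F) m = lookup h 0 * part F m"
      proof (cases "exp_degree m = d")
        case True
        define h' where "h' = h - single 0 (lookup h 0)"
        have h0: "0 \<notin> keys h'" by (simp add: h'_def in_keys_iff lookup_minus)
        have "lookup (h' * F) m = 0"
        proof (rule ccontr)
          assume "lookup (h' * F) m \<noteq> 0"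
          then have "m \<in> keys (h' * F)" by (simp add: in_keys_iff)
          then obtain x y where xy: "m = x + y" "x \<in> keys h'" "y \<in> keys F" using keys_mult[of h' F] by blast
          then obtain a b where ab: "a \<in> A" "y = a + b" using F by (auto simp: mono_ideal_def)
          have "exp_degree x \<noteq> 0" using h0 xy(2) by (auto simp: exp_degree_0_iff)
          then show False using True xy(1) ab A[OF ab(1)] by (simp add: exp_degree_add)
        qed
        moreover have "h * F = single 0 (lookup h 0) * F + h' * F"
          by (simp add: h'_def algebra_simps)
        ultimately show ?thesis using True by (simp add: part_def lookup_add lookup_single_times)
      qed (simp add: part_def)
    qed
    moreover have "h * F \<in> mono_ideal A"
      by (rule rm.subspace_scale[OF subI]) (use F in simp)
    ultimately show "h * F \<in> {G \<in> mono_ideal A. part G \<in> fs.span (part ` S)}"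
      using F fs.span_scale by simp
  qed
  have "S \<subseteq> ideal_gen S" unfolding ideal_gen_def by (auto intro: rm.span_base)
  then have "S \<subseteq> {G \<in> mono_ideal A. part G \<in> fs.span (part ` S)}"
    unfolding S(2) by (intro subsetI CollectI conjI fs.span_base imageI) auto
  then have "ideal_gen S \<subseteq> {G \<in> mono_ideal A. part G \<in> fs.span (part ` S)}"
    by (rule ideal_gen_subset[OF sub[folded is_ideal_def]])
  then have all: "part G \<in> fs.span (part ` S)" if "G \<in> mono_ideal A" for G using that unfolding S(2) by auto
  have "unit_vec ` A \<subseteq> fs.span (part ` S)"
  proof
    fix v :: "'v exponent \<Rightarrow> 'k" assume "v \<in> unit_vec ` A"
    then obtain a where a: "a \<in> A" "v = unit_vec a" by blast
    have "part (monom_of a) = v"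
      using A[OF a(1)] by (auto simp: part_def monom_of_def unit_vec_def a(2) lookup_single when_def fun_eq_iff)
    moreover have "monom_of a \<in> (mono_ideal A :: ('v, 'k) mpoly set)"
      using monom_of_in_mono_ideal[of A d a, OF A A[OF a(1)]] a(1) by simp
    ultimately show "v \<in> fs.span (part ` S)" using all[of "monom_of a"] by simp
  qed
  then have "card (unit_vec ` A :: ('v exponent \<Rightarrow> 'k) set) \<le> card (part ` S)"
    using fs.independent_span_bound[OF finite_imageI[OF S(1)] independent_unit_vec[OF finA]] by blast
  also have "\<dots> \<le> card S" by (rule card_image_le[OF S(1)])
  finally show ?thesis by (simp add: card_image inj_on_subset[OF inj_unit_vec])
qed

section \<open>The weak Lefschetz property and minimality\<close>

lemma coset_of_eq_iff:
  assumes "is_ideal I" shows "coset_of I F = coset_of I G \<longleftrightarrow> F - G \<in> I"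
proof -
  interpret rm: module "(*) :: 'a \<Rightarrow> 'a \<Rightarrow> 'a" by (rule module_self)
  have I: "rm.subspace I" using assms by (simp add: is_ideal_def)
  show ?thesis
  proof
    assume "coset_of I F = coset_of I G"
    moreover have "F + 0 \<in> coset_of I F" unfolding coset_of_def using rm.subspace_0[OF I] by blast
    ultimately obtain h where "F = G + h" "h \<in> I" unfolding coset_of_def by auto
    then show "F - G \<in> I" by simp
  next
    assume d: "F - G \<in> I"
    have "coset_of I X \<subseteq> coset_of I Y" if "X - Y \<in> I" for X Y
    proof
      fix x assume "x \<in> coset_of I X"
      then obtain h where h: "x = X + h" "h \<in> I" unfolding coset_of_def by blast
      have "x = Y + (X - Y + h)" using h by simp
      moreover have "X - Y + h \<in> I" using rm.subspace_add[OF I that h(2)] .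
      ultimately show "x \<in> coset_of I Y" unfolding coset_of_def by blast
    qed
    moreover have "G - F \<in> I" using rm.subspace_neg[OF I d] by simp
    ultimately show "coset_of I F = coset_of I G" using d by (intro equalityI)
  qed
qed

lemma mult_map_coset:
  assumes "is_ideal I" shows "mult_map I L (coset_of I F) = coset_of I (L * F)"
proof -
  interpret rm: module "(*) :: 'a \<Rightarrow> 'a \<Rightarrow> 'a" by (rule module_self)
  have I: "rm.subspace I" using assms by (simp add: is_ideal_def)
  show ?thesis
  proof (intro equalityI subsetI)
    fix x assume "x \<in> mult_map I L (coset_of I F)"
    then obtain h h' where h: "x = L * (F + h) + h'" "h \<in> I" "h' \<in> I" unfolding mult_map_def coset_of_def by blast
    have "x = L * F + (L * h + h')" using h by (simp add: algebra_simps)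
    moreover have "L * h + h' \<in> I" by (rule rm.subspace_add[OF I rm.subspace_scale[OF I h(2)] h(3)])
    ultimately show "x \<in> coset_of I (L * F)" unfolding coset_of_def by blast
  next
    fix x assume "x \<in> coset_of I (L * F)"
    then obtain h where h: "x = L * F + h" "h \<in> I" unfolding coset_of_def by blast
    have "F + 0 \<in> coset_of I F" unfolding coset_of_def using rm.subspace_0[OF I] by blast
    then have "F \<in> coset_of I F" by simp
    then show "x \<in> mult_map I L (coset_of I F)" unfolding mult_map_def using h by blast
  qed
qed

lemma is_form_linear_form_times:
  fixes F :: "('v::finite, 'k::comm_ring_1) mpoly"
  assumes "is_form j F" shows "is_form (Suc j) (linear_form a * F)"
  unfolding is_form_def
proof
  fix s assume "s \<in> keys (linear_form a * F)"
  then have "(\<Sum>i\<in>keys s. a i * lookup F (s - single i 1)) \<noteq> 0"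
    by (simp add: in_keys_iff lookup_linear_form_times)
  then obtain i where i: "i \<in> keys s" "a i * lookup F (s - single i 1) \<noteq> 0" by (meson sum.neutral)
  then have "s - single i 1 \<in> keys F" by (auto simp: in_keys_iff)
  then have "exp_degree (s - single i 1) = j" using assms by (simp add: is_form_def)
  then show "exp_degree s = Suc j" using exp_degree_diff_single[OF i(1)] by simp
qed

lemma is_form_diff: "is_form j F \<Longrightarrow> is_form j G \<Longrightarrow> is_form j (F - G)"
  unfolding is_form_def by (metis in_keys_iff lookup_minus diff_zero)

lemma not_inj_mult_map_iff:
  fixes I :: "('v::finite, 'k::comm_ring_1) mpoly set"
  assumes I: "is_ideal I"
  shows "\<not> inj_on (mult_map I (linear_form a)) (graded_piece I j) \<longleftrightarrow>
    (\<exists>F. is_form j F \<and> F \<notin> I \<and> linear_form a * F \<in> I)"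
proof
  assume "\<not> inj_on (mult_map I (linear_form a)) (graded_piece I j)"
  then obtain F G where FG: "is_form j F" "is_form j G" "coset_of I F \<noteq> coset_of I G"
    "mult_map I (linear_form a) (coset_of I F) = mult_map I (linear_form a) (coset_of I G)"
    unfolding inj_on_def graded_piece_def by auto
  have "linear_form a * F - linear_form a * G \<in> I"
    using FG(4) by (simp only: mult_map_coset[OF I] coset_of_eq_iff[OF I])
  then have "linear_form a * (F - G) \<in> I" by (simp add: algebra_simps)
  moreover have "F - G \<notin> I" using FG(3) by (simp only: coset_of_eq_iff[OF I] not_False_eq_True)
  ultimately show "\<exists>F. is_form j F \<and> F \<notin> I \<and> linear_form a * F \<in> I"
    using is_form_diff[OF FG(1,2)] by blast
next
  assume "\<exists>F. is_form j F \<and> F \<notin> I \<and> linear_form a * F \<in> I"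
  then obtain F where F: "is_form j F" "F \<notin> I" "linear_form a * F \<in> I" by blast
  have z: "is_form j (0 :: ('v, 'k) mpoly)" by (simp add: is_form_def)
  show "\<not> inj_on (mult_map I (linear_form a)) (graded_piece I j)"
  proof
    assume inj: "inj_on (mult_map I (linear_form a)) (graded_piece I j)"
    have "coset_of I F = coset_of I 0"
    proof (rule inj_onD[OF inj])
      show "mult_map I (linear_form a) (coset_of I F) = mult_map I (linear_form a) (coset_of I 0)"
        unfolding mult_map_coset[OF I] coset_of_eq_iff[OF I] using F(3) by simp
    qed (use F z in \<open>simp_all add: graded_piece_def\<close>)
    then show False using F(2) by (simp add: coset_of_eq_iff[OF I])
  qed
qed

lemma surj_mult_map_iff:
  fixes I :: "('v::finite, 'k::comm_ring_1) mpoly set"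
  assumes I: "is_ideal I"
  shows "mult_map I (linear_form a) ` graded_piece I j = graded_piece I (Suc j) \<longleftrightarrow>
    (\<forall>G. is_form (Suc j) G \<longrightarrow> (\<exists>F. is_form j F \<and> linear_form a * F - G \<in> I))"
proof
  assume eq: "mult_map I (linear_form a) ` graded_piece I j = graded_piece I (Suc j)"
  show "\<forall>G. is_form (Suc j) G \<longrightarrow> (\<exists>F. is_form j F \<and> linear_form a * F - G \<in> I)"
  proof (intro allI impI)
    fix G :: "('v, 'k) mpoly" assume "is_form (Suc j) G"
    then have "coset_of I G \<in> graded_piece I (Suc j)" unfolding graded_piece_def by simp
    then have "coset_of I G \<in> mult_map I (linear_form a) ` graded_piece I j" unfolding eq .
    then obtain F where "is_form j F" "coset_of I G = mult_map I (linear_form a) (coset_of I F)"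
      unfolding graded_piece_def by auto
    then have "coset_of I (linear_form a * F) = coset_of I G" by (simp only: mult_map_coset[OF I])
    then show "\<exists>F. is_form j F \<and> linear_form a * F - G \<in> I"
      using \<open>is_form j F\<close> coset_of_eq_iff[OF I] by blast
  qed
next
  assume all: "\<forall>G. is_form (Suc j) G \<longrightarrow> (\<exists>F. is_form j F \<and> linear_form a * F - G \<in> I)"
  show "mult_map I (linear_form a) ` graded_piece I j = graded_piece I (Suc j)"
  proof (intro equalityI subsetI)
    fix C assume "C \<in> mult_map I (linear_form a) ` graded_piece I j"
    then obtain F where F: "is_form j F" "C = coset_of I (linear_form a * F)"
      unfolding graded_piece_def by (auto simp: mult_map_coset[OF I])
    show "C \<in> graded_piece I (Suc j)"
      unfolding F(2) graded_piece_def using is_form_linear_form_times[OF F(1)] by blast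
  next
    fix C assume "C \<in> graded_piece I (Suc j)"
    then obtain G where G: "is_form (Suc j) G" "C = coset_of I G" unfolding graded_piece_def by blast
    then obtain F where F: "is_form j F" "linear_form a * F - G \<in> I" using all by blast
    have "C = mult_map I (linear_form a) (coset_of I F)"
      unfolding G(2) mult_map_coset[OF I] using F(2) coset_of_eq_iff[OF I] by metis
    then show "C \<in> mult_map I (linear_form a) ` graded_piece I j"
      unfolding graded_piece_def using F(1) by blast
  qed
qed

section \<open>Reduction of general linear forms to those without vanishing coefficients\<close>

lemma torus_open: "openin affine_zariski {a :: 'v::finite \<Rightarrow> 'k::field. \<forall>i. a i \<noteq> 0}"
proof -
  define m :: "'v exponent" where "m = (\<Sum>i\<in>UNIV. single i 1)"
  have l: "lookup m j = 1" for j
    unfolding m_def by (simp add: lookup_sum_mapping lookup_single when_def)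
  have "eval_mpoly a (single m 1) = (\<Prod>i\<in>UNIV. a i)" for a :: "'v \<Rightarrow> 'k"
    by (simp add: eval_monom_UNIV l)
  then have "{a :: 'v \<Rightarrow> 'k. \<forall>i. a i \<noteq> 0} = {a. eval_mpoly a (single m 1) \<noteq> 0}" by auto
  then show ?thesis unfolding affine_zariski_def
    by (intro topology_generated_by_Basis CollectI exI[of _ "single m 1"]) simp
qed

text \<open>On the line \<open>a0 + s (1, ..., 1)\<close> all but finitely many points stay in
  \<open>U\<close>, and each coordinate vanishes for only one \<open>s\<close>.\<close>

lemma open_meets_torus:
  assumes "openin affine_zariski U" "(a0 :: 'v::finite \<Rightarrow> 'k::field_char_0) \<in> U"
  shows "\<exists>a\<in>U. \<forall>i. a i \<noteq> 0"
proof -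
  define \<gamma> :: "'k \<Rightarrow> 'v \<Rightarrow> 'k" where "\<gamma> s = (\<lambda>i. a0 i + s)" for s
  have gen: "generate_topology_on {{a :: 'v \<Rightarrow> 'k. eval_mpoly a F \<noteq> 0} | F. True} U"
    using assms(1) unfolding affine_zariski_def openin_topology_generated_by_iff .
  have fin: "finite {s\<in>UNIV. \<gamma> s \<notin> U}"
  proof (rule generated_open_curve[OF gen assms(2)])
    fix B assume "B \<in> {{a :: 'v \<Rightarrow> 'k. eval_mpoly a F \<noteq> 0} | F. True}" "a0 \<in> B"
    then obtain F :: "('v, 'k) mpoly" where B: "B = {a. eval_mpoly a F \<noteq> 0}" "eval_mpoly a0 F \<noteq> 0" by blast
    define P where "P = (\<Sum>c\<in>keys F. smult (lookup F c) (\<Prod>i\<in>keys c. [:a0 i, 1:] ^ lookup c i))"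
    have P: "poly P s = eval_mpoly (\<gamma> s) F" for s
      by (simp add: P_def poly_sum poly_prod eval_mpoly_def eval_monom_def \<gamma>_def)
    have "\<gamma> 0 = a0" by (simp add: \<gamma>_def)
    then have "poly P 0 \<noteq> 0" using B(2) P by simp
    then have "P \<noteq> 0" by auto
    then have "finite {s. poly P s = 0}" by (rule poly_roots_finite)
    then show "finite {s\<in>UNIV. \<gamma> s \<notin> B}" by (simp add: B P)
  qed
  have "finite {s. a0 i + s = 0}" for i
    by (rule finite_subset[of _ "{- a0 i}"]) (auto simp: add_eq_0_iff)
  then have "finite ({s. \<gamma> s \<notin> U} \<union> (\<Union>i\<in>UNIV. {s. a0 i + s = 0}))" using fin by simp
  then obtain s where "s \<notin> {s. \<gamma> s \<notin> U} \<union> (\<Union>i\<in>UNIV. {s. a0 i + s = 0})"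
    using ex_new_if_finite[OF infinite_UNIV_char_0] by blast
  then show ?thesis by (intro bexI[of _ "\<gamma> s"]) (auto simp: \<gamma>_def)
qed

lemma eval_monom_add_exponent: "eval_monom (a :: 'v::finite \<Rightarrow> 'k::comm_ring_1) (b + c) = eval_monom a b * eval_monom a c"
  by (simp add: eval_monom_UNIV lookup_add power_add prod.distrib)

lemma eval_monom_single: "eval_monom (a :: 'v::finite \<Rightarrow> 'k::comm_ring_1) (single i n) = a i ^ n"
  by (simp add: eval_monom_def)

lemma eval_monom_nonzero: "(\<And>i. a i \<noteq> 0) \<Longrightarrow> eval_monom (a :: 'v::finite \<Rightarrow> 'k::field) b \<noteq> 0"
  by (simp add: eval_monom_UNIV)

text \<open>The torus action \<open>x\<^sub>i \<mapsto> a\<^sub>i x\<^sub>i\<close> reduces every linear form without vanishing coefficients to the sum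
  of the variables.\<close>

lemma linear_form_times_scaled:
  fixes a :: "'v::finite \<Rightarrow> 'k::field"
  assumes a: "\<And>i. a i \<noteq> 0" and F: "\<And>b. lookup F b = f b * eval_monom a b"
  shows "lookup (linear_form a * F) s = lsum f s * eval_monom a s"
proof -
  have "a i * lookup F (s - single i 1) = f (s - single i 1) * eval_monom a s" if "i \<in> keys s" for i
  proof -
    have "eval_monom a s = eval_monom a (s - single i 1) * a i"
      using diff_single_add[OF that] eval_monom_add_exponent[of a "s - single i 1" "single i 1"]
      by (simp add: eval_monom_single)
    then show ?thesis by (simp add: F)
  qed
  then show ?thesis by (simp add: lookup_linear_form_times lsum_def sum_distrib_right)
qed

lemma mapping_of_finite_support:
  assumes "finite {b. g b \<noteq> (0::'k::comm_ring_1)}"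
  shows "\<exists>F. \<forall>b. lookup F b = g b"
  using Abs_poly_mapping_inverse[of g] assms by (intro exI[of _ "Abs_poly_mapping g"]) simp

definition pure_powers :: "nat \<Rightarrow> 'v exponent set" where
  "pure_powers d = range (\<lambda>i. single i d)"

text \<open>\<open>F\<close> corresponds to \<open>f\<close> by dividing the coefficient at
  \<open>b\<close> by \<open>a^b\<close>, and a nonzero \<open>F\<close> lies outside the ideal
  because its degree is below \<open>d\<close>. The right-hand side does not mention
  \<open>a\<close>, so one witness serves all linear forms in the torus.\<close>

lemma noninjective_iff_lsum:
  fixes A :: "'v::finite exponent set" and a :: "'v \<Rightarrow> 'k::field_char_0"
  assumes A: "\<And>m. m \<in> A \<Longrightarrow> exp_degree m = d" and d: "d \<ge> 1" and a: "\<And>i. a i \<noteq> 0"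
  shows "\<not> inj_on (mult_map (mono_ideal A) (linear_form a)) (graded_piece (mono_ideal A) (d - 1)) \<longleftrightarrow>
    (\<exists>f :: 'v exponent \<Rightarrow> 'k. (\<exists>b. f b \<noteq> 0) \<and> (\<forall>b. f b \<noteq> 0 \<longrightarrow> exp_degree b + 1 = d) \<and> (\<forall>s. lsum f s \<noteq> 0 \<longrightarrow> s \<in> A))"
  unfolding not_inj_mult_map_iff[OF is_ideal_mono_ideal]
proof
  assume "\<exists>F. is_form (d - 1) F \<and> F \<notin> mono_ideal A \<and> linear_form a * F \<in> mono_ideal A"
  then obtain F where F: "is_form (d - 1) F" "F \<notin> mono_ideal A" "linear_form a * F \<in> mono_ideal A" by blast
  define f where "f b = lookup F b / eval_monom a b" for b
  have lF: "lookup F b = f b * eval_monom a b" for b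
    unfolding f_def using eval_monom_nonzero[of a b] a by simp
  have "F \<noteq> 0" using F(2) by (auto simp: mono_ideal_def)
  then obtain b where "b \<in> keys F" by (metis keys_eq_empty ex_in_conv)
  then have "f b \<noteq> 0" using lF[of b] by (auto simp: in_keys_iff)
  moreover have "exp_degree b + 1 = d" if "f b \<noteq> 0" for b
  proof -
    have "b \<in> keys F" using that lF[of b] eval_monom_nonzero[of a b] a by (simp add: in_keys_iff)
    then show ?thesis using F(1) d by (simp add: is_form_def)
  qed
  moreover have "s \<in> A" if "lsum f s \<noteq> 0" for s
  proof -
    have "is_form d (linear_form a * F)" using is_form_linear_form_times[OF F(1), of a] d by simp
    then have "keys (linear_form a * F) \<subseteq> A" using form_in_mono_ideal[of A d, OF A] F(3) by blast
    moreover have "lookup (linear_form a * F) s \<noteq> 0"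
      using linear_form_times_scaled[of a F f, OF a lF] that eval_monom_nonzero[of a s] a by simp
    ultimately show ?thesis by (auto simp: in_keys_iff)
  qed
  ultimately show "\<exists>f :: 'v exponent \<Rightarrow> 'k. (\<exists>b. f b \<noteq> 0) \<and> (\<forall>b. f b \<noteq> 0 \<longrightarrow> exp_degree b + 1 = d) \<and> (\<forall>s. lsum f s \<noteq> 0 \<longrightarrow> s \<in> A)"
    by (intro exI[of _ f]) blast
next
  assume "\<exists>f :: 'v exponent \<Rightarrow> 'k. (\<exists>b. f b \<noteq> 0) \<and> (\<forall>b. f b \<noteq> 0 \<longrightarrow> exp_degree b + 1 = d) \<and> (\<forall>s. lsum f s \<noteq> 0 \<longrightarrow> s \<in> A)"
  then obtain f :: "'v exponent \<Rightarrow> 'k" where f: "\<exists>b. f b \<noteq> 0" "\<And>b. f b \<noteq> 0 \<Longrightarrow> exp_degree b + 1 = d" "\<And>s. lsum f s \<noteq> 0 \<Longrightarrow> s \<in> A" by blast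
  have "finite {b. f b * eval_monom a b \<noteq> 0}"
    by (rule finite_subset[OF _ finite_exp_degree[of "d - 1"]]) (use f(2) in force)
  then obtain F where F: "\<And>b. lookup F b = f b * eval_monom a b"
    using mapping_of_finite_support[of "\<lambda>b. f b * eval_monom a b"] by blast
  have form: "is_form (d - 1) F"
    unfolding is_form_def using f(2) by (force simp: in_keys_iff F)
  obtain b where b: "f b \<noteq> 0" using f(1) by blast
  then have bF: "b \<in> keys F" using eval_monom_nonzero[of a b] a by (simp add: in_keys_iff F)
  have "F \<notin> mono_ideal A"
  proof
    assume "F \<in> mono_ideal A"
    then obtain x y where xy: "x \<in> A" "b = x + y" using bF unfolding mono_ideal_def by blast
    have "exp_degree b = d + exp_degree y" using xy A by (simp add: exp_degree_add)
    then show False using f(2)[OF b] by simp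
  qed
  moreover have "linear_form a * F \<in> mono_ideal A"
  proof -
    have "is_form d (linear_form a * F)" using is_form_linear_form_times[OF form, of a] d by simp
    moreover have "keys (linear_form a * F) \<subseteq> A"
      using f(3) linear_form_times_scaled[of a F f, OF a F] by (auto simp: in_keys_iff)
    ultimately show ?thesis using form_in_mono_ideal[of A d, OF A] by blast
  qed
  ultimately show "\<exists>F. is_form (d - 1) F \<and> F \<notin> mono_ideal A \<and> linear_form a * F \<in> mono_ideal A"
    using form by blast
qed

lemma card_monom_image: "card (monom_of ` A :: ('i, 'k::comm_ring_1) mpoly set) = card A"
proof (rule card_image, rule inj_onI)
  fix x y :: "'i exponent" assume "monom_of x = (monom_of y :: ('i, 'k) mpoly)"
  then have "keys (monom_of x :: ('i, 'k) mpoly) = keys (monom_of y :: ('i, 'k) mpoly)" by simp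
  then show "x = y" by (simp add: monom_of_def)
qed

locale minimal_togliatti_exponents =
  fixes A :: "'v::finite exponent set" and d :: nat and I :: "('v, 'k::field_char_0) mpoly set"
  assumes d_pos: "d \<ge> 1" and A_degree: "\<And>m. m \<in> A \<Longrightarrow> exp_degree m = d"
    and I_eq: "I = ideal_gen (monom_of ` A)" and togliatti: "togliatti_system d I"
    and minimal: "\<And>B. B \<subset> A \<Longrightarrow> \<not> monomial_togliatti d (ideal_gen (monom_of ` B) :: ('v, 'k) mpoly set)"
begin

lemma I_mono: "I = mono_ideal A"
  unfolding I_eq by (rule ideal_gen_monomials)

lemmas togliatti_parts = togliatti[unfolded togliatti_system_def I_mono fails_wlp_def general_linear_form_def]

definition fails_at :: "('v \<Rightarrow> 'k) \<Rightarrow> bool" where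
  "fails_at a \<longleftrightarrow> \<not> inj_on (mult_map (mono_ideal A :: ('v, 'k) mpoly set) (linear_form a)) (graded_piece (mono_ideal A) (d - 1)) \<and>
    mult_map (mono_ideal A :: ('v, 'k) mpoly set) (linear_form a) ` graded_piece (mono_ideal A) (d - 1)
       \<noteq> graded_piece (mono_ideal A) (Suc (d - 1))"

lemma fails_open: "\<exists>U :: ('v \<Rightarrow> 'k) set. openin affine_zariski U \<and> U \<noteq> {} \<and> (\<forall>a\<in>U. fails_at a)"
  unfolding fails_at_def by (rule togliatti_parts[THEN conjunct2, THEN conjunct2])

lemma finite_A: "finite A"
  by (rule finite_subset[OF _ finite_exp_degree[of d]]) (use A_degree in blast)

lemma pure_powers_A: "pure_powers d \<subseteq> A"
  using artinian_pure_powers[of A d, OF A_degree togliatti_parts[THEN conjunct2, THEN conjunct1]]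
  by (auto simp: pure_powers_def)

definition admissible :: "('v exponent \<Rightarrow> 'k) \<Rightarrow> bool" where
  "admissible f \<longleftrightarrow> (\<exists>b. f b \<noteq> 0) \<and> (\<forall>b. f b \<noteq> 0 \<longrightarrow> exp_degree b + 1 = d)"

lemma exists_admissible: "\<exists>f. admissible f \<and> (\<forall>s. lsum f s \<noteq> 0 \<longrightarrow> s \<in> A)"
proof -
  obtain U :: "('v \<Rightarrow> 'k) set" where U: "openin affine_zariski U" "U \<noteq> {}"
    "\<forall>a\<in>U. fails_at a"
    using fails_open by (elim exE conjE)
  obtain a0 where "a0 \<in> U" using U(2) by auto
  then obtain a where a: "a \<in> U" "\<And>i. a i \<noteq> 0" using open_meets_torus[OF U(1)] by auto
  have "\<not> inj_on (mult_map (mono_ideal A :: ('v, 'k) mpoly set) (linear_form a)) (graded_piece (mono_ideal A) (d - 1))"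
    using U(3)[THEN bspec, OF a(1)] unfolding fails_at_def by (rule conjunct1)
  from iffD1[OF noninjective_iff_lsum[of A d a, OF A_degree d_pos a(2)] this]
  show ?thesis unfolding admissible_def by (simp only: conj_assoc)
qed

text \<open>The monomials on the right generate a Togliatti system themselves: the pure powers make
  the ideal artinian, \<open>f\<close> shows noninjectivity for every linear form in the torus, and
  surjectivity would carry over to the larger ideal of \<open>A\<close>.\<close>

lemma minimal_support:
  assumes f: "admissible f" "\<And>s. lsum f s \<noteq> 0 \<Longrightarrow> s \<in> A"
  shows "A = {s. lsum f s \<noteq> 0} \<union> pure_powers d"
proof (rule ccontr)
  define B where "B = {s. lsum f s \<noteq> 0} \<union> pure_powers d"
  assume "A \<noteq> {s. lsum f s \<noteq> 0} \<union> pure_powers d"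
  then have BA: "B \<subset> A" using f(2) pure_powers_A unfolding B_def by blast
  then have finB: "finite B" using finite_A finite_subset by blast
  have B_degree: "exp_degree m = d" if "m \<in> B" for m using that BA A_degree by blast
  have sub: "mono_ideal B \<subseteq> (mono_ideal A :: ('v, 'k) mpoly set)"
  proof
    fix F :: "('v, 'k) mpoly" assume F: "F \<in> mono_ideal B"
    show "F \<in> mono_ideal A" unfolding mono_ideal_def
    proof (intro CollectI ballI)
      fix m assume "m \<in> keys F"
      then obtain x y where "x \<in> B" "m = x + y" using F unfolding mono_ideal_def by blast
      then show "\<exists>a\<in>A. \<exists>b. m = a + b" using BA by blast
    qed
  qed
  obtain S :: "('v, 'k) mpoly set" where S: "finite S" "mono_ideal A = ideal_gen S"
     "card S \<le> (let n = CARD('v) - 1 in (n + d - 1) choose (n - 1))"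
    using togliatti_parts[THEN conjunct1] by (elim exE conjE)
  \<comment> \<open>The bound on the number of generators is given for some set \<open>S\<close>
    only; it passes to \<open>A\<close>, and from there to \<open>B\<close>, because no generating
    set is smaller than \<open>A\<close>.\<close>
  have card: "card (monom_of ` B :: ('v, 'k) mpoly set) \<le> card S"
  proof -
    have "card B \<le> card A" using BA finite_A by (intro card_mono) auto
    also have "card A \<le> card S" by (rule card_le_generators[of A d, OF A_degree S(1) S(2)[symmetric]])
    finally show ?thesis by (simp add: card_monom_image)
  qed
  have "\<exists>S. finite S \<and> (\<forall>F\<in>S. is_form d F) \<and> (mono_ideal B :: ('v, 'k) mpoly set) = ideal_gen S \<and>
     card S \<le> (let n = CARD('v) - 1 in (n + d - 1) choose (n - 1))"
  proof (intro exI conjI)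
    show "finite (monom_of ` B)" using finB by simp
    show "\<forall>F\<in>monom_of ` B. is_form d F" using B_degree by (auto simp: is_form_def monom_of_def)
    show "(mono_ideal B :: ('v, 'k) mpoly set) = ideal_gen (monom_of ` B)" by (rule ideal_gen_monomials[symmetric])
    show "card (monom_of ` B :: ('v, 'k) mpoly set) \<le> (let n = CARD('v) - 1 in (n + d - 1) choose (n - 1))"
      using card S(3) by (rule order_trans)
  qed
  moreover have "artinian_ideal (mono_ideal B :: ('v, 'k) mpoly set)"
    by (rule pure_powers_artinian[of d]) (auto simp: B_def pure_powers_def)
  moreover have "fails_wlp (d - 1) (mono_ideal B :: ('v, 'k) mpoly set)"
  proof -
    obtain U :: "('v \<Rightarrow> 'k) set" where U: "openin affine_zariski U" "U \<noteq> {}"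
      "\<forall>a\<in>U. fails_at a"
      using fails_open by (elim exE conjE)
    obtain a0 where "a0 \<in> U" using U(2) by auto
    let ?U = "U \<inter> {a. \<forall>i. a i \<noteq> 0}"
    have "openin affine_zariski ?U" by (rule openin_Int[OF U(1) torus_open])
    moreover have "?U \<noteq> {}" using open_meets_torus[OF U(1) \<open>a0 \<in> U\<close>] by auto
    moreover have "\<not> inj_on (mult_map (mono_ideal B) (linear_form a)) (graded_piece (mono_ideal B) (d - 1)) \<and>
      mult_map (mono_ideal B) (linear_form a) ` graded_piece (mono_ideal B) (d - 1) \<noteq> graded_piece (mono_ideal B) (Suc (d - 1))"
      if a: "a \<in> ?U" for a
    proof
      have a0: "\<And>i. a i \<noteq> 0" and aU: "a \<in> U" using a by auto
      show "\<not> inj_on (mult_map (mono_ideal B) (linear_form a)) (graded_piece (mono_ideal B) (d - 1))"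
        by (rule iffD2[OF noninjective_iff_lsum[of B d a, OF B_degree d_pos a0]])
          (use f(1) in \<open>auto simp: admissible_def B_def intro!: exI[of _ f]\<close>)
      show "mult_map (mono_ideal B) (linear_form a) ` graded_piece (mono_ideal B) (d - 1) \<noteq> graded_piece (mono_ideal B) (Suc (d - 1))"
      proof
        assume "mult_map (mono_ideal B) (linear_form a) ` graded_piece (mono_ideal B) (d - 1) = graded_piece (mono_ideal B) (Suc (d - 1))"
        then have "\<forall>G. is_form (Suc (d - 1)) G \<longrightarrow> (\<exists>F. is_form (d - 1) F \<and> linear_form a * F - G \<in> mono_ideal B)"
          unfolding surj_mult_map_iff[OF is_ideal_mono_ideal] .
        then have "\<forall>G. is_form (Suc (d - 1)) G \<longrightarrow> (\<exists>F. is_form (d - 1) F \<and> linear_form a * F - G \<in> mono_ideal A)"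
          by (meson sub subsetD)
        then show False using U(3)[THEN bspec, OF aU] unfolding fails_at_def surj_mult_map_iff[OF is_ideal_mono_ideal] by simp
      qed
    qed
    ultimately show ?thesis unfolding fails_wlp_def general_linear_form_def
      by (intro exI[of _ ?U] conjI ballI) simp_all
  qed
  ultimately have "togliatti_system d (mono_ideal B :: ('v, 'k) mpoly set)"
    unfolding togliatti_system_def by (intro conjI)
  then have "monomial_togliatti d (ideal_gen (monom_of ` B) :: ('v, 'k) mpoly set)"
    unfolding monomial_togliatti_def ideal_gen_monomials[symmetric] by (intro conjI exI[of _ B]) simp_all
  then show False using minimal[OF BA] by simp
qed

end

section \<open>The main theorem\<close>

lemma card_pure_powers: "d \<ge> 1 \<Longrightarrow> card (pure_powers d :: 'v::finite exponent set) = CARD('v)"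
proof -
  assume "d \<ge> 1"
  then obtain e where "d = Suc e" by (cases d) auto
  then have "inj (\<lambda>i :: 'v. single i d)" by (auto simp: inj_def dest: single_Suc_inject)
  then show ?thesis unfolding pure_powers_def by (simp add: card_image)
qed

lemma lsum_indicator_support:
  fixes b :: "'v::finite exponent"
  assumes "\<And>x. f x \<noteq> (0::'k::field_char_0) \<Longrightarrow> x = b"
  shows "{s. lsum f s \<noteq> 0} \<subseteq> range (\<lambda>i. b + single i 1)"
proof
  fix s assume "s \<in> {s. lsum f s \<noteq> 0}"
  then obtain i where i: "i \<in> keys s" "f (s - single i 1) \<noteq> 0"
    unfolding lsum_def mem_Collect_eq by (meson sum.neutral)
  then have "s = b + single i 1" using assms[OF i(2)] diff_single_add[OF i(1)] by simp
  then show "s \<in> range (\<lambda>i. b + single i 1)" by blast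
qed

lemma (in linear_multiple) S_eq: "S = {s. lsum f s \<noteq> 0} - pure_powers d"
  unfolding S_def pure_powers_def by auto

theorem proposition4p4:
  fixes n d :: nat
  assumes "CARD('v::finite) = n + 1" and "n \<ge> 3" and "d \<ge> 4"
  shows "\<not> (\<exists>I \<in> (minimal_smooth_monomial_togliatti d
      :: ('v, 'k::{alg_closed_field, field_char_0}) mpoly set set). min_num_gens I = 2 * n + 3)"
proof
  assume "\<exists>I \<in> (minimal_smooth_monomial_togliatti d :: ('v, 'k) mpoly set set). min_num_gens I = 2 * n + 3"
  then obtain I :: "('v, 'k) mpoly set" where I: "monomial_togliatti d I" "smooth_togliatti d I" "minimal_togliatti d I"
    and gens: "min_num_gens I = 2 * n + 3"
    unfolding minimal_smooth_monomial_togliatti_def by auto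
  obtain A :: "'v exponent set" where A: "\<forall>m\<in>A. exp_degree m = d" "I = ideal_gen (monom_of ` A)"
    "\<forall>B. B \<subset> A \<longrightarrow> \<not> monomial_togliatti d (ideal_gen (monom_of ` B) :: ('v, 'k) mpoly set)"
    using I(3) unfolding minimal_togliatti_def by (elim exE conjE)
  interpret mt: minimal_togliatti_exponents A d I
    by unfold_locales (use A I(1) assms(3) in \<open>simp_all add: monomial_togliatti_def\<close>)
  have I_mono: "I = mono_ideal A" by (rule mt.I_mono)
  have cardA: "card A = 2 * n + 3"
  proof (rule antisym)
    have ex: "\<exists>S :: ('v, 'k) mpoly set. finite S \<and> card S = card A \<and> ideal_gen S = I"
      using mt.finite_A A(2) card_monom_image[of A] by (intro exI[of _ "monom_of ` A"]) simp
    have "\<exists>S :: ('v, 'k) mpoly set. finite S \<and> card S = min_num_gens I \<and> ideal_gen S = I"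
      unfolding min_num_gens_def by (rule LeastI[of "\<lambda>r. \<exists>S. finite S \<and> card S = r \<and> ideal_gen S = I", OF ex])
    then obtain S :: "('v, 'k) mpoly set" where S: "finite S" "card S = min_num_gens I" "ideal_gen S = I" by (elim exE conjE)
    then show "card A \<le> 2 * n + 3"
      using card_le_generators[of A d S, OF mt.A_degree] I_mono gens by simp
    have "min_num_gens I \<le> card A"
      unfolding min_num_gens_def by (rule Least_le) (rule ex)
    then show "2 * n + 3 \<le> card A" using gens by simp
  qed
  have pure: "card (pure_powers d :: 'v exponent set) = n + 1"
    using card_pure_powers[where 'v = 'v, of d] assms by simp
  have fin_pure: "finite (pure_powers d :: 'v exponent set)" by (simp add: pure_powers_def)
  obtain f where f: "mt.admissible f" "\<And>s. lsum f s \<noteq> 0 \<Longrightarrow> s \<in> A" using mt.exists_admissible by auto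
  have Asupp: "A = {s. lsum f s \<noteq> 0} \<union> pure_powers d" by (rule mt.minimal_support[OF f])
  interpret lm: linear_multiple f d
    by unfold_locales (use assms(3) f(1) in \<open>auto simp: mt.admissible_def\<close>)
  have AS: "A = lm.S \<union> pure_powers d" unfolding lm.S_eq using Asupp by auto
  have "card A = card lm.S + card (pure_powers d :: 'v exponent set)"
    unfolding AS by (rule card_Un_disjoint) (use fin_pure lm.finite_S in \<open>auto simp: lm.S_eq\<close>)
  then have cardS: "card lm.S = n + 2" using cardA pure by simp
  have memA: "(monom_of m :: ('v, 'k) mpoly) \<in> mono_ideal A \<longleftrightarrow> m \<in> A" if "exp_degree m = d" for m
    by (rule monom_of_in_mono_ideal[OF mt.A_degree that])
  have MA: "lm.M = complement_exponents d I"
    unfolding lm.M_def complement_exponents_def I_mono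
    using memA AS by (auto simp: pure_powers_def)
  interpret mv: monomial_variety lm.M "togliatti_variety d I" d
  proof
    show "finite lm.M" by (rule finite_subset[OF _ finite_exp_degree[of d]]) (auto simp: lm.M_def)
    show "togliatti_variety d I = proj_zariski lm.M closure_of {monomial_map lm.M a | a. monomial_map lm.M a \<noteq> 0}"
      unfolding togliatti_variety_def MA by (simp add: Let_def)
  qed (use assms(3) in \<open>auto simp: lm.M_def\<close>)
  have smooth: "smooth_projective lm.M (togliatti_variety d I)"
    using I(2) unfolding smooth_togliatti_def MA .
  interpret sm: smooth_multiple f d
  proof
    show "card lm.S = CARD('v) + 1" "CARD('v) \<ge> 4" using cardS assms by simp_all
    show False if "is_vertex lm.M m" "keys m \<union> keys a1 \<union> keys a2 \<union> keys a3 \<subseteq> {t,k,j}"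
      "distinct [a1,a2,a3]" "atom_at lm.M m a1" "atom_at lm.M m a2" "atom_at lm.M m a3" for m t k j a1 a2 a3
      by (rule mv.smooth_no_three_atoms[OF smooth that])
    show "\<exists>k. k \<noteq> t \<and> single k 1 + single t (d - 1) \<notin> lm.S" if "t \<in> lm.T" for t
    proof (rule ccontr)
      assume n: "\<not> (\<exists>k. k \<noteq> t \<and> single k 1 + single t (d - 1) \<notin> lm.S)"
      let ?b = "single t (d - 1)"
      \<comment> \<open>If all neighbours of \<open>x_t^d\<close> were in \<open>S\<close>, the
        monomial \<open>x_t^(d-1)\<close> would be an admissible form whose product is supported in
        \<open>A\<close>. Minimality then bounds \<open>card A\<close> by
        \<open>n + (n + 1)\<close>, short of \<open>2n + 3\<close>.\<close>
      define h where "h = (\<lambda>x. if x = ?b then 1 else (0::'k))"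
      have sub: "{s. lsum h s \<noteq> 0} \<subseteq> range (\<lambda>i. ?b + single i 1)"
        by (rule lsum_indicator_support) (simp add: h_def split: if_splits)
      have "?b + single i 1 \<in> A" for i
      proof (cases "i = t")
        case True
        have "?b + single t 1 = single t d" using assms(3) by (simp flip: single_add)
        then show ?thesis using True mt.pure_powers_A by (auto simp: pure_powers_def)
      next
        case False
        then have "single i 1 + ?b \<in> lm.S" using n by blast
        then show ?thesis unfolding AS by (simp add: add.commute)
      qed
      then have subA: "s \<in> A" if "lsum h s \<noteq> 0" for s using sub that by blast
      have "mt.admissible h"
        using assms(3) by (auto simp: mt.admissible_def h_def split: if_splits)
      then have eq: "A = {s. lsum h s \<noteq> 0} \<union> pure_powers d" using subA by (rule mt.minimal_support)
      have "A \<subseteq> (\<lambda>i. ?b + single i 1) ` (UNIV - {t}) \<union> pure_powers d"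
      proof
        fix s assume "s \<in> A"
        then consider "s \<in> pure_powers d" | i where "s = ?b + single i 1" using eq sub by blast
        then show "s \<in> (\<lambda>i. ?b + single i 1) ` (UNIV - {t}) \<union> pure_powers d"
        proof cases
          case (2 i)
          show ?thesis
          proof (cases "i = t")
            case True
            have "s = single t d" using 2 True assms(3) by (simp flip: single_add)
            then show ?thesis by (simp add: pure_powers_def)
          qed (use 2 in auto)
        qed simp
      qed
      then have "card A \<le> card ((\<lambda>i. ?b + single i 1) ` (UNIV - {t}) \<union> pure_powers d)"
        by (rule card_mono[rotated]) (simp add: fin_pure)
      also have "\<dots> \<le> card ((\<lambda>i. ?b + single i 1) ` (UNIV - {t})) + card (pure_powers d :: 'v exponent set)"
        by (rule card_Un_le)
      also have "card ((\<lambda>i. ?b + single i 1) ` (UNIV - {t})) \<le> card (UNIV - {t} :: 'v set)"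
        by (rule card_image_le) simp
      finally show False using cardA pure assms by (simp add: card_Diff_singleton)
    qed
  qed
  have supp_S: "{s. lsum f s \<noteq> 0} = lm.S"
    using sm.T_empty unfolding lm.S_eq lm.T_def pure_powers_def by auto
  have finf: "finite (supp f)"
    by (rule finite_subset[OF _ finite_exp_degree[of "d - 1"]]) (use lm.f_degree in \<open>force simp: in_supp\<close>)
  show False
  proof (cases "card (supp f) \<ge> 2")
    \<comment> \<open>The product has at least \<open>2 (n + 1) - 2 = 2n\<close> terms, more than
      \<open>n + 2\<close> since \<open>n >= 3\<close>.\<close>
    case True
    have "2 * card (UNIV :: 'v set) \<le> card (supp (lsum_on UNIV f)) + 2"
      by (rule card_supp_lsum_on_nonmonomial[OF finf True])
    then show False using cardS assms supp_S by (simp add: lsum_on_UNIV supp_def)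
  next
    case False
    obtain b where b: "f b \<noteq> 0" using f(1) unfolding mt.admissible_def by blast
    have "card (supp f) = 1" using False b finf by (cases "card (supp f)") (auto simp: in_supp)
    then obtain b where "supp f = {b}" by (auto simp: card_1_singleton_iff)
    then have "x = b" if "f x \<noteq> 0" for x using that by (auto simp: supp_def)
    then have "lm.S \<subseteq> range (\<lambda>i. b + single i 1)"
      unfolding supp_S[symmetric] by (rule lsum_indicator_support)
    then have "card lm.S \<le> card (range (\<lambda>i. b + single i 1))" by (rule card_mono[rotated]) simp
    also have "\<dots> \<le> CARD('v)" by (rule card_image_le) simp
    finally show False using cardS assms by simp
  qed
qed

end
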